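(* Let $d\in\mathbb{C}^\times$. Fiber functors on $\mathcal{O}_d$ are completely classified, up to natural (monoidal) equivalence, by the similarity orbits (orbits under $B\mapsto T^{-1}BT$, $T\in\mathrm{GL}(n,\mathbb{C})$) in the sets $$\{B\in\mathrm{GL}(n,\mathbb{C});\ \mathrm{trace}(B)=d=\mathrm{trace}(B^{-1})\},\qquad n\ge1.$$
   Context: A Kauffman diagram of type $(m,n)$ is a planar isotopy class (boundary fixed) of $(m+n)/2$ pairwise disjoint strings (arcs, no closed loops) in a rectangle, joining in pairs $m$ points on the upper edge and $n$ points on the lower edge. An oriented Kauffman diagram is one in which every string is oriented. Label an upper vertex by $X$ if a string starts there and by $X^*$ if a string ends there; label a lower vertex by $X$ if a string ends there and by $X^*$ if a string starts there. Reading labels from left to right gives an upper word $w$ and a lower word $w'$ in the letters $X,X^*$; the diagram is of type $(w,w')$. Let $K_{w,w'}$ be the set of oriented Kauffman diagrams of type $(w,w')$. $\mathcal{O}_d$ is the strict $\mathbb{C}$-linear tensor category whose objects are the symbols $X^w$ for finite (possibly empty) words $w$ in $X,X^*$, with $\mathrm{Hom}(X^w,X^{w'})=\mathbb{C}[K_{w,w'}]$ (the vector space with basis $K_{w,w'}$). Composition is the bilinear extension of vertical concatenation (first map on top), each resulting closed loop being replaced by the scalar $d$. The tensor product is concatenation of words and horizontal juxtaposition of diagrams; the unit object is $I=X^\emptyset$. The basic arcs $\epsilon_X:X\otimes X^*\to I$ and $\epsilon_{X^*}:X^*\otimes X\to I$ are the unique diagrams of these types. A fiber functor is a $\mathbb{C}$-linear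 monoidal functor $\Phi$ from $\mathcal{O}_d$ to the tensor category of finite-dimensional complex vector spaces (faithfulness is not required; monoidal functors are taken strict, the tensor product of vector spaces being treated as strictly associative). Two fiber functors are naturally equivalent if they are related by a monoidal natural isomorphism. The correspondence: the bilinear forms $E=\Phi(\epsilon_X):V\otimes W\to\mathbb{C}$ and $F=\Phi(\epsilon_{X^*}):W\otimes V\to\mathbb{C}$, with $V=\Phi(X)$, $W=\Phi(X^* )$, are non-degenerate; with $n=\dim V=\dim W$, choose bases $\{v_i\}$ of $V$ and $\{w_j\}$ of $W$ with $E(v_i\otimes w_j)=\delta_{ij}$; the matrix attached to $\Phi$ is $B=(b_{ji})$ with $b_{ji}=F(w_j\otimes v_i)$. *)

theory Defs
  imports "HOL-Library.Poly_Mapping" "HOL-Library.FuncSet" "Jordan_Normal_Form.Matrix"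
begin

subsection \<open>Oriented Kauffman diagrams\<close>

datatype letter = X | X_star

type_synonym word = "letter list"

text \<open>Boundary points of the rectangle, numbered from the left starting with 0.\<close>

datatype point = Up nat | Lo nat

text \<open>
  A planar isotopy class (with fixed boundary) of pairwise disjoint arcs in a rectangle is
  determined by which boundary points are joined, and the pairings that occur are exactly the
  non-crossing ones. An oriented diagram is represented by its set of strings, each string being
  the pair (starting point, end point).
\<close>

type_synonym diagram = "(point \<times> point) set"

definition points :: "nat \<Rightarrow> nat \<Rightarrow> point set" where
  "points m n = Up ` {..<m} \<union> Lo ` {..<n}"

text \<open>Rank of a boundary point when the boundary is traversed clockwise from the upper left
  corner; the lower edge is then met from right to left.\<close>

fun rank :: "nat \<Rightarrow> nat \<Rightarrow> point \<Rightarrow> nat" where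
  "rank m n (Up i) = i"
| "rank m n (Lo j) = m + (n - 1 - j)"

definition crossing :: "nat \<Rightarrow> nat \<Rightarrow> point \<times> point \<Rightarrow> point \<times> point \<Rightarrow> bool" where
  "crossing m n s t \<longleftrightarrow>
     (\<exists>a b c e. {fst s, snd s} = {a, c} \<and> {fst t, snd t} = {b, e} \<and>
        rank m n a < rank m n b \<and> rank m n b < rank m n c \<and> rank m n c < rank m n e)"

definition oriented_kauffman :: "nat \<Rightarrow> nat \<Rightarrow> diagram \<Rightarrow> bool" where
  "oriented_kauffman m n D \<longleftrightarrow>
     (\<forall>s\<in>D. fst s \<in> points m n \<and> snd s \<in> points m n \<and> fst s \<noteq> snd s) \<and>
     (\<forall>p\<in>points m n. \<exists>!s. s \<in> D \<and> (p = fst s \<or> p = snd s)) \<and>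
     (\<forall>s\<in>D. \<forall>t\<in>D. \<not> crossing m n s t)"

definition upper_word :: "nat \<Rightarrow> diagram \<Rightarrow> word" where
  "upper_word m D = map (\<lambda>i. if Up i \<in> fst ` D then X else X_star) [0..<m]"

definition lower_word :: "nat \<Rightarrow> diagram \<Rightarrow> word" where
  "lower_word n D = map (\<lambda>j. if Lo j \<in> snd ` D then X else X_star) [0..<n]"

definition K :: "word \<Rightarrow> word \<Rightarrow> diagram set" where
  "K w w' = {D. oriented_kauffman (length w) (length w') D \<and>
                upper_word (length w) D = w \<and> lower_word (length w') D = w'}"

subsection \<open>Operations on diagrams\<close>

definition id_diagram :: "word \<Rightarrow> diagram" where
  "id_diagram w = {(Up i, Lo i) |i. i < length w \<and> w ! i = X} \<union>
                  {(Lo i, Up i) |i. i < length w \<and> w ! i = X_star}"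

text \<open>Vertical concatenation of \<open>D\<close> (on top) and \<open>D'\<close>: the lower points of \<open>D\<close> and the upper
  points of \<open>D'\<close> are both identified with the points \<open>Mid k\<close>, and \<open>glue D D'\<close> is the resulting
  set of oriented segments.\<close>

datatype glued_point = Top nat | Mid nat | Bot nat

fun upper_half :: "point \<Rightarrow> glued_point" where
  "upper_half (Up i) = Top i"
| "upper_half (Lo k) = Mid k"

fun lower_half :: "point \<Rightarrow> glued_point" where
  "lower_half (Up k) = Mid k"
| "lower_half (Lo j) = Bot j"

fun outer :: "point \<Rightarrow> glued_point" where
  "outer (Up i) = Top i"
| "outer (Lo j) = Bot j"

definition glue :: "diagram \<Rightarrow> diagram \<Rightarrow> (glued_point \<times> glued_point) set" where
  "glue D D' = map_prod upper_half upper_half ` D \<union> map_prod lower_half lower_half ` D'"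

text \<open>Orientations match at the glued points, so the strings of the concatenation are the
  directed paths between outer points, and its closed loops are the directed cycles; a cycle is
  counted through its set of vertices.\<close>

definition vconcat :: "diagram \<Rightarrow> diagram \<Rightarrow> diagram" where
  "vconcat D D' = {(s, t). (outer s, outer t) \<in> (glue D D')\<^sup>+}"

definition loops :: "diagram \<Rightarrow> diagram \<Rightarrow> nat" where
  "loops D D' = card {(glue D D')\<^sup>* `` {p} |p. (p, p) \<in> (glue D D')\<^sup>+}"

fun shift :: "nat \<Rightarrow> nat \<Rightarrow> point \<Rightarrow> point" where
  "shift m n (Up i) = Up (m + i)"
| "shift m n (Lo j) = Lo (n + j)"

definition hconcat :: "nat \<Rightarrow> nat \<Rightarrow> diagram \<Rightarrow> diagram \<Rightarrow> diagram" where
  "hconcat m n D D' = D \<union> map_prod (shift m n) (shift m n) ` D'"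

subsection \<open>The tensor category\<close>

text \<open>The objects are the words, with concatenation as tensor product and the empty word as unit.
  \<open>hom w w'\<close> is the vector space with basis \<open>K w w'\<close>; the composition \<open>comp d g f\<close> is ``\<open>g\<close>
  after \<open>f\<close>'', so that the diagrams of \<open>f\<close> are put on top.\<close>

type_synonym morphism = "diagram \<Rightarrow>\<^sub>0 complex"

definition hom :: "word \<Rightarrow> word \<Rightarrow> morphism set" where
  "hom w w' = {f. Poly_Mapping.keys f \<subseteq> K w w'}"

definition smult :: "complex \<Rightarrow> morphism \<Rightarrow> morphism" where
  "smult c f = Poly_Mapping.map ((*) c) f"

definition ident :: "word \<Rightarrow> morphism" where
  "ident w = Poly_Mapping.single (id_diagram w) 1"

definition comp :: "complex \<Rightarrow> morphism \<Rightarrow> morphism \<Rightarrow> morphism" where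
  "comp d g f =
     (\<Sum>D\<in>Poly_Mapping.keys f. \<Sum>D'\<in>Poly_Mapping.keys g.
        Poly_Mapping.single (vconcat D D')
          (Poly_Mapping.lookup f D * Poly_Mapping.lookup g D' * d ^ loops D D'))"

definition tensor :: "nat \<Rightarrow> nat \<Rightarrow> morphism \<Rightarrow> morphism \<Rightarrow> morphism" where
  "tensor m n f g =
     (\<Sum>D\<in>Poly_Mapping.keys f. \<Sum>D'\<in>Poly_Mapping.keys g.
        Poly_Mapping.single (hconcat m n D D')
          (Poly_Mapping.lookup f D * Poly_Mapping.lookup g D'))"

text \<open>The unique diagrams of types \<open>([X, X_star], [])\<close> and \<open>([X_star, X], [])\<close>.\<close>

definition eps_X :: morphism where
  "eps_X = Poly_Mapping.single {(Up 0, Up 1)} 1"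

definition eps_X_star :: morphism where
  "eps_X_star = Poly_Mapping.single {(Up 1, Up 0)} 1"

subsection \<open>Finite-dimensional vector spaces\<close>

text \<open>Finite-dimensional complex vector spaces are rendered as the finite-dimensional subspaces of
  an arbitrary infinite-dimensional complex vector space, which serves as a universe: every
  finite-dimensional space is isomorphic to one of its subspaces.\<close>

locale vect_universe = vector_space scale
  for scale :: "complex \<Rightarrow> 'v::ab_group_add \<Rightarrow> 'v" (infixr \<open>*s\<close> 75) +
  assumes infinite_dimensional: "\<exists>S. infinite S \<and> independent S"
begin

definition fin_dim :: "'v set \<Rightarrow> bool" where
  "fin_dim U \<longleftrightarrow> subspace U \<and> (\<exists>S. finite S \<and> span S = U)"

definition linear_between :: "'v set \<Rightarrow> 'v set \<Rightarrow> ('v \<Rightarrow> 'v) \<Rightarrow> bool" where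
  "linear_between U V f \<longleftrightarrow> f \<in> U \<rightarrow> V \<and>
     (\<forall>x\<in>U. \<forall>y\<in>U. f (x + y) = f x + f y) \<and> (\<forall>c. \<forall>x\<in>U. f (c *s x) = c *s f x)"

definition bilinear_between :: "'v set \<Rightarrow> 'v set \<Rightarrow> 'v set \<Rightarrow> ('v \<Rightarrow> 'v \<Rightarrow> 'v) \<Rightarrow> bool" where
  "bilinear_between U V Z b \<longleftrightarrow>
     (\<forall>x\<in>U. linear_between V Z (b x)) \<and> (\<forall>y\<in>V. linear_between U Z (\<lambda>x. b x y))"

text \<open>\<open>T\<close> is a tensor product of \<open>U\<close> and \<open>V\<close> with \<open>x \<otimes> y = t x y\<close>; a linear map is only
  determined on its domain.\<close>

definition is_tensor_product :: "'v set \<Rightarrow> 'v set \<Rightarrow> 'v set \<Rightarrow> ('v \<Rightarrow> 'v \<Rightarrow> 'v) \<Rightarrow> bool" where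
  "is_tensor_product U V T t \<longleftrightarrow> bilinear_between U V T t \<and>
     (\<forall>Z b. subspace Z \<longrightarrow> bilinear_between U V Z b \<longrightarrow>
        (\<exists>L. linear_between T Z L \<and> (\<forall>x\<in>U. \<forall>y\<in>V. L (t x y) = b x y) \<and>
          (\<forall>L'. linear_between T Z L' \<longrightarrow> (\<forall>x\<in>U. \<forall>y\<in>V. L' (t x y) = b x y) \<longrightarrow>
             (\<forall>z\<in>T. L' z = L z))))"

definition basis_of :: "'v set \<Rightarrow> nat \<Rightarrow> (nat \<Rightarrow> 'v) \<Rightarrow> bool" where
  "basis_of V n v \<longleftrightarrow>
     inj_on v {..<n} \<and> independent (v ` {..<n}) \<and> span (v ` {..<n}) = V"

end

subsection \<open>Fiber functors\<close>

text \<open>The image of the object \<open>w\<close> is \<open>obj w\<close> and the image of a morphism \<open>f\<close> from \<open>w\<close> to \<open>w'\<close> is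
  \<open>mor w w' f\<close>. The space \<open>obj (w @ w')\<close> is the tensor product of \<open>obj w\<close> and \<open>obj w'\<close>, with
  \<open>tens w w' a b\<close> in the role of \<open>a \<otimes> b\<close>; \<open>obj []\<close> is the field of scalars, with \<open>one\<close> in the
  role of the number 1. Values outside of the relevant subspaces and hom spaces are irrelevant.\<close>

record 'v functor_data =
  obj :: "word \<Rightarrow> 'v set"
  mor :: "word \<Rightarrow> word \<Rightarrow> morphism \<Rightarrow> 'v \<Rightarrow> 'v"
  tens :: "word \<Rightarrow> word \<Rightarrow> 'v \<Rightarrow> 'v \<Rightarrow> 'v"
  one :: 'v

locale fiber_functor = vect_universe scale
  for scale :: "complex \<Rightarrow> 'v::ab_group_add \<Rightarrow> 'v" (infixr \<open>*s\<close> 75) +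
  fixes d :: complex and \<Phi> :: "'v functor_data"
  assumes obj_fin_dim: "fin_dim (obj \<Phi> w)"
    and mor_linear: "f \<in> hom w w' \<Longrightarrow> linear_between (obj \<Phi> w) (obj \<Phi> w') (mor \<Phi> w w' f)"
    and mor_ident: "a \<in> obj \<Phi> w \<Longrightarrow> mor \<Phi> w w (ident w) a = a"
    and mor_comp: "f \<in> hom w w' \<Longrightarrow> g \<in> hom w' w'' \<Longrightarrow> a \<in> obj \<Phi> w \<Longrightarrow>
      mor \<Phi> w w'' (comp d g f) a = mor \<Phi> w' w'' g (mor \<Phi> w w' f a)"
    and mor_add: "f \<in> hom w w' \<Longrightarrow> g \<in> hom w w' \<Longrightarrow> a \<in> obj \<Phi> w \<Longrightarrow>
      mor \<Phi> w w' (f + g) a = mor \<Phi> w w' f a + mor \<Phi> w w' g a"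
    and mor_smult: "f \<in> hom w w' \<Longrightarrow> a \<in> obj \<Phi> w \<Longrightarrow>
      mor \<Phi> w w' (smult c f) a = c *s mor \<Phi> w w' f a"
    and tens_tensor_product:
      "is_tensor_product (obj \<Phi> w) (obj \<Phi> w') (obj \<Phi> (w @ w')) (tens \<Phi> w w')"
    and tens_assoc: "a \<in> obj \<Phi> w \<Longrightarrow> b \<in> obj \<Phi> w' \<Longrightarrow> c' \<in> obj \<Phi> w'' \<Longrightarrow>
      tens \<Phi> (w @ w') w'' (tens \<Phi> w w' a b) c' = tens \<Phi> w (w' @ w'') a (tens \<Phi> w' w'' b c')"
    and one_basis: "one \<Phi> \<noteq> 0" "obj \<Phi> [] = span {one \<Phi>}"
    and tens_one: "a \<in> obj \<Phi> w \<Longrightarrow> tens \<Phi> [] w (one \<Phi>) a = a"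
      "a \<in> obj \<Phi> w \<Longrightarrow> tens \<Phi> w [] a (one \<Phi>) = a"
    and mor_tensor: "f \<in> hom w1 w1' \<Longrightarrow> g \<in> hom w2 w2' \<Longrightarrow> a \<in> obj \<Phi> w1 \<Longrightarrow> b \<in> obj \<Phi> w2 \<Longrightarrow>
      mor \<Phi> (w1 @ w2) (w1' @ w2') (tensor (length w1) (length w1') f g) (tens \<Phi> w1 w2 a b) =
      tens \<Phi> w1' w2' (mor \<Phi> w1 w1' f a) (mor \<Phi> w2 w2' g b)"

context vect_universe
begin

text \<open>Existence of a monoidal natural isomorphism.\<close>

definition naturally_equivalent :: "'v functor_data \<Rightarrow> 'v functor_data \<Rightarrow> bool" where
  "naturally_equivalent \<Phi> \<Psi> \<longleftrightarrow> (\<exists>\<theta> :: word \<Rightarrow> 'v \<Rightarrow> 'v.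
     (\<forall>w. linear_between (obj \<Phi> w) (obj \<Psi> w) (\<theta> w) \<and>
          bij_betw (\<theta> w) (obj \<Phi> w) (obj \<Psi> w)) \<and>
     (\<forall>w w'. \<forall>f\<in>hom w w'. \<forall>a\<in>obj \<Phi> w. \<theta> w' (mor \<Phi> w w' f a) = mor \<Psi> w w' f (\<theta> w a)) \<and>
     (\<forall>w w'. \<forall>a\<in>obj \<Phi> w. \<forall>b\<in>obj \<Phi> w'.
          \<theta> (w @ w') (tens \<Phi> w w' a b) = tens \<Psi> w w' (\<theta> w a) (\<theta> w' b)) \<and>
     \<theta> [] (one \<Phi>) = one \<Psi>)"

definition scalar_of :: "'v functor_data \<Rightarrow> 'v \<Rightarrow> complex" where
  "scalar_of \<Phi> z = (THE c. z = c *s one \<Phi>)"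

definition E_form :: "'v functor_data \<Rightarrow> 'v \<Rightarrow> 'v \<Rightarrow> complex" where
  "E_form \<Phi> v w = scalar_of \<Phi> (mor \<Phi> [X, X_star] [] eps_X (tens \<Phi> [X] [X_star] v w))"

definition F_form :: "'v functor_data \<Rightarrow> 'v \<Rightarrow> 'v \<Rightarrow> complex" where
  "F_form \<Phi> w v = scalar_of \<Phi> (mor \<Phi> [X_star, X] [] eps_X_star (tens \<Phi> [X_star] [X] w v))"

text \<open>All matrices attached to a functor, for all choices of dual bases; the row index is the
  one of \<open>w\<close>.\<close>

definition attached_matrices :: "'v functor_data \<Rightarrow> complex mat set" where
  "attached_matrices \<Phi> = {B. \<exists>n v w.
     basis_of (obj \<Phi> [X]) n v \<and> basis_of (obj \<Phi> [X_star]) n w \<and>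
     (\<forall>i<n. \<forall>j<n. E_form \<Phi> (v i) (w j) = (if i = j then 1 else 0)) \<and>
     B = mat n n (\<lambda>(j, i). F_form \<Phi> (w j) (v i))}"

end

subsection \<open>Similarity orbits\<close>

definition mat_trace :: "complex mat \<Rightarrow> complex" where
  "mat_trace A = (\<Sum>i<dim_row A. A $$ (i, i))"

definition trace_matrices :: "nat \<Rightarrow> complex \<Rightarrow> complex mat set" where
  "trace_matrices n d = {B \<in> carrier_mat n n. \<exists>C \<in> carrier_mat n n.
     inverts_mat B C \<and> inverts_mat C B \<and> mat_trace B = d \<and> d = mat_trace C}"

definition similarity_orbits :: "complex \<Rightarrow> complex mat set set" where
  "similarity_orbits d = (\<Union>n\<in>{1..}. (\<lambda>B. {A. similar_mat A B}) ` trace_matrices n d)"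

end

theory Submission
  imports Defs "Jordan_Normal_Form.Determinant" "HOL-Library.Nat_Bijection"
begin

text \<open>
  An innermost arc shows that every diagram is a composite of identities and elementary caps and
  cups, each with a single arc besides vertical strings. So a fiber functor is determined by its two
  spaces and its values on the four arcs. The snake identities make the two lower arcs the
  coevaluation vectors of the forms \<open>E\<close> and \<open>F\<close>: in bases dual for \<open>E\<close> they have the identity matrix
  and the inverse of \<open>B\<close> as coefficients, and the two oriented circles give the conditions on the traces. Another choice of
  dual bases conjugates \<open>B\<close>, and functors with the same matrix are identified by the tensor powers of
  the map matching the dual bases.

  Conversely, given \<open>B\<close>, a diagram is sent to the tensor whose coefficients are products over its
  strings of entries of \<open>B\<close> to the power 1, 0 or -1, according to how the string turns. Functoriality
  is shown by peeling elementary diagrams off the lower factor, using that vertical concatenation is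
  associative and that the loop count is additive. The only case in which strings get joined
  nontrivially is that of a single cap below a diagram; there the turning exponents add up because
  the diagram is noncrossing, and a closed loop contributes the trace of \<open>B\<close> or of its inverse.
\<close>

text \<open>Planarity is kept apart from the joining of strings. Concatenation, its associativity
  and the loop count concern only matchings from starting points to end points, seen as directed
  graphs in which every point has at most one edge in and one edge out. Planarity enters where a
  diagram is taken apart or evaluated: it supplies an arc between neighbours, it forces a diagram
  without returning strings to be an identity, and it makes the turning exponents additive. The
  exponents come from the choice of bases. Once \<open>E\<close> has the identity matrix, only
  \<open>F\<close> and the coevaluation belonging to it carry information, so a string picks up
  \<open>B\<close> or its inverse exactly when it runs through one of these two. Tensor products are
  known only by their universal property, so vectors in them are handled by expansion over a basis
  of the first factor. In the construction strict associativity is obtained by labelling one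
  independent family of vectors by lists, with concatenation of lists as tensor product.\<close>

fun dual :: "letter \<Rightarrow> letter" where
  "dual X = X_star" | "dual X_star = X"

lemma neq_X_iff [simp]: "x \<noteq> X \<longleftrightarrow> x = X_star" "x \<noteq> X_star \<longleftrightarrow> x = X"
  by (cases x; simp)+

lemma dual_eq_iff [simp]: "dual x = X \<longleftrightarrow> x = X_star" "dual x = X_star \<longleftrightarrow> x = X"
  by (cases x; simp)+

section \<open>Diagrams as noncrossing matchings\<close>

definition starts :: "word \<Rightarrow> word \<Rightarrow> point set" where
  "starts w w' = {Up i |i. i < length w \<and> w ! i = X} \<union> {Lo j |j. j < length w' \<and> w' ! j = X_star}"

definition ends :: "word \<Rightarrow> word \<Rightarrow> point set" where
  "ends w w' = {Up i |i. i < length w \<and> w ! i = X_star} \<union> {Lo j |j. j < length w' \<and> w' ! j = X}"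

lemma starts_simps [simp]:
  "Up i \<in> starts w w' \<longleftrightarrow> i < length w \<and> w ! i = X"
  "Lo j \<in> starts w w' \<longleftrightarrow> j < length w' \<and> w' ! j = X_star"
  by (auto simp: starts_def)

lemma ends_simps [simp]:
  "Up i \<in> ends w w' \<longleftrightarrow> i < length w \<and> w ! i = X_star"
  "Lo j \<in> ends w w' \<longleftrightarrow> j < length w' \<and> w' ! j = X"
  by (auto simp: ends_def)

lemma points_simps [simp]: "Up i \<in> points m n \<longleftrightarrow> i < m" "Lo j \<in> points m n \<longleftrightarrow> j < n"
  by (auto simp: points_def)

lemma starts_Int_ends: "starts w w' \<inter> ends w w' = {}"
  by (auto simp: starts_def ends_def)

lemma starts_Un_ends: "starts w w' \<union> ends w w' = points (length w) (length w')"
proof -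
  have "p \<in> starts w w' \<union> ends w w' \<longleftrightarrow> p \<in> points (length w) (length w')" for p
    by (cases p) (auto simp flip: neq_X_iff(1))
  then show ?thesis by blast
qed

text \<open>The part of membership in \<open>K\<close> that does not involve planarity: a bijection,
  written as a relation, from the starting points to the end points prescribed by the two
  words.\<close>

definition matching :: "word \<Rightarrow> word \<Rightarrow> diagram \<Rightarrow> bool" where
  "matching w w' D \<longleftrightarrow> single_valued D \<and> single_valued (D\<inverse>) \<and>
     Domain D = starts w w' \<and> Range D = ends w w'"

definition noncrossing :: "nat \<Rightarrow> nat \<Rightarrow> diagram \<Rightarrow> bool" where
  "noncrossing m n D \<longleftrightarrow> (\<forall>s\<in>D. \<forall>t\<in>D. \<not> crossing m n s t)"

text \<open>Asymmetric, as the chord \<open>a c\<close> has to begin first. Two chords avoid each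
  other only if both orders are excluded, which \<open>noncrossing\<close> does by ranging over all
  ordered pairs of strings.\<close>

definition crossed :: "nat \<Rightarrow> nat \<Rightarrow> nat \<Rightarrow> nat \<Rightarrow> bool" where
  "crossed a c b e \<longleftrightarrow> min a c < min b e \<and> min b e < max a c \<and> max a c < max b e"

text \<open>The sets in \<open>crossing\<close> leave open which end of a string has the smaller
  rank, while \<open>crossed\<close> decides it by min and max. The four cases are the possible
  orders within the two pairs.\<close>

lemma crossing_iff:
  "crossing m n (a, c) (b, e) \<longleftrightarrow>
     crossed (rank m n a) (rank m n c) (rank m n b) (rank m n e)"
proof
  assume "crossing m n (a, c) (b, e)"
  then show "crossed (rank m n a) (rank m n c) (rank m n b) (rank m n e)"
    by (force simp: crossing_def crossed_def doubleton_eq_iff)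
next
  assume *: "crossed (rank m n a) (rank m n c) (rank m n b) (rank m n e)"
  let ?r = "rank m n"
  consider "?r a \<le> ?r c" "?r b \<le> ?r e" | "?r a \<le> ?r c" "?r e \<le> ?r b"
    | "?r c \<le> ?r a" "?r b \<le> ?r e" | "?r c \<le> ?r a" "?r e \<le> ?r b"
    by linarith
  then show "crossing m n (a, c) (b, e)"
  proof cases
    case 1
    show ?thesis unfolding crossing_def
      by (rule exI[of _ a], rule exI[of _ b], rule exI[of _ c], rule exI[of _ e]) (use 1 * in \<open>auto simp: crossed_def min_def max_def split: if_splits\<close>)
  next
    case 2
    show ?thesis unfolding crossing_def
      by (rule exI[of _ a], rule exI[of _ e], rule exI[of _ c], rule exI[of _ b]) (use 2 * in \<open>auto simp: crossed_def min_def max_def split: if_splits\<close>)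
  next
    case 3
    show ?thesis unfolding crossing_def
      by (rule exI[of _ c], rule exI[of _ b], rule exI[of _ a], rule exI[of _ e]) (use 3 * in \<open>auto simp: crossed_def min_def max_def split: if_splits\<close>)
  next
    case 4
    show ?thesis unfolding crossing_def
      by (rule exI[of _ c], rule exI[of _ e], rule exI[of _ a], rule exI[of _ b]) (use 4 * in \<open>auto simp: crossed_def min_def max_def split: if_splits\<close>)
  qed
qed

lemma noncrossing_iff:
  "noncrossing m n D \<longleftrightarrow> (\<forall>(a, c)\<in>D. \<forall>(b, e)\<in>D.
     \<not> crossed (rank m n a) (rank m n c) (rank m n b) (rank m n e))"
  unfolding noncrossing_def by (simp add: split_paired_Ball_Sigma case_prod_beta flip: crossing_iff)

lemma noncrossingD:
  assumes "noncrossing m n D" "(a, c) \<in> D" "(b, e) \<in> D"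
  shows "\<not> crossed (rank m n a) (rank m n c) (rank m n b) (rank m n e)"
  using assms by (auto simp: noncrossing_iff)

lemma matching_mem:
  assumes "matching w w' D" "(s, t) \<in> D"
  shows "s \<in> starts w w'" "t \<in> ends w w'" "s \<in> points (length w) (length w')"
    "t \<in> points (length w) (length w')" "s \<noteq> t"
  using assms starts_Int_ends[of w w'] starts_Un_ends[of w w'] unfolding matching_def by blast+

lemma matching_out: "matching w w' D \<Longrightarrow> s \<in> starts w w' \<Longrightarrow> \<exists>t. (s, t) \<in> D"
  unfolding matching_def by blast

lemma matching_in: "matching w w' D \<Longrightarrow> t \<in> ends w w' \<Longrightarrow> \<exists>s. (s, t) \<in> D"
  unfolding matching_def by blast

lemma matching_unique:
  assumes "matching w w' D"
  shows "(s, t) \<in> D \<Longrightarrow> (s, t') \<in> D \<Longrightarrow> t = t'" "(s, t) \<in> D \<Longrightarrow> (s', t) \<in> D \<Longrightarrow> s = s'"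
  using assms unfolding matching_def single_valued_def by blast+

lemma matching_unique':
  assumes "matching w w' D" "(s, t) \<in> D" "(s', t') \<in> D"
  shows "s = s' \<longleftrightarrow> t = t'" "s \<noteq> t'" "t \<noteq> s'"
  using matching_unique[OF assms(1)] assms matching_mem[OF assms(1)] starts_Int_ends[of w w'] by blast+

lemma if_letter_eq_iff: "(if b then X else X_star) = x \<longleftrightarrow> (b \<longleftrightarrow> x = X)"
  by (cases x) auto

text \<open>A label \<open>X\<close> says directly that an upper point lies in the domain, or a
  lower point in the range. Since every point lies on exactly one string and at one end of it, the
  label \<open>X_star\<close> then puts the point into the other of these two sets.\<close>

lemma K_iff: "D \<in> K w w' \<longleftrightarrow> matching w w' D \<and> noncrossing (length w) (length w') D"
proof -
  let ?P = "points (length w) (length w')"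
  have labels: "upper_word (length w) D = w \<longleftrightarrow> (\<forall>i<length w. Up i \<in> Domain D \<longleftrightarrow> w ! i = X)"
    "lower_word (length w') D = w' \<longleftrightarrow> (\<forall>j<length w'. Lo j \<in> Range D \<longleftrightarrow> w' ! j = X)"
    unfolding upper_word_def lower_word_def list_eq_iff_nth_eq Domain_fst Range_snd
    by (simp_all add: if_letter_eq_iff)
  show ?thesis
  proof
    assume D: "D \<in> K w w'"
    then have ok: "oriented_kauffman (length w) (length w') D"
      and words: "upper_word (length w) D = w" "lower_word (length w') D = w'"
      unfolding K_def by blast+
    note ok' = ok[unfolded oriented_kauffman_def]
    have ends: "s \<in> ?P \<and> t \<in> ?P \<and> s \<noteq> t" if "(s, t) \<in> D" for s t
      using bspec[OF conjunct1[OF ok'] that] by simp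
    have ex: "\<exists>!s. s \<in> D \<and> (p = fst s \<or> p = snd s)" if "p \<in> ?P" for p
      by (rule bspec[OF conjunct1[OF conjunct2[OF ok']] that])
    have nc: "noncrossing (length w) (length w') D"
      unfolding noncrossing_def by (rule conjunct2[OF conjunct2[OF ok']])
    have up: "Up i \<in> Domain D \<longleftrightarrow> w ! i = X" if "i < length w" for i
      using words that labels by blast
    have lo: "Lo j \<in> Range D \<longleftrightarrow> w' ! j = X" if "j < length w'" for j
      using words that labels by blast
    have uniq: "s = s' \<and> t = t'" if "(s, t) \<in> D" "(s', t') \<in> D" "p \<in> {s, t}" "p \<in> {s', t'}" for s t s' t' p
    proof -
      have "p \<in> ?P" using ends that by blast
      from ex[OF this] have "(s, t) = (s', t')"
        by (rule ex1E) (use that in \<open>metis fst_conv insertE singletonD snd_conv\<close>)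
      then show ?thesis by simp
    qed
    have cover: "p \<in> Domain D \<union> Range D" if "p \<in> ?P" for p
      using ex[OF that] by (metis DomainI RangeI UnCI prod.collapse)
    have disj: "p \<notin> Range D" if "p \<in> Domain D" for p
    proof
      assume "p \<in> Range D"
      with that obtain q r where "(p, q) \<in> D" "(r, p) \<in> D" by blast
      with uniq[of p q r p p] ends show False by blast
    qed
    have "p \<in> Domain D \<longleftrightarrow> p \<in> starts w w'" "p \<in> Range D \<longleftrightarrow> p \<in> ends w w'" for p
    proof -
      have "(p \<in> Domain D \<longleftrightarrow> p \<in> starts w w') \<and> (p \<in> Range D \<longleftrightarrow> p \<in> ends w w')"
      proof (cases "p \<in> ?P")
        case True
        then show ?thesis using cover[OF True] disj[of p] up lo
          by (cases p) (auto simp flip: neq_X_iff(1))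
      next
        case False
        then have "p \<notin> Domain D" "p \<notin> Range D" using ends by blast+
        moreover have "p \<notin> starts w w'" "p \<notin> ends w w'" using False starts_Un_ends by blast+
        ultimately show ?thesis by blast
      qed
      then show "p \<in> Domain D \<longleftrightarrow> p \<in> starts w w'" "p \<in> Range D \<longleftrightarrow> p \<in> ends w w'" by auto
    qed
    moreover have "single_valued D" "single_valued (D\<inverse>)"
      unfolding single_valued_def using uniq by blast+
    ultimately show "matching w w' D \<and> noncrossing (length w) (length w') D"
      using nc unfolding matching_def by blast
  next
    assume *: "matching w w' D \<and> noncrossing (length w) (length w') D"
    then have m: "matching w w' D" ..
    have dom: "Domain D = starts w w'" "Range D = ends w w'" using m by (auto simp: matching_def)
    have "\<exists>!s. s \<in> D \<and> (p = fst s \<or> p = snd s)" if "p \<in> ?P" for p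
    proof -
      have "p \<in> starts w w' \<or> p \<in> ends w w'" using that starts_Un_ends by blast
      then obtain s where s: "s \<in> D" "p = fst s \<or> p = snd s"
        using matching_out[OF m] matching_in[OF m] by (metis fst_conv snd_conv)
      moreover have "s' = s" if "s' \<in> D" "p = fst s' \<or> p = snd s'" for s'
      proof (cases s; cases s')
        fix a b a' b' assume eq: "s = (a, b)" "s' = (a', b')"
        then have "a = a' \<longleftrightarrow> b = b'" "a \<noteq> b'" "b \<noteq> a'"
          using matching_unique'[OF m, of a b a' b'] s(1) that(1) by blast+
        then show "s' = s" using that(2) s(2) unfolding eq by fastforce
      qed
      ultimately show ?thesis by blast
    qed
    moreover have "\<forall>s\<in>D. fst s \<in> ?P \<and> snd s \<in> ?P \<and> fst s \<noteq> snd s"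
      using matching_mem[OF m] by (metis prod.collapse)
    ultimately have "oriented_kauffman (length w) (length w') D"
      using * unfolding oriented_kauffman_def noncrossing_def by blast
    moreover have "upper_word (length w) D = w" "lower_word (length w') D = w'"
      unfolding labels dom by simp_all
    ultimately show "D \<in> K w w'" unfolding K_def by blast
  qed
qed

lemma K_matching: "D \<in> K w w' \<Longrightarrow> matching w w' D"
  by (simp add: K_iff)

lemma finite_points [simp]: "finite (points m n)"
  by (simp add: points_def)

lemma matching_finite: "matching w w' D \<Longrightarrow> finite D"
  by (rule finite_subset[of _ "points (length w) (length w') \<times> points (length w) (length w')"])
    (auto dest: matching_mem)

text \<open>The two words already fix domain and range, so a larger matching has no room for a
  further string. Equalities of diagrams thereby reduce to one inclusion.\<close>

lemma matching_subset_eq: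
  assumes "matching w w' R" "matching w w' D" "R \<subseteq> D"
  shows "R = D"
proof (intro subset_antisym assms subrelI)
  fix s t assume "(s, t) \<in> D"
  then obtain t' where "(s, t') \<in> R" using matching_mem(1)[OF assms(2)] matching_out[OF assms(1)] by blast
  then show "(s, t) \<in> R" using matching_unique[OF assms(2)] \<open>(s, t) \<in> D\<close> assms(3) by blast
qed

subsection \<open>Relabelling\<close>

abbreviation relabel :: "(point \<Rightarrow> point) \<Rightarrow> diagram \<Rightarrow> diagram" where
  "relabel f \<equiv> image (map_prod f f)"

definition rank_mono :: "nat \<Rightarrow> nat \<Rightarrow> nat \<Rightarrow> nat \<Rightarrow> (point \<Rightarrow> point) \<Rightarrow> bool" where
  "rank_mono m n m' n' f \<longleftrightarrow> (\<forall>p\<in>points m n. \<forall>q\<in>points m n.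
     rank m' n' (f p) < rank m' n' (f q) \<longleftrightarrow> rank m n p < rank m n q)"

lemma rank_inj: "p \<in> points m n \<Longrightarrow> q \<in> points m n \<Longrightarrow> rank m n p = rank m n q \<longleftrightarrow> p = q"
  by (cases p; cases q) auto

lemma crossed_mono:
  assumes "\<And>x y. x \<in> {a, c, b, e} \<Longrightarrow> y \<in> {a, c, b, e} \<Longrightarrow> g x < g y \<longleftrightarrow> h x < (h y :: nat)"
  shows "crossed (g a) (g c) (g b) (g e) \<longleftrightarrow> crossed (h a) (h c) (h b) (h e)"
  unfolding crossed_def min_less_iff_disj less_max_iff_disj min_less_iff_conj
    max_less_iff_conj by (simp add: assms)

lemma noncrossing_relabel:
  assumes "rank_mono m n m' n' f" "D \<subseteq> points m n \<times> points m n"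
  shows "noncrossing m' n' (relabel f D) \<longleftrightarrow> noncrossing m n D"
proof -
  have "crossed (rank m' n' (f (fst s))) (rank m' n' (f (snd s))) (rank m' n' (f (fst t))) (rank m' n' (f (snd t))) \<longleftrightarrow>
      crossed (rank m n (fst s)) (rank m n (snd s)) (rank m n (fst t)) (rank m n (snd t))"
    if "s \<in> D" "t \<in> D" for s t
  proof (rule crossed_mono)
    have "fst s \<in> points m n" "snd s \<in> points m n" "fst t \<in> points m n" "snd t \<in> points m n"
      using that assms(2) by auto
    then show "rank m' n' (f x) < rank m' n' (f y) \<longleftrightarrow> rank m n x < rank m n y"
      if "x \<in> {fst s, snd s, fst t, snd t}" "y \<in> {fst s, snd s, fst t, snd t}" for x y
      using assms(1) that unfolding rank_mono_def by blast
  qed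
  then show ?thesis by (simp add: noncrossing_iff case_prod_beta)
qed

section \<open>Juxtaposition of diagrams\<close>

lemma mem_starts_append:
  "p \<in> starts (w1 @ w2) (w1' @ w2') \<longleftrightarrow>
     p \<in> starts w1 w1' \<or> p \<in> shift (length w1) (length w1') ` starts w2 w2'"
proof (cases p)
  case (Up i)
  have "Up i \<in> shift (length w1) (length w1') ` starts w2 w2' \<longleftrightarrow>
      length w1 \<le> i \<and> Up (i - length w1) \<in> starts w2 w2'"
  proof
    assume "Up i \<in> shift (length w1) (length w1') ` starts w2 w2'"
    then obtain q where q: "q \<in> starts w2 w2'" "Up i = shift (length w1) (length w1') q" by blast
    then show "length w1 \<le> i \<and> Up (i - length w1) \<in> starts w2 w2'" by (cases q) auto
  next
    assume *: "length w1 \<le> i \<and> Up (i - length w1) \<in> starts w2 w2'"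
    show "Up i \<in> shift (length w1) (length w1') ` starts w2 w2'"
      by (rule image_eqI[of _ _ "Up (i - length w1)"]) (use * in auto)
  qed
  then show ?thesis unfolding Up by (auto simp: nth_append)
next
  case (Lo j)
  have "Lo j \<in> shift (length w1) (length w1') ` starts w2 w2' \<longleftrightarrow>
      length w1' \<le> j \<and> Lo (j - length w1') \<in> starts w2 w2'"
  proof
    assume "Lo j \<in> shift (length w1) (length w1') ` starts w2 w2'"
    then obtain q where q: "q \<in> starts w2 w2'" "Lo j = shift (length w1) (length w1') q" by blast
    then show "length w1' \<le> j \<and> Lo (j - length w1') \<in> starts w2 w2'" by (cases q) auto
  next
    assume *: "length w1' \<le> j \<and> Lo (j - length w1') \<in> starts w2 w2'"
    show "Lo j \<in> shift (length w1) (length w1') ` starts w2 w2'"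
      by (rule image_eqI[of _ _ "Lo (j - length w1')"]) (use * in auto)
  qed
  then show ?thesis unfolding Lo by (auto simp: nth_append)
qed

lemma starts_append:
  "starts (w1 @ w2) (w1' @ w2') = starts w1 w1' \<union> shift (length w1) (length w1') ` starts w2 w2'"
  using mem_starts_append by blast

text \<open>Reversing all strings exchanges starting points and end points; statements about
  \<open>ends\<close> are obtained in this way from those about \<open>starts\<close>.\<close>

lemma ends_eq_starts: "ends w w' = starts (map dual w) (map dual w')"
  by (auto simp: starts_def ends_def)

lemma ends_append:
  "ends (w1 @ w2) (w1' @ w2') = ends w1 w1' \<union> shift (length w1) (length w1') ` ends w2 w2'"
  by (simp add: ends_eq_starts starts_append)

lemma inj_shift: "inj (shift m n)"
proof (rule injI)
  show "p = q" if "shift m n p = shift m n q" for p q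
    using that by (cases p; cases q) auto
qed

lemma shift_notin_points: "shift m n p \<notin> points m n"
  by (cases p) auto

lemma single_valued_relabel: "inj f \<Longrightarrow> single_valued D \<Longrightarrow> single_valued (map_prod f f ` D)"
  unfolding single_valued_def by (auto dest: injD)

lemma converse_map_prod_image: "(map_prod f f ` D)\<inverse> = map_prod f f ` (D\<inverse>)"
  by force

lemma Domain_map_prod_image: "Domain (map_prod f f ` D) = f ` Domain D"
  "Range (map_prod f f ` D) = f ` Range D"
  by force+

lemma single_valued_Un:
  assumes "single_valued A" "single_valued B" "Domain A \<inter> Domain B = {}"
  shows "single_valued (A \<union> B)"
  using assms unfolding single_valued_def by blast

lemma matching_hconcat:
  assumes D: "matching w1 w1' D" and D': "matching w2 w2' D'"
  shows "matching (w1 @ w2) (w1' @ w2') (hconcat (length w1) (length w1') D D')"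
proof -
  let ?f = "shift (length w1) (length w1')"
  have "starts w1 w1' \<inter> ?f ` starts w2 w2' = {}" "ends w1 w1' \<inter> ?f ` ends w2 w2' = {}"
    using starts_Un_ends[of w1 w1'] shift_notin_points by blast+
  then show ?thesis
    using D D' unfolding matching_def hconcat_def starts_append ends_append converse_Un
      converse_map_prod_image Domain_Un_eq Range_Un_eq
    by (simp add: Domain_map_prod_image single_valued_Un single_valued_relabel inj_shift)
qed

lemma rank_mono_id: "rank_mono m n (m + m') (n + n') id"
  unfolding rank_mono_def
proof (intro ballI)
  fix p q assume "p \<in> points m n" "q \<in> points m n"
  then show "rank (m + m') (n + n') (id p) < rank (m + m') (n + n') (id q) \<longleftrightarrow> rank m n p < rank m n q"
    by (cases p; cases q) auto
qed

lemma rank_mono_shift: "rank_mono m' n' (m + m') (n + n') (shift m n)"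
  unfolding rank_mono_def
proof (intro ballI)
  fix p q assume "p \<in> points m' n'" "q \<in> points m' n'"
  then show "rank (m + m') (n + n') (shift m n p) < rank (m + m') (n + n') (shift m n q) \<longleftrightarrow>
      rank m' n' p < rank m' n' q"
    by (cases p; cases q) auto
qed

lemma not_crossed_interval:
  assumes "a < l \<or> h \<le> a" "c < l \<or> h \<le> c" "l \<le> b" "b < h" "l \<le> e" "e < h"
  shows "\<not> crossed a c b e" "\<not> crossed b e a c"
  using assms unfolding crossed_def by auto

text \<open>In the clockwise numbering the right-hand diagram occupies an interval of ranks and the
  left-hand one its complement, so a string of one of them never separates the two ends of a string
  of the other.\<close>

lemma K_hconcat:
  assumes D: "D \<in> K w1 w1'" and D': "D' \<in> K w2 w2'"
  shows "hconcat (length w1) (length w1') D D' \<in> K (w1 @ w2) (w1' @ w2')"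
proof -
  define m n m' n' where mn: "m = length w1" "n = length w1'" "m' = length w2" "n' = length w2'"
  have m: "matching w1 w1' D" "matching w2 w2' D'" using D D' by (simp_all add: K_iff)
  have sub: "D \<subseteq> points m n \<times> points m n" "D' \<subseteq> points m' n' \<times> points m' n'"
    using matching_mem(3,4)[OF m(1)] matching_mem(3,4)[OF m(2)] by (auto simp: mn)
  have nc: "noncrossing (m + m') (n + n') D"
    using noncrossing_relabel[OF rank_mono_id sub(1), of m' n'] D
    by (simp add: K_iff mn map_prod.id)
  have nc': "noncrossing (m + m') (n + n') (relabel (shift m n) D')"
    using noncrossing_relabel[OF rank_mono_shift sub(2), of m n] D' by (simp add: K_iff mn)
  let ?r = "rank (m + m') (n + n')"
  have r: "?r p < m \<or> m + m' + n' \<le> ?r p" if "p \<in> points m n" for p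
    using that by (cases p) auto
  have r': "m \<le> ?r (shift m n p) \<and> ?r (shift m n p) < m + m' + n'" if "p \<in> points m' n'" for p
    using that by (cases p) auto
  have "\<not> crossed (?r a) (?r c) (?r (shift m n b)) (?r (shift m n e))"
    "\<not> crossed (?r (shift m n b)) (?r (shift m n e)) (?r a) (?r c)"
    if "(a, c) \<in> D" "(b, e) \<in> D'" for a c b e
    using not_crossed_interval[of "?r a" m "m + m' + n'" "?r c" "?r (shift m n b)" "?r (shift m n e)"]
      r[of a] r[of c] r'[of b] r'[of e] that sub by blast+
  then have "noncrossing (m + m') (n + n') (hconcat m n D D')"
    using nc nc' unfolding hconcat_def noncrossing_iff ball_Un by (auto split: prod.splits)
  then show ?thesis using matching_hconcat[OF m] by (simp add: K_iff mn)
qed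

subsection \<open>Vertical concatenation\<close>

text \<open>If no path from \<open>s\<close> stopped, the successor map would be an injective
  self-map of the finite set of points reachable from \<open>s\<close>, hence surjective, and
  \<open>s\<close> would have a predecessor.\<close>

lemma finite_path:
  assumes "finite G" "single_valued G" "single_valued (G\<inverse>)" "s \<in> Domain G" "s \<notin> Range G"
  shows "\<exists>t. (s, t) \<in> G\<^sup>+ \<and> t \<in> Range G \<and> t \<notin> Domain G"
proof (rule ccontr)
  assume no: "\<nexists>t. (s, t) \<in> G\<^sup>+ \<and> t \<in> Range G \<and> t \<notin> Domain G"
  define S where "S = G\<^sup>* `` {s}"
  have "S \<subseteq> insert s (Range G)"
    unfolding S_def by (auto elim: rtranclE)
  then have fin: "finite S" using finite_Range[OF assms(1)] by (meson finite_insert finite_subset)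
  have dom: "x \<in> Domain G" if "x \<in> S" for x
  proof (cases "x = s")
    case False
    then have "(s, x) \<in> G\<^sup>+" using that unfolding S_def by (auto simp: rtrancl_eq_or_trancl)
    then have "x \<in> Range G" by (metis Range.intros tranclE)
    then show ?thesis using no \<open>(s, x) \<in> G\<^sup>+\<close> by blast
  qed (use assms in simp)
  then have "\<forall>x\<in>S. \<exists>y. (x, y) \<in> G" by blast
  then obtain g where g: "\<And>x. x \<in> S \<Longrightarrow> (x, g x) \<in> G" by metis
  have "inj_on g S"
  proof (rule inj_onI)
    fix x y assume "x \<in> S" "y \<in> S" "g x = g y"
    then show "x = y" using g[of x] g[of y] assms(3) by (metis converse.intros single_valuedD)
  qed
  moreover have "g ` S \<subseteq> S" using g unfolding S_def by (auto intro: rtrancl.rtrancl_into_rtrancl)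
  ultimately have "g ` S = S" by (rule endo_inj_surj[OF fin, rotated])
  moreover have "s \<in> S" by (simp add: S_def)
  ultimately obtain x where "x \<in> S" "s = g x" by (metis imageE)
  then show False using g[of x] assms(5) by (metis Range.intros)
qed

lemma trancl_unique_end:
  assumes "single_valued G" "(s, t) \<in> G\<^sup>+" "(s, t') \<in> G\<^sup>+" "t \<notin> Domain G" "t' \<notin> Domain G"
  shows "t = t'"
proof -
  have "(t, t') \<in> G\<^sup>* \<or> (t', t) \<in> G\<^sup>*"
    by (rule single_valued_confluent[OF assms(1) trancl_into_rtrancl[OF assms(2)] trancl_into_rtrancl[OF assms(3)]])
  then show ?thesis using assms(4,5) by (metis Domain.DomainI converse_rtranclE)
qed

lemma half_inj: "upper_half s = upper_half t \<longleftrightarrow> s = t" "lower_half s = lower_half t \<longleftrightarrow> s = t"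
  "outer s = outer t \<longleftrightarrow> s = t"
  by (cases s; cases t; simp)+

lemma half_eq: "upper_half s = lower_half t \<longleftrightarrow> (\<exists>k. s = Lo k \<and> t = Up k)"
  "lower_half t = upper_half s \<longleftrightarrow> (\<exists>k. s = Lo k \<and> t = Up k)"
  by (cases s; cases t; auto)+

lemma glueI: "(s, t) \<in> D \<Longrightarrow> (upper_half s, upper_half t) \<in> glue D D'"
  "(s, t) \<in> D' \<Longrightarrow> (lower_half s, lower_half t) \<in> glue D D'"
  unfolding glue_def by force+

lemma glueE:
  assumes "(x, y) \<in> glue D D'"
  obtains (upper) s t where "(s, t) \<in> D" "x = upper_half s" "y = upper_half t"
    | (lower) s t where "(s, t) \<in> D'" "x = lower_half s" "y = lower_half t"
  using assms unfolding glue_def by auto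

text \<open>At a glued point the letter of the middle word decides: for \<open>X\<close> the upper
  diagram arrives and the lower one departs, for \<open>X_star\<close> the other way round. So the
  two diagrams never compete for the same direction.\<close>

lemma single_valued_glue:
  assumes "matching w w' D" "matching w' w'' D'"
  shows "single_valued (glue D D')" "single_valued ((glue D D')\<inverse>)"
proof -
  have out: False if "(Lo k, t) \<in> D" "(Up k, t') \<in> D'" for k t t'
    using matching_mem(1)[OF assms(1) that(1)] matching_mem(1)[OF assms(2) that(2)] by simp
  have inn: False if "(t, Lo k) \<in> D" "(t', Up k) \<in> D'" for k t t'
    using matching_mem(2)[OF assms(1) that(1)] matching_mem(2)[OF assms(2) that(2)] by simp
  show "single_valued (glue D D')"
  proof (rule single_valuedI)
    fix x y z assume xy: "(x, y) \<in> glue D D'" and xz: "(x, z) \<in> glue D D'"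
    from xy show "y = z"
    proof (cases rule: glueE)
      case (upper s t)
      from xz show ?thesis
        by (cases rule: glueE)
          (use upper out matching_unique(1)[OF assms(1)] in \<open>auto simp: half_inj half_eq\<close>)
    next
      case (lower s t)
      from xz show ?thesis
        by (cases rule: glueE)
          (use lower out matching_unique(1)[OF assms(2)] in \<open>auto simp: half_inj half_eq\<close>)
    qed
  qed
  show "single_valued ((glue D D')\<inverse>)"
  proof (rule single_valuedI)
    fix x y z assume "(x, y) \<in> (glue D D')\<inverse>" "(x, z) \<in> (glue D D')\<inverse>"
    then have xy: "(y, x) \<in> glue D D'" and xz: "(z, x) \<in> glue D D'" by auto
    from xy show "y = z"
    proof (cases rule: glueE)
      case (upper s t)
      from xz show ?thesis
        by (cases rule: glueE)
          (use upper inn matching_unique(2)[OF assms(1)] in \<open>auto simp: half_inj half_eq\<close>)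
    next
      case (lower s t)
      from xz show ?thesis
        by (cases rule: glueE)
          (use lower inn matching_unique(2)[OF assms(2)] in \<open>auto simp: half_inj half_eq\<close>)
    qed
  qed
qed

lemma matching_starts_iff:
  assumes "matching w w' D"
  shows "p \<in> Domain D \<longleftrightarrow> p \<in> starts w w'" "p \<in> Range D \<longleftrightarrow> p \<in> ends w w'"
  using assms by (auto simp: matching_def)

lemma Domain_glue: "Domain (glue D D') = upper_half ` Domain D \<union> lower_half ` Domain D'"
  "Range (glue D D') = upper_half ` Range D \<union> lower_half ` Range D'"
  unfolding glue_def by (auto simp: Domain_Un_eq Range_Un_eq Domain_map_prod_image)

lemma half_image_simps [simp]:
  "Top i \<in> upper_half ` A \<longleftrightarrow> Up i \<in> A" "Mid i \<in> upper_half ` A \<longleftrightarrow> Lo i \<in> A" "Bot i \<notin> upper_half ` A"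
  "Top i \<notin> lower_half ` A" "Mid i \<in> lower_half ` A \<longleftrightarrow> Up i \<in> A" "Bot i \<in> lower_half ` A \<longleftrightarrow> Lo i \<in> A"
proof -
  have "Top i = upper_half p \<longleftrightarrow> p = Up i" "Mid i = upper_half p \<longleftrightarrow> p = Lo i" "Bot i \<noteq> upper_half p"
    "Top i \<noteq> lower_half p" "Mid i = lower_half p \<longleftrightarrow> p = Up i" "Bot i = lower_half p \<longleftrightarrow> p = Lo i" for p
    by (cases p; auto)+
  then show "Top i \<in> upper_half ` A \<longleftrightarrow> Up i \<in> A" "Mid i \<in> upper_half ` A \<longleftrightarrow> Lo i \<in> A" "Bot i \<notin> upper_half ` A"
    "Top i \<notin> lower_half ` A" "Mid i \<in> lower_half ` A \<longleftrightarrow> Up i \<in> A" "Bot i \<in> lower_half ` A \<longleftrightarrow> Lo i \<in> A"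
    by (auto simp: image_iff)
qed

lemma glue_Domain_iff:
  assumes "matching w w' D" "matching w' w'' D'"
  shows "outer p \<in> Domain (glue D D') \<longleftrightarrow> p \<in> starts w w''"
    "outer p \<in> Range (glue D D') \<longleftrightarrow> p \<in> ends w w''"
    "Mid k \<in> Domain (glue D D') \<longleftrightarrow> k < length w'"
    "Mid k \<in> Range (glue D D') \<longleftrightarrow> k < length w'"
  using assms by ((cases p)?; auto simp: Domain_glue matching_starts_iff simp flip: neq_X_iff(1))+

lemma outer_or_Mid: "(\<exists>p. x = outer p) \<or> (\<exists>k. x = Mid k)"
  by (cases x) (metis outer.simps(1), blast, metis outer.simps(2))

lemma vconcat_iff: "(s, t) \<in> vconcat D D' \<longleftrightarrow> (outer s, outer t) \<in> (glue D D')\<^sup>+"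
  by (simp add: vconcat_def)

lemma finite_glue: "finite D \<Longrightarrow> finite D' \<Longrightarrow> finite (glue D D')"
  by (simp add: glue_def)

text \<open>Every glued point has an edge in and an edge out, so a maximal path can only stop at an
  outer point, which gives each starting point its end point. The same argument in the converse
  graph shows that every end point is reached.\<close>

lemma matching_vconcat:
  assumes "matching w w' D" "matching w' w'' D'"
  shows "matching w w'' (vconcat D D')"
proof -
  let ?G = "glue D D'"
  note sv = single_valued_glue[OF assms] and dom = glue_Domain_iff[OF assms]
  have fin: "finite ?G" using assms by (simp add: finite_glue matching_finite)
  have mem: "s \<in> starts w w''" "t \<in> ends w w''" if "(s, t) \<in> vconcat D D'" for s t
  proof -
    have *: "(outer s, outer t) \<in> ?G\<^sup>+" using that by (simp add: vconcat_iff)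
    then show "s \<in> starts w w''" unfolding dom(1)[symmetric] by (metis Domain.DomainI converse_tranclE)
    from * show "t \<in> ends w w''" unfolding dom(2)[symmetric] by (metis Range.intros tranclE)
  qed
  have out: "\<exists>t. (s, t) \<in> vconcat D D'" if "s \<in> starts w w''" for s
  proof -
    have "outer s \<in> Domain ?G" "outer s \<notin> Range ?G"
      using that starts_Int_ends unfolding dom by blast+
    from finite_path[OF fin sv this] obtain x where
      x: "(outer s, x) \<in> ?G\<^sup>+" "x \<in> Range ?G" "x \<notin> Domain ?G" by blast
    moreover have "\<nexists>k. x = Mid k" using x(2,3) dom(3,4) by blast
    ultimately show ?thesis using outer_or_Mid[of x] by (auto simp: vconcat_iff)
  qed
  have inn: "\<exists>s. (s, t) \<in> vconcat D D'" if "t \<in> ends w w''" for t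
  proof -
    have "outer t \<in> Domain (?G\<inverse>)" "outer t \<notin> Range (?G\<inverse>)"
      using that starts_Int_ends unfolding Domain_converse Range_converse dom by blast+
    with finite_path[of "?G\<inverse>" "outer t"] fin sv obtain x where
      x: "(outer t, x) \<in> (?G\<inverse>)\<^sup>+" "x \<in> Domain ?G" "x \<notin> Range ?G" by auto
    moreover have "\<nexists>k. x = Mid k" using x(2,3) dom(3,4) by blast
    ultimately show ?thesis using outer_or_Mid[of x] by (auto simp: vconcat_iff trancl_converse)
  qed
  have nodom: "outer t \<notin> Domain ?G" if "(s, t) \<in> vconcat D D'" for s t
    using mem(2)[OF that] starts_Int_ends unfolding dom by blast
  have noran: "outer s \<notin> Domain (?G\<inverse>)" if "(s, t) \<in> vconcat D D'" for s t
    using mem(1)[OF that] starts_Int_ends unfolding Domain_converse dom by blast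
  have "single_valued (vconcat D D')"
  proof (rule single_valuedI)
    fix s t t' assume *: "(s, t) \<in> vconcat D D'" "(s, t') \<in> vconcat D D'"
    have "outer t = outer t'"
      by (rule trancl_unique_end[OF sv(1)]) (use * nodom in \<open>auto simp: vconcat_iff\<close>)
    then show "t = t'" by (simp add: half_inj)
  qed
  moreover have "single_valued ((vconcat D D')\<inverse>)"
  proof (rule single_valuedI)
    fix t s s' assume "(t, s) \<in> (vconcat D D')\<inverse>" "(t, s') \<in> (vconcat D D')\<inverse>"
    then have *: "(s, t) \<in> vconcat D D'" "(s', t) \<in> vconcat D D'" by auto
    have "outer s = outer s'"
      by (rule trancl_unique_end[OF sv(2), of "outer t"])
        (use * noran[OF *(1)] noran[OF *(2)] in \<open>auto simp: vconcat_iff trancl_converse\<close>)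
    then show "s = s'" by (simp add: half_inj)
  qed
  ultimately show ?thesis using mem out inn unfolding matching_def by blast
qed

text \<open>By \<open>matching_subset_eq\<close> it is enough to exhibit, for each string of the
  expected result, a path in the glued graph. All explicit composites are computed like
  this.\<close>

lemma vconcat_eqI:
  assumes "matching w w' D" "matching w' w'' D'" "matching w w'' R"
    "\<And>s t. (s, t) \<in> R \<Longrightarrow> (outer s, outer t) \<in> (glue D D')\<^sup>+"
  shows "vconcat D D' = R"
  by (rule sym, rule matching_subset_eq[OF assms(3) matching_vconcat[OF assms(1,2)]])
    (auto simp: vconcat_iff assms(4))

subsection \<open>Associativity of vertical concatenation\<close>

text \<open>The graph left when the points of \<open>P\<close> are forgotten and the paths through
  them are kept as edges. A path may also visit points outside \<open>P\<close> on its way; this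
  does not matter for the transitive closure and the cycles.\<close>

definition contract :: "'a set \<Rightarrow> 'a rel \<Rightarrow> 'a rel" where
  "contract P A = {(x, y). (x, y) \<in> A\<^sup>+ \<and> x \<notin> P \<and> y \<notin> P}"

definition cycles :: "'a rel \<Rightarrow> 'a set set" where
  "cycles G = {G\<^sup>* `` {p} |p. (p, p) \<in> G\<^sup>+}"

lemma contract_trancl:
  assumes B: "\<And>x y. (x, y) \<in> B \<Longrightarrow> x \<notin> P \<and> y \<notin> P" and "x \<notin> P" "y \<notin> P"
  shows "(x, y) \<in> (A \<union> B)\<^sup>+ \<longleftrightarrow> (x, y) \<in> (contract P A \<union> B)\<^sup>+"
proof
  let ?C = "contract P A \<union> B"
  \<comment> \<open>The invariant for a path that currently sits in \<open>P\<close>: it is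
    remembered as a contracted path to some point \<open>u\<close> outside \<open>P\<close>,
    followed by a path of \<open>A\<close>. It persists because edges of \<open>B\<close> avoid
    \<open>P\<close>.\<close>
  have "if z \<in> P then \<exists>u. u \<notin> P \<and> (x, u) \<in> ?C\<^sup>* \<and> (u, z) \<in> A\<^sup>+ else (x, z) \<in> ?C\<^sup>+"
    if "(x, z) \<in> (A \<union> B)\<^sup>+" for z
    using that
  proof (induction rule: trancl_induct)
    case (base z)
    show ?case
    proof (cases "z \<in> P")
      case True
      then have "(x, z) \<in> A" using base B by blast
      then show ?thesis using True assms(2) by auto
    next
      case False
      then have "(x, z) \<in> ?C" using base assms(2) unfolding contract_def by auto
      then show ?thesis using False by auto
    qed
  next
    case (step z z')
    show ?case
    proof (cases "z \<in> P")
      case True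
      then obtain u where u: "u \<notin> P" "(x, u) \<in> ?C\<^sup>*" "(u, z) \<in> A\<^sup>+" using step.IH by auto
      have "(z, z') \<in> A" using step.hyps True B by blast
      then have z': "(u, z') \<in> A\<^sup>+" using u(3) by (rule trancl_into_trancl[rotated])
      show ?thesis
      proof (cases "z' \<in> P")
        case False
        then have "(u, z') \<in> ?C" using u(1) z' by (simp add: contract_def)
        then show ?thesis using u(2) False by (simp add: rtrancl_into_trancl1)
      qed (use u z' in auto)
    next
      case False
      then have xz: "(x, z) \<in> ?C\<^sup>+" using step.IH by simp
      show ?thesis
      proof (cases "z' \<in> P")
        case True
        then have "(z, z') \<in> A" using step.hyps B by blast
        then show ?thesis using True False xz by (auto intro: trancl_into_rtrancl)
      next
        case z': False
        then have "(z, z') \<in> ?C" using step.hyps False unfolding contract_def by auto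
        then show ?thesis using z' xz by (simp add: trancl_into_trancl)
      qed
    qed
  qed
  from this[of y] assms(3) show "(x, y) \<in> ?C\<^sup>+" if "(x, y) \<in> (A \<union> B)\<^sup>+" using that by simp
next
  assume "(x, y) \<in> (contract P A \<union> B)\<^sup>+"
  then show "(x, y) \<in> (A \<union> B)\<^sup>+"
  proof (induction rule: trancl_induct)
    case (base z)
    then show ?case using trancl_mono[of _ A "A \<union> B"] unfolding contract_def by blast
  next
    case (step z z')
    then have "(z, z') \<in> (A \<union> B)\<^sup>+" using trancl_mono[of _ A "A \<union> B"] unfolding contract_def by blast
    then show ?case using step.IH by (rule trancl_trans[rotated])
  qed
qed

text \<open>Only one edge leaves each point, so a path starting on a cycle cannot leave it.\<close>

lemma cycle_back:
  assumes "single_valued G" "(p, p) \<in> G\<^sup>+" "(p, q) \<in> G\<^sup>*"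
  shows "(q, p) \<in> G\<^sup>*"
  using assms(3)
proof (induction rule: rtrancl_induct)
  case (step q r)
  have "(q, p) \<in> G\<^sup>+"
    using step.IH assms(2) by (metis rtrancl_eq_or_trancl)
  then obtain r' where "(q, r') \<in> G" "(r', p) \<in> G\<^sup>*" by (meson tranclD)
  then show ?case using step.hyps(2) single_valuedD[OF assms(1)] by metis
qed simp

lemma cycle_eq:
  assumes "single_valued G" "(p, p) \<in> G\<^sup>+" "(p, q) \<in> G\<^sup>*"
  shows "G\<^sup>* `` {q} = G\<^sup>* `` {p}" "(q, q) \<in> G\<^sup>+"
proof -
  note b = cycle_back[OF assms]
  show "G\<^sup>* `` {q} = G\<^sup>* `` {p}" using b assms(3) by (auto intro: rtrancl_trans)
  show "(q, q) \<in> G\<^sup>+" using b assms(2,3) by (meson rtrancl_trancl_trancl trancl_rtrancl_trancl)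
qed

lemma finite_cycles: "finite G \<Longrightarrow> finite (cycles G)"
proof (rule finite_subset)
  show "cycles G \<subseteq> (\<lambda>p. G\<^sup>* `` {p}) ` Domain G"
    unfolding cycles_def by (auto intro!: imageI dest!: tranclD)
qed (simp add: finite_Domain)

text \<open>The cycles of the union are of two kinds. Those inside \<open>P\<close> are the cycles
  of \<open>A\<close>, and those with a point outside \<open>P\<close> become the cycles of the
  contracted graph when their points in \<open>P\<close> are removed.\<close>

lemma card_cycles_contract:
  assumes sv: "single_valued (A \<union> B)" and fin: "finite (A \<union> B)"
    and B: "\<And>x y. (x, y) \<in> B \<Longrightarrow> x \<notin> P \<and> y \<notin> P"
    and inner: "\<And>p. (p, p) \<in> A\<^sup>+ \<Longrightarrow> A\<^sup>* `` {p} \<subseteq> P"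
  shows "card (cycles (A \<union> B)) = card (cycles A) + card (cycles (contract P A \<union> B))"
proof -
  let ?G = "A \<union> B" and ?C = "contract P A \<union> B"
  define In where "In = {Z \<in> cycles ?G. Z \<subseteq> P}"
  define Out where "Out = {Z \<in> cycles ?G. \<not> Z \<subseteq> P}"
  note contr = contract_trancl[of B P, OF B, of _ _ A]
  have A_G: "(x, y) \<in> ?G\<^sup>+" if "(x, y) \<in> A\<^sup>+" for x y using trancl_mono[OF that] by blast
  have rA_G: "(x, y) \<in> ?G\<^sup>*" if "(x, y) \<in> A\<^sup>*" for x y using that rtrancl_mono[of A ?G] by blast
  \<comment> \<open>A cycle inside \<open>P\<close> uses no edge of \<open>B\<close>. Conversely
    each point of a cycle of \<open>A\<close> already has its only outgoing edge in
    \<open>A\<close>, so adding \<open>B\<close> does not enlarge the cycle.\<close>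
  have "In = cycles A"
  proof (intro subset_antisym subsetI)
    fix Z assume "Z \<in> In"
    then obtain p where p: "(p, p) \<in> ?G\<^sup>+" "Z = ?G\<^sup>* `` {p}" "Z \<subseteq> P" by (auto simp: In_def cycles_def)
    have *: "(p, q) \<in> A\<^sup>+" if "(p, q) \<in> ?G\<^sup>+" for q
      using that
    proof (induction rule: trancl_induct)
      case (base q)
      moreover have "p \<in> P" using p by auto
      ultimately show ?case using B by blast
    next
      case (step q r)
      have "q \<in> P" using p(2,3) trancl_into_rtrancl[OF step.hyps(1)] by blast
      then have "(q, r) \<in> A" using step.hyps(2) B by blast
      with step.IH show ?case by (rule trancl_into_trancl)
    qed
    then have "(p, q) \<in> A\<^sup>*" if "(p, q) \<in> ?G\<^sup>*" for q using that by (simp add: rtrancl_eq_or_trancl) blast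
    then have "?G\<^sup>* `` {p} = A\<^sup>* `` {p}" using rA_G by blast
    then show "Z \<in> cycles A" using p * unfolding cycles_def by blast
  next
    fix Z assume "Z \<in> cycles A"
    then obtain p where p: "(p, p) \<in> A\<^sup>+" "Z = A\<^sup>* `` {p}" by (auto simp: cycles_def)
    have "(p, q) \<in> A\<^sup>*" if "(p, q) \<in> ?G\<^sup>*" for q
      using that
    proof (induction rule: rtrancl_induct)
      case (step q r)
      have svA: "single_valued A" using sv by (rule single_valued_subset[rotated]) simp
      have "(q, q) \<in> A\<^sup>+" by (rule cycle_eq(2)[OF svA p(1) step.IH])
      then obtain r' where "(q, r') \<in> A" by (meson tranclD)
      with step.hyps(2) sv have "(q, r) \<in> A" by (metis UnI1 single_valuedD)
      with step.IH show ?case by simp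
    qed simp
    then have "?G\<^sup>* `` {p} = Z" using rA_G p(2) by blast
    moreover have "Z \<subseteq> P" using inner p by blast
    ultimately show "Z \<in> In" unfolding In_def cycles_def using A_G[OF p(1)] by blast
  qed
  \<comment> \<open>Such a cycle can be started at a point outside \<open>P\<close>, and from there
    the contracted graph reaches exactly its points outside \<open>P\<close>. Nothing is lost by
    removing \<open>P\<close>, because cycles with a common point coincide.\<close>
  moreover have "bij_betw (\<lambda>Z. Z - P) Out (cycles ?C)"
  proof -
    have rep: "\<exists>p. p \<notin> P \<and> (p, p) \<in> ?G\<^sup>+ \<and> Z = ?G\<^sup>* `` {p}" if Z: "Z \<in> cycles ?G" "q \<in> Z" "q \<notin> P" for Z q
    proof -
      from Z obtain p where "(p, p) \<in> ?G\<^sup>+" "Z = ?G\<^sup>* `` {p}" by (auto simp: cycles_def)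
      then show ?thesis using cycle_eq[OF sv, of p q] Z by auto
    qed
    have minus: "?G\<^sup>* `` {p} - P = ?C\<^sup>* `` {p}" if "p \<notin> P" for p
    proof -
      have "(p, x) \<in> ?C\<^sup>+ \<Longrightarrow> x \<notin> P" for x
        by (induction rule: trancl_induct) (use B in \<open>auto simp: contract_def\<close>)
      then have "(p, x) \<in> ?G\<^sup>+ \<and> x \<notin> P \<longleftrightarrow> (p, x) \<in> ?C\<^sup>+" for x
        using contr[OF _ that] by blast
      then have "(p, x) \<in> ?G\<^sup>* \<and> x \<notin> P \<longleftrightarrow> (p, x) \<in> ?C\<^sup>*" for x
        unfolding rtrancl_eq_or_trancl using that by metis
      then show ?thesis by blast
    qed
    have inj: "Z = Z'" if ZZ: "Z \<in> Out" "Z' \<in> Out" "Z - P = Z' - P" for Z Z'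
    proof -
      obtain q where q: "q \<in> Z" "q \<notin> P" "q \<in> Z'" using ZZ unfolding Out_def by blast
      obtain p p' where p: "(p, p) \<in> ?G\<^sup>+" "Z = ?G\<^sup>* `` {p}" "(p', p') \<in> ?G\<^sup>+" "Z' = ?G\<^sup>* `` {p'}"
        using ZZ unfolding Out_def cycles_def by auto
      have "?G\<^sup>* `` {q} = Z" "?G\<^sup>* `` {q} = Z'" using q cycle_eq(1)[OF sv] p by blast+
      then show ?thesis by simp
    qed
    have "Z - P \<in> cycles ?C" if Z: "Z \<in> Out" for Z
    proof -
      obtain q where q: "q \<in> Z" "q \<notin> P" "Z \<in> cycles ?G" using Z unfolding Out_def by blast
      then obtain p where "p \<notin> P" "(p, p) \<in> ?G\<^sup>+" "Z = ?G\<^sup>* `` {p}" using rep by blast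
      then show ?thesis using contr[of p p] minus[of p] unfolding cycles_def by blast
    qed
    moreover have "\<exists>Z\<in>Out. Y = Z - P" if Y: "Y \<in> cycles ?C" for Y
    proof -
      obtain p where p: "(p, p) \<in> ?C\<^sup>+" "Y = ?C\<^sup>* `` {p}" using Y by (auto simp: cycles_def)
      from p(1) have "p \<notin> P" by (cases rule: tranclE) (use B in \<open>auto simp: contract_def\<close>)
      moreover have "(p, p) \<in> ?G\<^sup>+" using contr[of p p] p \<open>p \<notin> P\<close> by simp
      ultimately have "?G\<^sup>* `` {p} \<in> Out" unfolding Out_def cycles_def by blast
      then show ?thesis using minus[OF \<open>p \<notin> P\<close>] p(2) by blast
    qed
    ultimately show ?thesis using inj unfolding bij_betw_def inj_on_def by blast
  qed
  moreover have "cycles ?G = In \<union> Out" "In \<inter> Out = {}" by (auto simp: In_def Out_def)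
  moreover have "finite In" "finite Out" using finite_cycles[OF fin] by (auto simp: In_def Out_def)
  ultimately show ?thesis by (simp add: card_Un_disjoint bij_betw_same_card)
qed

lemma trancl_map_prod:
  assumes "inj f"
  shows "(map_prod f f ` R)\<^sup>+ = map_prod f f ` R\<^sup>+"
proof -
  have "\<exists>a b. x = f a \<and> y = f b \<and> (a, b) \<in> R\<^sup>+" if "(x, y) \<in> (map_prod f f ` R)\<^sup>+" for x y
    using that
  proof (induction rule: trancl_induct)
    case (step y z)
    then show ?case using injD[OF assms] by (fastforce intro: trancl_into_trancl)
  qed auto
  moreover have "(f a, f b) \<in> (map_prod f f ` R)\<^sup>+" if "(a, b) \<in> R\<^sup>+" for a b
    using that
  proof (induction rule: trancl_induct)
    case (step y z)
    then have "(f y, f z) \<in> map_prod f f ` R" by force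
    then show ?case using step.IH by (rule trancl_into_trancl[rotated])
  qed force
  ultimately show ?thesis by (auto simp: image_iff)
qed

lemma card_cycles_map_prod:
  assumes "inj f"
  shows "card (cycles (map_prod f f ` R)) = card (cycles R)"
proof -
  have "(f p, x) \<in> (map_prod f f ` R)\<^sup>* \<longleftrightarrow> (\<exists>q. x = f q \<and> (p, q) \<in> R\<^sup>*)" for p x
    unfolding rtrancl_eq_or_trancl trancl_map_prod[OF assms] using injD[OF assms] by auto
  then have "(map_prod f f ` R)\<^sup>* `` {f p} = f ` (R\<^sup>* `` {p})" for p by blast
  moreover have "(x, x) \<in> map_prod f f ` R\<^sup>+ \<longleftrightarrow> (\<exists>p. x = f p \<and> (p, p) \<in> R\<^sup>+)" for x
    using injD[OF assms] by auto
  ultimately have "cycles (map_prod f f ` R) = image f ` cycles R"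
    unfolding cycles_def trancl_map_prod[OF assms] by (auto simp: image_iff)
  then show ?thesis
    by (simp add: card_image inj_on_def inj_image_eq_iff[OF assms])
qed

text \<open>Three stacked diagrams are glued along levels, a level \<open>a\<close> point being \<open>(a, i)\<close>.\<close>

fun level :: "nat \<Rightarrow> nat \<Rightarrow> point \<Rightarrow> nat \<times> nat" where
  "level a b (Up i) = (a, i)"
| "level a b (Lo j) = (b, j)"

fun glevel :: "nat \<Rightarrow> nat \<Rightarrow> nat \<Rightarrow> glued_point \<Rightarrow> nat \<times> nat" where
  "glevel a b c (Top i) = (a, i)"
| "glevel a b c (Mid i) = (b, i)"
| "glevel a b c (Bot i) = (c, i)"

lemma glevel_half [simp]:
  "glevel a b c (upper_half p) = level a b p" "glevel a b c (lower_half p) = level b c p"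
  "glevel a b c (outer p) = level a c p"
  by (cases p; simp)+

lemma inj_glevel: "a \<noteq> b \<Longrightarrow> b \<noteq> c \<Longrightarrow> a \<noteq> c \<Longrightarrow> inj (glevel a b c)"
proof (rule injI)
  show "x = y" if "a \<noteq> b" "b \<noteq> c" "a \<noteq> c" "glevel a b c x = glevel a b c y" for x y
    using that by (cases x; cases y) auto
qed

lemma fst_level: "fst (level a b p) = a \<or> fst (level a b p) = b"
  by (cases p) auto

definition stack :: "nat \<Rightarrow> nat \<Rightarrow> diagram \<Rightarrow> (nat \<times> nat) rel" where
  "stack a b D = map_prod (level a b) (level a b) ` D"

lemma glue_levels: "map_prod (glevel a b c) (glevel a b c) ` glue D D' = stack a b D \<union> stack b c D'"
  unfolding glue_def stack_def by (auto simp: image_iff) force+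

lemma outer_neq_Mid [simp]: "outer p \<noteq> Mid k" "Mid k \<noteq> outer p"
  by (cases p; simp)+

text \<open>This makes the two ways of bracketing three stacked diagrams contractions of one and the
  same three-layer graph.\<close>

lemma contract_glue:
  assumes "a \<noteq> b" "b \<noteq> c" "a \<noteq> c"
  shows "contract {x. fst x = b} (stack a b D \<union> stack b c D') = stack a c (vconcat D D')"
proof -
  let ?f = "glevel a b c"
  have *: "(\<exists>p. x = outer p) \<longleftrightarrow> fst (?f x) \<noteq> b" for x
    using assms by (cases x; simp; metis outer.simps)
  have "(x, y) \<in> contract {x. fst x = b} (stack a b D \<union> stack b c D') \<longleftrightarrow>
      (x, y) \<in> stack a c (vconcat D D')" for x y
  proof
    assume "(x, y) \<in> contract {x. fst x = b} (stack a b D \<union> stack b c D')"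
    then obtain u v where uv: "x = ?f u" "y = ?f v" "(u, v) \<in> (glue D D')\<^sup>+"
      and b: "fst (?f u) \<noteq> b" "fst (?f v) \<noteq> b"
      unfolding contract_def glue_levels[symmetric] trancl_map_prod[OF inj_glevel[OF assms]] by auto
    from b obtain s t where "u = outer s" "v = outer t" unfolding *[symmetric] by blast
    then show "(x, y) \<in> stack a c (vconcat D D')"
      using uv unfolding stack_def by (auto simp: vconcat_iff intro!: image_eqI[of _ _ "(s, t)"])
  next
    assume "(x, y) \<in> stack a c (vconcat D D')"
    then obtain s t where st: "x = ?f (outer s)" "y = ?f (outer t)" "(outer s, outer t) \<in> (glue D D')\<^sup>+"
      unfolding stack_def by (auto simp: vconcat_iff)
    moreover have "fst x \<noteq> b" "fst y \<noteq> b" using st *[of "outer s"] *[of "outer t"] by auto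
    ultimately show "(x, y) \<in> contract {x. fst x = b} (stack a b D \<union> stack b c D')"
      unfolding contract_def glue_levels[symmetric] trancl_map_prod[OF inj_glevel[OF assms]]
      by (auto intro!: image_eqI[of _ _ "(outer s, outer t)"])
  qed
  then show ?thesis by auto
qed

lemma loops_eq: "a \<noteq> b \<Longrightarrow> b \<noteq> c \<Longrightarrow> a \<noteq> c \<Longrightarrow>
    loops D D' = card (cycles (stack a b D \<union> stack b c D'))"
  unfolding glue_levels[symmetric] card_cycles_map_prod[OF inj_glevel] loops_def
  by (simp add: card_cycles_map_prod inj_glevel cycles_def)

text \<open>A point on a cycle has an edge in and an edge out, whereas an outer point is a source or
  a sink of the glued graph.\<close>

lemma cycle_glue_Mid:
  assumes "matching w w' D" "matching w' w'' D'" "(x, x) \<in> (glue D D')\<^sup>+" "(x, y) \<in> (glue D D')\<^sup>*"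
  shows "\<exists>k. y = Mid k"
proof (rule ccontr)
  assume "\<nexists>k. y = Mid k"
  then obtain p where p: "y = outer p" using outer_or_Mid by blast
  have "(y, y) \<in> (glue D D')\<^sup>+"
    by (rule cycle_eq(2)[OF single_valued_glue(1)[OF assms(1,2)] assms(3,4)])
  then have "y \<in> Domain (glue D D')" "y \<in> Range (glue D D')"
    by (metis Domain.DomainI converse_tranclE, metis Range.intros tranclE)
  then show False using glue_Domain_iff(1,2)[OF assms(1,2), of p] starts_Int_ends p by blast
qed

lemma cycle_stack_level:
  assumes "matching w w' D" "matching w' w'' D'" "a \<noteq> b" "b \<noteq> c" "a \<noteq> c"
    "(x, x) \<in> (stack a b D \<union> stack b c D')\<^sup>+"
  shows "(stack a b D \<union> stack b c D')\<^sup>* `` {x} \<subseteq> {x. fst x = b}"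
proof
  fix y assume y: "y \<in> (stack a b D \<union> stack b c D')\<^sup>* `` {x}"
  let ?f = "glevel a b c"
  note inj = inj_glevel[OF assms(3-5)]
  from assms(6) obtain u where u: "x = ?f u" "(u, u) \<in> (glue D D')\<^sup>+"
    unfolding glue_levels[symmetric] trancl_map_prod[OF inj] using injD[OF inj] by auto
  from y have "y = x \<or> (x, y) \<in> (map_prod ?f ?f ` glue D D')\<^sup>+"
    unfolding glue_levels by (auto simp: rtrancl_eq_or_trancl)
  then obtain v where v: "y = ?f v" "(u, v) \<in> (glue D D')\<^sup>*"
    unfolding trancl_map_prod[OF inj] using u injD[OF inj] by (auto intro: trancl_into_rtrancl)
  then obtain k where "v = Mid k" using cycle_glue_Mid[OF assms(1,2) u(2)] by blast
  then show "y \<in> {x. fst x = b}" using v by simp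
qed

context
  fixes w1 w2 w3 w4 D D' D''
  assumes D: "matching w1 w2 D" and D': "matching w2 w3 D'" and D'': "matching w3 w4 D''"
begin

lemma single_valued_stack: "single_valued (stack 0 1 D \<union> stack 1 2 D' \<union> stack 2 3 D'')"
proof -
  have 1: "single_valued (stack 0 1 D \<union> stack 1 2 D')" "single_valued (stack 1 2 D' \<union> stack 2 3 D'')"
    using single_valued_relabel[OF inj_glevel single_valued_glue(1)[OF D D'], of 0 1 2]
      single_valued_relabel[OF inj_glevel single_valued_glue(1)[OF D' D''], of 1 2 3]
    by (simp_all add: glue_levels)
  moreover have "x \<noteq> x'" if xx: "(x, y) \<in> stack 0 1 D" "(x', y') \<in> stack 2 3 D''" for x y x' y'
  proof -
    obtain p q where "x = level 0 1 p" "x' = level 2 3 q" using xx unfolding stack_def by auto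
    then have "fst x < 2 \<and> 2 \<le> fst x'" using fst_level[of 0 1 p] fst_level[of 2 3 q] by auto
    then show ?thesis by auto
  qed
  ultimately show ?thesis unfolding single_valued_def by blast
qed

lemma glue_vconcat_left:
  "contract {x. fst x = 1} (stack 0 1 D \<union> stack 1 2 D') \<union> stack 2 3 D'' =
     map_prod (glevel 0 2 3) (glevel 0 2 3) ` glue (vconcat D D') D''"
  by (simp add: contract_glue glue_levels)

lemma glue_vconcat_right:
  "contract {x. fst x = 2} (stack 1 2 D' \<union> stack 2 3 D'') \<union> stack 0 1 D =
     map_prod (glevel 0 1 3) (glevel 0 1 3) ` glue D (vconcat D' D'')"
  by (simp add: contract_glue glue_levels Un_commute)

lemma stack_levels:
  "(x, y) \<in> stack a b C \<Longrightarrow> fst x \<in> {a, b} \<and> fst y \<in> {a, b}"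
  using fst_level[of a b] unfolding stack_def by auto

text \<open>Contracting level 1 first or level 2 first does not change which points of the outer
  levels 0 and 3 are connected in the stack of all three diagrams.\<close>

lemma vconcat_assoc: "vconcat (vconcat D D') D'' = vconcat D (vconcat D' D'')"
proof -
  have l3: "fst (level 0 3 p) \<noteq> 1" "fst (level 0 3 p) \<noteq> 2" for p by (cases p; simp)+
  have "(s, t) \<in> vconcat (vconcat D D') D'' \<longleftrightarrow> (s, t) \<in> vconcat D (vconcat D' D'')" for s t
  proof -
    have "(s, t) \<in> vconcat (vconcat D D') D'' \<longleftrightarrow>
        (glevel 0 2 3 (outer s), glevel 0 2 3 (outer t)) \<in>
          map_prod (glevel 0 2 3) (glevel 0 2 3) ` (glue (vconcat D D') D'')\<^sup>+"
      using injD[OF inj_glevel, of 0 2 3] by (auto simp: vconcat_iff simp del: glevel_half)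
    also have "\<dots> \<longleftrightarrow> (level 0 3 s, level 0 3 t) \<in>
        (contract {x. fst x = 1} (stack 0 1 D \<union> stack 1 2 D') \<union> stack 2 3 D'')\<^sup>+"
      unfolding glue_vconcat_left by (simp add: trancl_map_prod inj_glevel)
    also have "\<dots> \<longleftrightarrow> (level 0 3 s, level 0 3 t) \<in> (stack 0 1 D \<union> stack 1 2 D' \<union> stack 2 3 D'')\<^sup>+"
      by (rule contract_trancl[symmetric]) (use l3 in \<open>auto dest: stack_levels\<close>)
    also have "stack 0 1 D \<union> stack 1 2 D' \<union> stack 2 3 D'' = (stack 1 2 D' \<union> stack 2 3 D'') \<union> stack 0 1 D"
      by blast
    also have "(level 0 3 s, level 0 3 t) \<in> \<dots>\<^sup>+ \<longleftrightarrow> (level 0 3 s, level 0 3 t) \<in>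
        (contract {x. fst x = 2} (stack 1 2 D' \<union> stack 2 3 D'') \<union> stack 0 1 D)\<^sup>+"
      by (rule contract_trancl) (use l3 in \<open>auto dest: stack_levels\<close>)
    also have "\<dots> \<longleftrightarrow> (glevel 0 1 3 (outer s), glevel 0 1 3 (outer t)) \<in>
          map_prod (glevel 0 1 3) (glevel 0 1 3) ` (glue D (vconcat D' D''))\<^sup>+"
      unfolding glue_vconcat_right by (simp add: trancl_map_prod inj_glevel)
    also have "\<dots> \<longleftrightarrow> (s, t) \<in> vconcat D (vconcat D' D'')"
      using injD[OF inj_glevel, of 0 1 3] by (auto simp: vconcat_iff simp del: glevel_half)
    finally show ?thesis .
  qed
  then show ?thesis by auto
qed

text \<open>The cycles of the whole stack are counted twice: once separating those in level 1 from
  the others, once those in level 2.\<close>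

lemma loops_assoc: "loops D D' + loops (vconcat D D') D'' = loops D' D'' + loops D (vconcat D' D'')"
proof -
  let ?S = "stack 0 1 D \<union> stack 1 2 D' \<union> stack 2 3 D''"
  have fin: "finite ?S" using D D' D'' by (simp add: stack_def matching_finite)
  have eq: "?S = (stack 1 2 D' \<union> stack 2 3 D'') \<union> stack 0 1 D" by blast
  have "card (cycles ?S) = card (cycles (stack 0 1 D \<union> stack 1 2 D')) +
      card (cycles (contract {x. fst x = 1} (stack 0 1 D \<union> stack 1 2 D') \<union> stack 2 3 D''))"
    by (rule card_cycles_contract[OF single_valued_stack fin])
      (use cycle_stack_level[OF D D', of 0 1 2] in \<open>auto dest: stack_levels\<close>)
  also have "\<dots> = loops D D' + loops (vconcat D D') D''"
    by (simp add: loops_eq[of 0 1 2 D D'] loops_eq[of 0 2 3 "vconcat D D'" D''] contract_glue)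
  finally have 1: "card (cycles ?S) = loops D D' + loops (vconcat D D') D''" .
  have "card (cycles ?S) = card (cycles (stack 1 2 D' \<union> stack 2 3 D'')) +
      card (cycles (contract {x. fst x = 2} (stack 1 2 D' \<union> stack 2 3 D'') \<union> stack 0 1 D))"
    unfolding eq by (rule card_cycles_contract[OF single_valued_stack[unfolded eq] fin[unfolded eq]])
      (use cycle_stack_level[OF D' D'', of 1 2 3] in \<open>auto dest: stack_levels\<close>)
  also have "\<dots> = loops D' D'' + loops D (vconcat D' D'')"
    by (simp add: loops_eq[of 1 2 3 D' D''] loops_eq[of 0 1 3 D "vconcat D' D''"] contract_glue Un_commute)
  finally show ?thesis using 1 by simp
qed

end

subsection \<open>Elementary diagrams\<close>

text \<open>In \<open>up_arc\<close> and \<open>lo_arc\<close> the argument \<open>x\<close> is the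
  letter at the left foot. Since \<open>X\<close> marks a start on the upper edge and an end on the
  lower edge, the two arcs for the same letter are oriented oppositely.\<close>

definition up_arc :: "letter \<Rightarrow> nat \<Rightarrow> point \<times> point" where
  "up_arc x k = (if x = X then (Up k, Up (Suc k)) else (Up (Suc k), Up k))"

definition lo_arc :: "letter \<Rightarrow> nat \<Rightarrow> point \<times> point" where
  "lo_arc x k = (if x = X then (Lo (Suc k), Lo k) else (Lo k, Lo (Suc k)))"

text \<open>Composed by \<open>hconcat\<close> from an arc and identities, so that membership in
  \<open>K\<close> and naturality are inherited from the factors. A cap consumes the two letters
  \<open>x\<close> and \<open>dual x\<close>; a cup creates them.\<close>

definition cap :: "word \<Rightarrow> letter \<Rightarrow> word \<Rightarrow> diagram" where
  "cap u x v = hconcat (length u) (length u) (id_diagram u) (hconcat 2 0 {up_arc x 0} (id_diagram v))"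

definition cup :: "word \<Rightarrow> letter \<Rightarrow> word \<Rightarrow> diagram" where
  "cup u x v = hconcat (length u) (length u) (id_diagram u) (hconcat 0 2 {lo_arc x 0} (id_diagram v))"

lemma mem_id_diagram:
  "(Up i, q) \<in> id_diagram w \<longleftrightarrow> i < length w \<and> w ! i = X \<and> q = Lo i"
  "(Lo i, q) \<in> id_diagram w \<longleftrightarrow> i < length w \<and> w ! i = X_star \<and> q = Up i"
  by (auto simp: id_diagram_def)

lemma matching_id: "matching w w (id_diagram w)"
proof -
  have "Domain (id_diagram w) = starts w w" "Range (id_diagram w) = ends w w"
    unfolding id_diagram_def starts_def ends_def by auto
  then show ?thesis
    unfolding matching_def by (auto simp: id_diagram_def single_valued_def)
qed

lemma K_id: "id_diagram w \<in> K w w"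
proof -
  have "\<not> crossed (rank m m a) (rank m m c) (rank m m b) (rank m m e)"
    if "(a, c) \<in> id_diagram w" "(b, e) \<in> id_diagram w" "m = length w" for a c b e m
    using that unfolding id_diagram_def crossed_def by auto
  then show ?thesis by (auto simp: K_iff matching_id noncrossing_iff)
qed

lemma K_up_arc: "{up_arc x 0} \<in> K [x, dual x] []"
  by (cases x) (auto simp: K_iff matching_def noncrossing_iff crossed_def up_arc_def
      starts_def ends_def single_valued_def less_Suc_eq nth_Cons')

lemma K_lo_arc: "{lo_arc x 0} \<in> K [] [x, dual x]"
  by (cases x) (auto simp: K_iff matching_def noncrossing_iff crossed_def lo_arc_def
      starts_def ends_def single_valued_def less_Suc_eq nth_Cons')

lemma K_cap: "cap u x v \<in> K (u @ [x, dual x] @ v) (u @ v)"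
  using K_hconcat[OF K_id[of u] K_hconcat[OF K_up_arc[of x] K_id[of v]]] unfolding cap_def
  by (simp add: numeral_2_eq_2)

lemma K_cup: "cup u x v \<in> K (u @ v) (u @ [x, dual x] @ v)"
  using K_hconcat[OF K_id[of u] K_hconcat[OF K_lo_arc[of x] K_id[of v]]] unfolding cup_def
  by (simp add: numeral_2_eq_2)

section \<open>Inserting and deleting an arc between neighbours\<close>

definition skip :: "nat \<Rightarrow> nat \<Rightarrow> nat" where
  "skip k i = (if i < k then i else Suc (Suc i))"

fun skip_up :: "nat \<Rightarrow> point \<Rightarrow> point" where
  "skip_up k (Up i) = Up (skip k i)"
| "skip_up k (Lo j) = Lo j"

fun skip_lo :: "nat \<Rightarrow> point \<Rightarrow> point" where
  "skip_lo k (Up i) = Up i"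
| "skip_lo k (Lo j) = Lo (skip k j)"

lemma skip_inj [simp]: "skip k i = skip k j \<longleftrightarrow> i = j"
  by (auto simp: skip_def)

lemma skip_less [simp]: "skip k i < skip k j \<longleftrightarrow> i < j"
  by (auto simp: skip_def)

lemma skip_neq [simp]: "skip k i \<noteq> k" "skip k i \<noteq> Suc k" "k \<noteq> skip k i" "Suc k \<noteq> skip k i"
  by (auto simp: skip_def)

lemma skip_surj: "i \<noteq> k \<Longrightarrow> i \<noteq> Suc k \<Longrightarrow> \<exists>j. i = skip k j"
  unfolding skip_def by (rule exI[of _ "if i < k then i else i - 2"]) auto

lemma skip_bound [simp]: "skip (length u) i < Suc (Suc (length u + length v)) \<longleftrightarrow> i < length u + length v"
  by (auto simp: skip_def)

lemma nth_skip [simp]: "(u @ x # y # v) ! skip (length u) i = (u @ v) ! i"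
  by (simp add: skip_def nth_append Suc_diff_le)

lemma inj_skip_up: "inj (skip_up k)" and inj_skip_lo: "inj (skip_lo k)"
proof -
  have "p = q" if "skip_up k p = skip_up k q" for p q using that by (cases p; cases q) auto
  then show "inj (skip_up k)" by (rule injI)
  have "p = q" if "skip_lo k p = skip_lo k q" for p q using that by (cases p; cases q) auto
  then show "inj (skip_lo k)" by (rule injI)
qed

lemma cap_arc: "up_arc x (length u) \<in> cap u x v"
proof -
  have "up_arc x (length u) = map_prod (shift (length u) (length u)) (shift (length u) (length u)) (up_arc x 0)"
    by (auto simp: up_arc_def)
  then show ?thesis unfolding cap_def hconcat_def by blast
qed

lemma cup_arc: "lo_arc x (length u) \<in> cup u x v"
proof -
  have "lo_arc x (length u) = map_prod (shift (length u) (length u)) (shift (length u) (length u)) (lo_arc x 0)"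
    by (auto simp: lo_arc_def)
  then show ?thesis unfolding cup_def hconcat_def by blast
qed

lemma cap_through:
  assumes "i < length (u @ v)"
  shows "(u @ v) ! i = X \<Longrightarrow> (Up (skip (length u) i), Lo i) \<in> cap u x v"
    "(u @ v) ! i = X_star \<Longrightarrow> (Lo i, Up (skip (length u) i)) \<in> cap u x v"
proof -
  let ?s = "shift (length u) (length u)" and ?t = "shift 2 0"
  have *: "(?s (?t p), ?s (?t q)) \<in> cap u x v" if "(p, q) \<in> id_diagram v" for p q
    using that unfolding cap_def hconcat_def by force
  have **: "(p, q) \<in> cap u x v" if "(p, q) \<in> id_diagram u" for p q
    using that unfolding cap_def hconcat_def by force
  show "(u @ v) ! i = X \<Longrightarrow> (Up (skip (length u) i), Lo i) \<in> cap u x v"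
    using *[of "Up (i - length u)" "Lo (i - length u)"] **[of "Up i" "Lo i"] assms
    by (cases "i < length u") (auto simp: skip_def nth_append mem_id_diagram)
  show "(u @ v) ! i = X_star \<Longrightarrow> (Lo i, Up (skip (length u) i)) \<in> cap u x v"
    using *[of "Lo (i - length u)" "Up (i - length u)"] **[of "Lo i" "Up i"] assms
    by (cases "i < length u") (auto simp: skip_def nth_append mem_id_diagram)
qed

lemma cup_through:
  assumes "i < length (u @ v)"
  shows "(u @ v) ! i = X \<Longrightarrow> (Up i, Lo (skip (length u) i)) \<in> cup u x v"
    "(u @ v) ! i = X_star \<Longrightarrow> (Lo (skip (length u) i), Up i) \<in> cup u x v"
proof -
  let ?s = "shift (length u) (length u)" and ?t = "shift 0 2"
  have *: "(?s (?t p), ?s (?t q)) \<in> cup u x v" if "(p, q) \<in> id_diagram v" for p q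
    using that unfolding cup_def hconcat_def by force
  have **: "(p, q) \<in> cup u x v" if "(p, q) \<in> id_diagram u" for p q
    using that unfolding cup_def hconcat_def by force
  show "(u @ v) ! i = X \<Longrightarrow> (Up i, Lo (skip (length u) i)) \<in> cup u x v"
    using *[of "Up (i - length u)" "Lo (i - length u)"] **[of "Up i" "Lo i"] assms
    by (cases "i < length u") (auto simp: skip_def nth_append mem_id_diagram)
  show "(u @ v) ! i = X_star \<Longrightarrow> (Lo (skip (length u) i), Up i) \<in> cup u x v"
    using *[of "Lo (i - length u)" "Up (i - length u)"] **[of "Lo i" "Up i"] assms
    by (cases "i < length u") (auto simp: skip_def nth_append mem_id_diagram)
qed

text \<open>In the applications \<open>f\<close> misses exactly two points, and they are joined by an arc of \<open>D\<close>.\<close>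

definition delete :: "(point \<Rightarrow> point) \<Rightarrow> diagram \<Rightarrow> diagram" where
  "delete f D = {(s, t). (f s, f t) \<in> D}"

text \<open>A string other than \<open>(a, b)\<close> meets neither \<open>a\<close> nor
  \<open>b\<close>, so both of its ends come from the smaller rectangle along
  \<open>f\<close>.\<close>

lemma matching_delete:
  assumes D: "matching w w' D" and ab: "(a, b) \<in> D" and f: "inj f"
    and range: "\<And>p. p \<in> points (length w) (length w') \<Longrightarrow> p \<noteq> a \<Longrightarrow> p \<noteq> b \<Longrightarrow> \<exists>q. p = f q"
    and nab: "\<And>q. f q \<noteq> a" "\<And>q. f q \<noteq> b"
    and se: "\<And>q. f q \<in> starts w w' \<longleftrightarrow> q \<in> starts w1 w1'" "\<And>q. f q \<in> ends w w' \<longleftrightarrow> q \<in> ends w1 w1'"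
  shows "matching w1 w1' (delete f D)" "D = insert (a, b) (relabel f (delete f D))"
proof -
  have rep: "\<exists>s' t'. s = f s' \<and> t = f t'" if st: "(s, t) \<in> D" "(s, t) \<noteq> (a, b)" for s t
  proof -
    have "s \<noteq> a" "s \<noteq> b" "t \<noteq> a" "t \<noteq> b" using matching_unique'[OF D st(1) ab] st(2) by auto
    then show ?thesis using range[of s] range[of t] matching_mem[OF D st(1)] by blast
  qed
  have inj: "f p = f q \<longleftrightarrow> p = q" for p q using f by (rule inj_eq)
  have out: "\<exists>t. (s, t) \<in> delete f D" if "s \<in> starts w1 w1'" for s
  proof -
    from that obtain t where t: "(f s, t) \<in> D" using se(1) matching_out[OF D] by blast
    then obtain t' where "t = f t'" using rep[OF t] nab by auto
    then show ?thesis using t unfolding delete_def by blast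
  qed
  have inn: "\<exists>s. (s, t) \<in> delete f D" if "t \<in> ends w1 w1'" for t
  proof -
    from that obtain s where s: "(s, f t) \<in> D" using se(2) matching_in[OF D] by blast
    then obtain s' where "s = f s'" using rep[OF s] nab by auto
    then show ?thesis using s unfolding delete_def by blast
  qed
  have "s \<in> starts w1 w1'" "t \<in> ends w1 w1'" if "(s, t) \<in> delete f D" for s t
    using that matching_mem[OF D] unfolding delete_def by (auto simp flip: se)
  moreover have "single_valued (delete f D)"
    by (rule single_valuedI) (use matching_unique(1)[OF D] inj in \<open>unfold delete_def, blast\<close>)
  moreover have "single_valued ((delete f D)\<inverse>)"
    by (rule single_valuedI) (use matching_unique(2)[OF D] inj in \<open>unfold delete_def, blast\<close>)
  ultimately show "matching w1 w1' (delete f D)" unfolding matching_def using out inn by blast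
  show "D = insert (a, b) (relabel f (delete f D))"
    using rep ab unfolding delete_def by (fastforce simp: image_iff)
qed

lemma skip_up_se:
  "skip_up (length u) q \<in> starts (u @ x # y # v) w' \<longleftrightarrow> q \<in> starts (u @ v) w'"
  "skip_up (length u) q \<in> ends (u @ x # y # v) w' \<longleftrightarrow> q \<in> ends (u @ v) w'"
  by (cases q; simp)+

lemma skip_lo_se:
  "skip_lo (length u) q \<in> starts w (u @ x # y # v) \<longleftrightarrow> q \<in> starts w (u @ v)"
  "skip_lo (length u) q \<in> ends w (u @ x # y # v) \<longleftrightarrow> q \<in> ends w (u @ v)"
  by (cases q; simp)+

lemma rank_mono_skip_up: "k \<le> m \<Longrightarrow> rank_mono m n (Suc (Suc m)) n (skip_up k)"
  unfolding rank_mono_def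
proof (intro ballI)
  fix p q assume "k \<le> m" "p \<in> points m n" "q \<in> points m n"
  then show "rank (Suc (Suc m)) n (skip_up k p) < rank (Suc (Suc m)) n (skip_up k q) \<longleftrightarrow> rank m n p < rank m n q"
    by (cases p; cases q) (auto simp: skip_def)
qed

lemma rank_mono_skip_lo: "k \<le> n \<Longrightarrow> rank_mono m n m (Suc (Suc n)) (skip_lo k)"
  unfolding rank_mono_def
proof (intro ballI)
  fix p q assume "k \<le> n" "p \<in> points m n" "q \<in> points m n"
  then show "rank m (Suc (Suc n)) (skip_lo k p) < rank m (Suc (Suc n)) (skip_lo k q) \<longleftrightarrow> rank m n p < rank m n q"
    by (cases p; cases q) (auto simp: skip_def)
qed

lemma noncrossing_subset: "noncrossing m n D \<Longrightarrow> E \<subseteq> D \<Longrightarrow> noncrossing m n E"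
  unfolding noncrossing_def by blast

lemma delete_up_arc:
  assumes D: "matching (u @ [x, dual x] @ v) w' D" and arc: "up_arc x (length u) \<in> D"
  shows "matching (u @ v) w' (delete (skip_up (length u)) D)"
    "D = insert (up_arc x (length u)) (relabel (skip_up (length u)) (delete (skip_up (length u)) D))"
    "noncrossing (length (u @ [x, dual x] @ v)) (length w') D \<Longrightarrow>
      noncrossing (length (u @ v)) (length w') (delete (skip_up (length u)) D)"
proof -
  let ?k = "length u"
  obtain a b where ab: "up_arc x ?k = (a, b)" "{a, b} = {Up ?k, Up (Suc ?k)}"
    unfolding up_arc_def by (cases "x = X") auto
  have nab: "skip_up ?k q \<noteq> Up ?k \<and> skip_up ?k q \<noteq> Up (Suc ?k)" for q by (cases q) auto
  have range: "\<exists>q. p = skip_up ?k q" if "p \<noteq> Up ?k" "p \<noteq> Up (Suc ?k)" for p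
  proof (cases p)
    case (Up i)
    with that skip_surj[of i ?k] obtain j where "i = skip ?k j" by auto
    then show ?thesis using Up by (intro exI[of _ "Up j"]) simp
  next
    case (Lo j)
    then show ?thesis by (intro exI[of _ "Lo j"]) simp
  qed
  have "skip_up ?k q \<noteq> a" "skip_up ?k q \<noteq> b" for q using nab[of q] ab(2) by blast+
  moreover have "\<exists>q. p = skip_up ?k q" if "p \<noteq> a" "p \<noteq> b" for p using range[of p] that ab(2) by blast
  ultimately show m: "matching (u @ v) w' (delete (skip_up ?k) D)"
    and eq: "D = insert (up_arc x ?k) (relabel (skip_up ?k) (delete (skip_up ?k) D))"
    using matching_delete[OF D arc[unfolded ab(1)] inj_skip_up[of ?k]] ab(1)
    by (simp_all add: skip_up_se)
  show "noncrossing (length (u @ v)) (length w') (delete (skip_up ?k) D)"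
    if nc: "noncrossing (length (u @ [x, dual x] @ v)) (length w') D"
  proof -
    have "noncrossing (length (u @ [x, dual x] @ v)) (length w') (relabel (skip_up ?k) (delete (skip_up ?k) D))"
      by (rule noncrossing_subset[OF nc]) (subst (2) eq, blast)
    moreover have "delete (skip_up ?k) D \<subseteq> points (length (u @ v)) (length w') \<times> points (length (u @ v)) (length w')"
      using matching_mem(3,4)[OF m] by auto
    ultimately show ?thesis
      using noncrossing_relabel[OF rank_mono_skip_up[of ?k "length (u @ v)"]] by simp
  qed
qed

lemma delete_lo_arc:
  assumes D: "matching w (u @ [x, dual x] @ v) D" and arc: "lo_arc x (length u) \<in> D"
  shows "matching w (u @ v) (delete (skip_lo (length u)) D)"
    "D = insert (lo_arc x (length u)) (relabel (skip_lo (length u)) (delete (skip_lo (length u)) D))"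
    "noncrossing (length w) (length (u @ [x, dual x] @ v)) D \<Longrightarrow>
      noncrossing (length w) (length (u @ v)) (delete (skip_lo (length u)) D)"
proof -
  let ?k = "length u"
  obtain a b where ab: "lo_arc x ?k = (a, b)" "{a, b} = {Lo ?k, Lo (Suc ?k)}"
    unfolding lo_arc_def by (cases "x = X") auto
  have nab: "skip_lo ?k q \<noteq> Lo ?k \<and> skip_lo ?k q \<noteq> Lo (Suc ?k)" for q by (cases q) auto
  have range: "\<exists>q. p = skip_lo ?k q" if "p \<noteq> Lo ?k" "p \<noteq> Lo (Suc ?k)" for p
  proof (cases p)
    case (Lo i)
    with that skip_surj[of i ?k] obtain j where "i = skip ?k j" by auto
    then show ?thesis using Lo by (intro exI[of _ "Lo j"]) simp
  next
    case (Up j)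
    then show ?thesis by (intro exI[of _ "Up j"]) simp
  qed
  have "skip_lo ?k q \<noteq> a" "skip_lo ?k q \<noteq> b" for q using nab[of q] ab(2) by blast+
  moreover have "\<exists>q. p = skip_lo ?k q" if "p \<noteq> a" "p \<noteq> b" for p using range[of p] that ab(2) by blast
  ultimately show m: "matching w (u @ v) (delete (skip_lo ?k) D)"
    and eq: "D = insert (lo_arc x ?k) (relabel (skip_lo ?k) (delete (skip_lo ?k) D))"
    using matching_delete[OF D arc[unfolded ab(1)] inj_skip_lo[of ?k]] ab(1)
    by (simp_all add: skip_lo_se)
  show "noncrossing (length w) (length (u @ v)) (delete (skip_lo ?k) D)"
    if nc: "noncrossing (length w) (length (u @ [x, dual x] @ v)) D"
  proof -
    have "noncrossing (length w) (length (u @ [x, dual x] @ v)) (relabel (skip_lo ?k) (delete (skip_lo ?k) D))"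
      by (rule noncrossing_subset[OF nc]) (subst (2) eq, blast)
    moreover have "delete (skip_lo ?k) D \<subseteq> points (length w) (length (u @ v)) \<times> points (length w) (length (u @ v))"
      using matching_mem(3,4)[OF m] by auto
    ultimately show ?thesis
      using noncrossing_relabel[OF rank_mono_skip_lo[of ?k "length (u @ v)"]] by simp
  qed
qed

text \<open>The reflexive closure covers two situations: an upper point of \<open>D\<close> is
  linked to the outside by a vertical string of the cap, while a lower point of \<open>D\<close> is
  an outer point itself.\<close>

lemma cap_glue:
  assumes "matching (u @ v) w' D"
  shows "s \<in> starts (u @ v) w' \<Longrightarrow>
      (outer (skip_up (length u) s), lower_half s) \<in> (glue (cap u x v) D)\<^sup>*"
    "t \<in> ends (u @ v) w' \<Longrightarrow>
      (lower_half t, outer (skip_up (length u) t)) \<in> (glue (cap u x v) D)\<^sup>*"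
proof -
  show "(outer (skip_up (length u) s), lower_half s) \<in> (glue (cap u x v) D)\<^sup>*" if "s \<in> starts (u @ v) w'"
    using that glueI(1)[OF cap_through(1)[of _ u v x], of _ D] by (cases s) (auto intro!: r_into_rtrancl)
  show "(lower_half t, outer (skip_up (length u) t)) \<in> (glue (cap u x v) D)\<^sup>*" if "t \<in> ends (u @ v) w'"
    using that glueI(1)[OF cap_through(2)[of _ u v x], of _ D] by (cases t) (auto intro!: r_into_rtrancl)
qed

lemma cup_glue:
  shows "s \<in> starts w (u @ v) \<Longrightarrow>
      (outer (skip_lo (length u) s), upper_half s) \<in> (glue D (cup u x v))\<^sup>*"
    "t \<in> ends w (u @ v) \<Longrightarrow>
      (upper_half t, outer (skip_lo (length u) t)) \<in> (glue D (cup u x v))\<^sup>*"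
proof -
  show "(outer (skip_lo (length u) s), upper_half s) \<in> (glue D (cup u x v))\<^sup>*" if "s \<in> starts w (u @ v)"
    using that glueI(2)[OF cup_through(2)[of _ u v x], of _ D] by (cases s) (auto intro!: r_into_rtrancl)
  show "(upper_half t, outer (skip_lo (length u) t)) \<in> (glue D (cup u x v))\<^sup>*" if "t \<in> ends w (u @ v)"
    using that glueI(2)[OF cup_through(1)[of _ u v x], of _ D] by (cases t) (auto intro!: r_into_rtrancl)
qed


text \<open>The arc of \<open>D\<close> is found in the cap itself; every other string runs through
  the vertical strings of the cap into the reduced diagram. This peels one arc off the top.\<close>

lemma vconcat_cap_delete:
  assumes D: "matching (u @ [x, dual x] @ v) w' D" and arc: "up_arc x (length u) \<in> D"
  shows "vconcat (cap u x v) (delete (skip_up (length u)) D) = D"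
proof (rule vconcat_eqI[OF K_matching[OF K_cap] delete_up_arc(1)[OF D arc] D])
  let ?f = "skip_up (length u)" and ?D = "delete (skip_up (length u)) D"
  let ?G = "glue (cap u x v) ?D"
  note m = delete_up_arc(1)[OF D arc]
  fix s t assume "(s, t) \<in> D"
  then have "(s, t) \<in> insert (up_arc x (length u)) (relabel ?f ?D)"
    by (simp only: delete_up_arc(2)[OF D arc, symmetric])
  then consider "(s, t) = up_arc x (length u)" | s' t' where "s = ?f s'" "t = ?f t'" "(s', t') \<in> ?D"
    by auto
  then show "(outer s, outer t) \<in> ?G\<^sup>+"
  proof cases
    case 1
    then have "(upper_half s, upper_half t) \<in> ?G" using glueI(1) cap_arc by metis
    moreover have "upper_half s = outer s" "upper_half t = outer t"
      using 1 by (auto simp: up_arc_def split: if_splits)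
    ultimately show ?thesis by auto
  next
    case 2
    have "(lower_half s', lower_half t') \<in> ?G" using glueI(2) 2(3) .
    with cap_glue(1)[OF m matching_mem(1)[OF m 2(3)]] cap_glue(2)[OF m matching_mem(2)[OF m 2(3)]]
    show ?thesis unfolding 2 by (meson rtrancl_into_trancl1 trancl_rtrancl_trancl)
  qed
qed

lemma vconcat_cup:
  assumes D0: "matching w (u @ v) D0"
    and D: "matching w (u @ [x, dual x] @ v) (insert (lo_arc x (length u)) (relabel (skip_lo (length u)) D0))"
  shows "vconcat D0 (cup u x v) = insert (lo_arc x (length u)) (relabel (skip_lo (length u)) D0)"
proof (rule vconcat_eqI[OF D0 K_matching[OF K_cup] D])
  let ?f = "skip_lo (length u)"
  let ?G = "glue D0 (cup u x v)"
  fix s t assume "(s, t) \<in> insert (lo_arc x (length u)) (relabel ?f D0)"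
  then consider "(s, t) = lo_arc x (length u)" | s' t' where "s = ?f s'" "t = ?f t'" "(s', t') \<in> D0"
    by auto
  then show "(outer s, outer t) \<in> ?G\<^sup>+"
  proof cases
    case 1
    then have "(lower_half s, lower_half t) \<in> ?G" using glueI(2) cup_arc by metis
    moreover have "lower_half s = outer s" "lower_half t = outer t"
      using 1 by (auto simp: lo_arc_def split: if_splits)
    ultimately show ?thesis by auto
  next
    case 2
    have "(upper_half s', upper_half t') \<in> ?G" using glueI(1) 2(3) .
    with cup_glue(1)[OF matching_mem(1)[OF D0 2(3)]] cup_glue(2)[OF matching_mem(2)[OF D0 2(3)]]
    show ?thesis unfolding 2 by (meson rtrancl_into_trancl1 trancl_rtrancl_trancl)
  qed
qed

lemma converse_insert: "(insert (a, b) R)\<inverse> = insert (b, a) (R\<inverse>)"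
  by auto

text \<open>Needed when a cup is put below a composite of two diagrams: there the diagram containing
  the new arc is not given in advance but has to be built.\<close>

lemma insert_lo_arc:
  assumes D0: "matching w (u @ v) D0"
  shows "matching w (u @ [x, dual x] @ v) (insert (lo_arc x (length u)) (relabel (skip_lo (length u)) D0))"
proof -
  let ?k = "length u" let ?f = "skip_lo (length u)"
  obtain a b where ab: "lo_arc x ?k = (a, b)" "{a, b} = {Lo ?k, Lo (Suc ?k)}" "a \<noteq> b"
    "a \<in> starts w (u @ [x, dual x] @ v)" "b \<in> ends w (u @ [x, dual x] @ v)"
    by (cases x) (auto simp: lo_arc_def nth_append)
  have cover: "p \<in> range ?f \<or> p = a \<or> p = b" for p
  proof (cases p)
    case (Lo i)
    show ?thesis
    proof (cases "i = ?k \<or> i = Suc ?k")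
      case False
      then obtain j where "i = skip ?k j" using skip_surj by blast
      then show ?thesis using Lo by (auto intro!: image_eqI[of _ _ "Lo j"])
    qed (use Lo ab(2) in auto)
  qed (auto intro!: image_eqI[of _ _ "Up _"])
  have nab: "?f q \<noteq> a" "?f q \<noteq> b" for q using ab(2) by (cases q; fastforce simp: doubleton_eq_iff)+
  have "p \<in> starts w (u @ [x, dual x] @ v) \<longleftrightarrow> p = a \<or> p \<in> ?f ` starts w (u @ v)" for p
    using cover[of p] ab nab starts_Int_ends[of w "u @ [x, dual x] @ v"]
      skip_lo_se(1)[of u _ w x "dual x" v] inj_skip_lo[of ?k] by (auto simp: inj_image_mem_iff)
  moreover have "p \<in> ends w (u @ [x, dual x] @ v) \<longleftrightarrow> p = b \<or> p \<in> ?f ` ends w (u @ v)" for p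
    using cover[of p] ab nab starts_Int_ends[of w "u @ [x, dual x] @ v"]
      skip_lo_se(2)[of u _ w x "dual x" v] inj_skip_lo[of ?k] by (auto simp: inj_image_mem_iff)
  ultimately have se: "starts w (u @ [x, dual x] @ v) = insert a (?f ` starts w (u @ v))"
    "ends w (u @ [x, dual x] @ v) = insert b (?f ` ends w (u @ v))" by blast+
  have "single_valued ({(a, b)} \<union> relabel ?f D0)" "single_valued ({(b, a)} \<union> relabel ?f (D0\<inverse>))"
    using D0 nab unfolding matching_def
    by ((intro single_valued_Un single_valued_relabel inj_skip_lo;
        auto simp: Domain_map_prod_image single_valued_def dest: sym)+)
  then show ?thesis
    using D0 unfolding matching_def se ab(1)
    by (simp add: Domain_map_prod_image converse_map_prod_image converse_insert flip: insert_is_Un)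
qed

lemma vconcat_delete_cup:
  assumes D: "matching w (u @ [x, dual x] @ v) D" and arc: "lo_arc x (length u) \<in> D"
  shows "vconcat (delete (skip_lo (length u)) D) (cup u x v) = D"
  using vconcat_cup[OF delete_lo_arc(1)[OF D arc], of x] delete_lo_arc(2)[OF D arc] D by simp

lemma vconcat_id:
  assumes D: "matching w w' D"
  shows "vconcat D (id_diagram w') = D"
proof (rule vconcat_eqI[OF D matching_id D])
  let ?G = "glue D (id_diagram w')"
  fix s t assume st: "(s, t) \<in> D"
  have "(outer s, upper_half s) \<in> ?G\<^sup>*"
  proof (cases s)
    case (Lo j)
    then have "(Lo j, Up j) \<in> id_diagram w'" using matching_mem(1)[OF D st] by (simp add: mem_id_diagram)
    then show ?thesis using glueI(2)[of "Lo j" "Up j" "id_diagram w'" D] Lo by auto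
  qed simp
  moreover have "(upper_half t, outer t) \<in> ?G\<^sup>*"
  proof (cases t)
    case (Lo j)
    then have "(Up j, Lo j) \<in> id_diagram w'" using matching_mem(2)[OF D st] by (simp add: mem_id_diagram)
    then show ?thesis using glueI(2)[of "Up j" "Lo j" "id_diagram w'" D] Lo by auto
  qed simp
  moreover have "(upper_half s, upper_half t) \<in> ?G" using glueI(1) st .
  ultimately show "(outer s, outer t) \<in> ?G\<^sup>+" by (meson rtrancl_into_trancl1 trancl_rtrancl_trancl)
qed

section \<open>Loop counts with elementary diagrams\<close>

lemma loops_eq_cycles: "loops D D' = card (cycles (glue D D'))"
  by (simp add: loops_def cycles_def)

lemma cycle_edges:
  assumes "(x, x) \<in> G\<^sup>+"
  shows "\<exists>y z. (x, y) \<in> G \<and> (z, x) \<in> G \<and> (x, y) \<in> G\<^sup>* \<and> (x, z) \<in> G\<^sup>*"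
proof -
  obtain y where "(x, y) \<in> G" using assms by (metis converse_tranclE)
  moreover obtain z where "(x, z) \<in> G\<^sup>*" "(z, x) \<in> G" using assms by (metis tranclD2)
  ultimately show ?thesis by blast
qed

text \<open>If \<open>D'\<close> has no string returning to its upper edge, both edges at a point of
  a cycle come from \<open>D\<close>. That lower point of \<open>D\<close> would then be a start and
  an end at once.\<close>

lemma loops_0_right:
  assumes D: "matching w w' D" and D': "matching w' w'' D'"
    and through: "\<And>s t. (s, t) \<in> D' \<Longrightarrow> \<exists>j. s = Lo j \<or> t = Lo j"
  shows "loops D D' = 0"
proof -
  have False if cyc: "(p, p) \<in> (glue D D')\<^sup>+" for p
  proof -
    obtain q r where qr: "(p, q) \<in> glue D D'" "(r, p) \<in> glue D D'"
      "(p, q) \<in> (glue D D')\<^sup>*" "(p, r) \<in> (glue D D')\<^sup>*" using cycle_edges[OF cyc] by blast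
    then obtain k k' k'' where k: "p = Mid k" "q = Mid k'" "r = Mid k''"
      using cycle_glue_Mid[OF D D' cyc] by (metis rtrancl.rtrancl_refl)
    have N: "\<not> (Mid i, Mid j) \<in> map_prod lower_half lower_half ` D'" for i j
      using through by (auto elim!: lower_half.elims) (metis lower_half.simps(2) glued_point.distinct(5))+
    then have e: "(Mid k, Mid k') \<in> map_prod upper_half upper_half ` D"
      "(Mid k'', Mid k) \<in> map_prod upper_half upper_half ` D"
      using qr(1,2) N[of k k'] N[of k'' k] unfolding k glue_def by (auto simp only: Un_iff)
    have "Mid k \<in> upper_half ` Domain D" "Mid k \<in> upper_half ` Range D"
      using DomainI[OF e(1)] RangeI[OF e(2)] unfolding Domain_map_prod_image by simp_all
    then show False using D starts_Int_ends[of w w'] unfolding matching_def by auto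
  qed
  then have "cycles (glue D D') = {}" unfolding cycles_def by blast
  then show ?thesis by (simp add: loops_eq_cycles)
qed

lemma loops_0_left:
  assumes D: "matching w w' D" and D': "matching w' w'' D'"
    and through: "\<And>s t. (s, t) \<in> D \<Longrightarrow> \<exists>j. s = Up j \<or> t = Up j"
  shows "loops D D' = 0"
proof -
  have False if cyc: "(p, p) \<in> (glue D D')\<^sup>+" for p
  proof -
    obtain q r where qr: "(p, q) \<in> glue D D'" "(r, p) \<in> glue D D'"
      "(p, q) \<in> (glue D D')\<^sup>*" "(p, r) \<in> (glue D D')\<^sup>*" using cycle_edges[OF cyc] by blast
    then obtain k k' k'' where k: "p = Mid k" "q = Mid k'" "r = Mid k''"
      using cycle_glue_Mid[OF D D' cyc] by (metis rtrancl.rtrancl_refl)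
    have N: "\<not> (Mid i, Mid j) \<in> map_prod upper_half upper_half ` D" for i j
      using through by (auto elim!: upper_half.elims) (metis upper_half.simps(1) glued_point.distinct(1))+
    then have e: "(Mid k, Mid k') \<in> map_prod lower_half lower_half ` D'"
      "(Mid k'', Mid k) \<in> map_prod lower_half lower_half ` D'"
      using qr(1,2) N[of k k'] N[of k'' k] unfolding k glue_def by (auto simp only: Un_iff)
    have "Mid k \<in> lower_half ` Domain D'" "Mid k \<in> lower_half ` Range D'"
      using DomainI[OF e(1)] RangeI[OF e(2)] unfolding Domain_map_prod_image by simp_all
    then show False using D' starts_Int_ends[of w' w''] unfolding matching_def by auto
  qed
  then have "cycles (glue D D') = {}" unfolding cycles_def by blast
  then show ?thesis by (simp add: loops_eq_cycles)
qed

lemma loops_id: "matching w w' D \<Longrightarrow> loops D (id_diagram w') = 0"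
  by (rule loops_0_right[OF _ matching_id]) (auto simp: id_diagram_def)

lemma loops_cup: "matching w (u @ v) D \<Longrightarrow> loops D (cup u x v) = 0"
proof (rule loops_0_right[OF _ K_matching[OF K_cup]])
  note m = K_matching[OF K_cup[of u x v]]
  fix s t assume st: "(s, t) \<in> cup u x v"
  show "\<exists>j. s = Lo j \<or> t = Lo j"
  proof (cases s)
    case (Up i)
    then have i: "i < length (u @ v)" "(u @ v) ! i = X" using matching_mem(1)[OF m st] by simp_all
    then show ?thesis using matching_unique(1)[OF m st] cup_through(1)[OF i, of x] Up by blast
  qed blast
qed

lemma loops_cap: "matching (u @ v) w D \<Longrightarrow> loops (cap u x v) D = 0"
proof (rule loops_0_left[OF K_matching[OF K_cap]])
  note m = K_matching[OF K_cap[of u x v]]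
  fix s t assume st: "(s, t) \<in> cap u x v"
  show "\<exists>j. s = Up j \<or> t = Up j"
  proof (cases s)
    case (Lo i)
    then have i: "i < length (u @ v)" "(u @ v) ! i = X_star" using matching_mem(1)[OF m st] by simp_all
    then show ?thesis using matching_unique(1)[OF m st] cap_through(2)[OF i, of x] Lo by blast
  qed blast
qed

subsection \<open>Decomposition into elementary diagrams\<close>

lemma rank_surj: "r < m + n \<Longrightarrow> \<exists>p\<in>points m n. rank m n p = r"
proof (cases "r < m")
  case True
  then show ?thesis by (intro bexI[of _ "Up r"]) simp_all
next
  case False
  assume "r < m + n"
  with False show ?thesis by (intro bexI[of _ "Lo (n - 1 - (r - m))"]) auto
qed

lemma rank_bound: "p \<in> points m n \<Longrightarrow> rank m n p < m + n"
  by (cases p) auto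

lemma crossed_commute: "crossed c a b e \<longleftrightarrow> crossed a c b e" "crossed a c e b \<longleftrightarrow> crossed a c b e"
  by (simp_all add: crossed_def min.commute max.commute)

lemma noncrossing_joined:
  assumes "noncrossing m n D" "(a, c) \<in> D \<or> (c, a) \<in> D" "(b, e) \<in> D \<or> (e, b) \<in> D"
  shows "\<not> crossed (rank m n a) (rank m n c) (rank m n b) (rank m n e)"
  using assms noncrossingD[OF assms(1)] crossed_commute by metis

lemma joined_unique:
  assumes "matching w w' D" "(a, b) \<in> D \<or> (b, a) \<in> D" "(a, e) \<in> D \<or> (e, a) \<in> D"
  shows "b = e"
  using assms(2,3) matching_unique'[OF assms(1)] by blast

text \<open>The point next to \<open>a\<close> lies under the chord from \<open>a\<close> to
  \<open>b\<close>, so its partner \<open>e\<close> is trapped under that chord as well.\<close>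

lemma not_crossed_nested:
  assumes "\<not> crossed a b c e" "\<not> crossed c e a b" "c = Suc a" "c < b" "e \<noteq> a" "e \<noteq> b" "e \<noteq> c"
  shows "c < e" "e < b"
  using assms unfolding crossed_def by (auto simp: min_def max_def split: if_splits)

lemma not_crossed_through:
  assumes "\<not> crossed i x i' x'" "\<not> crossed i' x' i x" "i = i' \<longleftrightarrow> x = x'"
    "i < x" "i < x'" "i' < x" "i' < x'"
  shows "i < i' \<longleftrightarrow> x' < x"
  using assms unfolding crossed_def by (auto simp: min_def max_def split: if_splits)

text \<open>If \<open>b\<close> is not next to \<open>a\<close>, the neighbour of \<open>a\<close>
  is joined to a point strictly under the same chord, and this shorter chord replaces the given one.
  The bounds on the ranks are carried along because they keep the arc found on the edge where the
  given one lies.\<close>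

lemma innermost:
  assumes D: "matching w w' D" and nc: "noncrossing m n D" and mn: "m = length w" "n = length w'"
    and "(a, b) \<in> D \<or> (b, a) \<in> D" "rank m n a < rank m n b"
  shows "\<exists>p q. ((p, q) \<in> D \<or> (q, p) \<in> D) \<and> rank m n q = Suc (rank m n p) \<and>
    rank m n a \<le> rank m n p \<and> rank m n q \<le> rank m n b"
  using assms(5,6)
proof (induction "rank m n b - rank m n a" arbitrary: a b rule: less_induct)
  case less
  let ?r = "rank m n"
  have abp: "a \<in> points m n" "b \<in> points m n"
    using less.prems(1) matching_mem(3,4)[OF D] unfolding mn by blast+
  show ?case
  proof (cases "?r b = Suc (?r a)")
    case True
    then show ?thesis using less.prems by (intro exI[of _ a] exI[of _ b]) auto
  next
    case False
    have "Suc (?r a) < m + n" using less.prems(2) rank_bound[OF abp(2)] by simp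
    then obtain c where c: "c \<in> points m n" "?r c = Suc (?r a)" using rank_surj by blast
    have "c \<in> starts w w' \<union> ends w w'" using c(1) starts_Un_ends unfolding mn by blast
    then obtain e where e: "(c, e) \<in> D \<or> (e, c) \<in> D" using matching_out[OF D] matching_in[OF D] by blast
    have ep: "e \<in> points m n" using e matching_mem(3,4)[OF D] unfolding mn by blast
    have cab: "c \<noteq> a" "c \<noteq> b" using c(2) False by auto
    have "e \<noteq> a" "e \<noteq> b" "e \<noteq> c"
      using joined_unique[OF D, of b a c] joined_unique[OF D, of a b c] e less.prems(1) cab matching_mem(5)[OF D]
      by blast+
    then have "?r e \<noteq> ?r a" "?r e \<noteq> ?r b" "?r e \<noteq> ?r c" using rank_inj ep abp c(1) by blast+
    moreover have "\<not> crossed (?r a) (?r b) (?r c) (?r e)" "\<not> crossed (?r c) (?r e) (?r a) (?r b)"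
      using noncrossing_joined[OF nc] e less.prems(1) by blast+
    ultimately have "?r c < ?r e" "?r e < ?r b"
      using not_crossed_nested[of "?r a" "?r b" "?r c" "?r e"] c(2) less.prems(2) False by simp_all
    then have "\<exists>p q. ((p, q) \<in> D \<or> (q, p) \<in> D) \<and> ?r q = Suc (?r p) \<and> ?r c \<le> ?r p \<and> ?r q \<le> ?r e"
      by (intro less.hyps) (use c(2) e in auto)
    then obtain p q where pq: "(p, q) \<in> D \<or> (q, p) \<in> D" "?r q = Suc (?r p)" "?r c \<le> ?r p" "?r q \<le> ?r e" by blast
    moreover have "?r a \<le> ?r p" "?r q \<le> ?r b" using pq \<open>?r e < ?r b\<close> c(2) by linarith+
    ultimately show ?thesis by blast
  qed
qed

lemma split_at_arc:
  assumes "Suc k < length w" "w ! Suc k = dual (w ! k)"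
  shows "\<exists>u v. length u = k \<and> w = u @ [w ! k, dual (w ! k)] @ v"
proof (intro exI conjI)
  show "length (take k w) = k" using assms by simp
  show "w = take k w @ [w ! k, dual (w ! k)] @ drop (Suc (Suc k)) w"
    using assms by (metis Cons_nth_drop_Suc Suc_lessD append_Cons append_Nil append_take_drop_id)
qed

lemma strict_mono_ge_index:
  fixes \<phi> :: "nat \<Rightarrow> nat"
  assumes "\<And>i j. i < j \<Longrightarrow> j < m \<Longrightarrow> \<phi> i < \<phi> j" "i < m"
  shows "i \<le> \<phi> i"
  using assms(2)
proof (induction i)
  case (Suc i)
  then have "i \<le> \<phi> i" "\<phi> i < \<phi> (Suc i)" using assms(1)[of i "Suc i"] by auto
  then show ?case by simp
qed simp

text \<open>The lower edge is traversed backwards, so noncrossing makes the pairing of upper with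
  lower positions strictly increasing. It and its inverse thus never decrease a position, which
  leaves only the identity; comparing labels then gives \<open>w = w'\<close>.\<close>

lemma through_eq_id:
  assumes D: "D \<in> K w w'"
    and through: "\<And>s t. (s, t) \<in> D \<Longrightarrow> \<exists>i j. (s, t) = (Up i, Lo j) \<or> (s, t) = (Lo j, Up i)"
  shows "w = w' \<and> D = id_diagram w"
proof -
  let ?m = "length w" and ?n = "length w'"
  have m: "matching w w' D" and nc: "noncrossing ?m ?n D" using D by (simp_all add: K_iff)
  define J where "J i j \<longleftrightarrow> (Up i, Lo j) \<in> D \<or> (Lo j, Up i) \<in> D" for i j
  have J_bound: "i < ?m" "j < ?n" if "J i j" for i j
    using that matching_mem(3,4)[OF m] unfolding J_def by fastforce+
  have J_mono: "i < i' \<longleftrightarrow> j < j'" if J: "J i j" "J i' j'" for i i' j j'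
  proof -
    have "\<not> crossed i (?m + (?n - 1 - j)) i' (?m + (?n - 1 - j'))" "\<not> crossed i' (?m + (?n - 1 - j')) i (?m + (?n - 1 - j))"
      using noncrossing_joined[OF nc, of "Up i" "Lo j" "Up i'" "Lo j'"]
        noncrossing_joined[OF nc, of "Up i'" "Lo j'" "Up i" "Lo j"] J unfolding J_def by simp_all
    moreover have "i = i' \<longleftrightarrow> j = j'"
      using J joined_unique[OF m, of "Up i" "Lo j" "Lo j'"] joined_unique[OF m, of "Lo j" "Up i" "Up i'"]
      unfolding J_def by auto
    moreover have "j = j' \<longleftrightarrow> ?m + (?n - 1 - j) = ?m + (?n - 1 - j')"
      "j < j' \<longleftrightarrow> ?m + (?n - 1 - j') < ?m + (?n - 1 - j)"
      using J_bound[OF J(1)] J_bound[OF J(2)] by linarith+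
    moreover have "i < ?m + (?n - 1 - j)" "i < ?m + (?n - 1 - j')" "i' < ?m + (?n - 1 - j)" "i' < ?m + (?n - 1 - j')"
      using J_bound(1)[OF J(1)] J_bound(1)[OF J(2)] by linarith+
    ultimately show ?thesis
      using not_crossed_through[of i "?m + (?n - 1 - j)" i' "?m + (?n - 1 - j')"] by metis
  qed
  have total: "p \<in> starts w w' \<union> ends w w'" if "p \<in> points ?m ?n" for p using that starts_Un_ends by blast
  have "\<exists>j. J i j" if "i < ?m" for i
    using total[of "Up i"] that matching_out[OF m, of "Up i"] matching_in[OF m, of "Up i"] through
    unfolding J_def by fastforce
  then obtain \<phi> where \<phi>: "\<And>i. i < ?m \<Longrightarrow> J i (\<phi> i)" by metis
  have "\<exists>i. J i j" if "j < ?n" for j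
    using total[of "Lo j"] that matching_out[OF m, of "Lo j"] matching_in[OF m, of "Lo j"] through
    unfolding J_def by fastforce
  then obtain \<psi> where \<psi>: "\<And>j. j < ?n \<Longrightarrow> J (\<psi> j) j" by metis
  have J_eq: "j = i" if "J i j" for i j
  proof -
    have \<phi>_mono: "\<phi> k < \<phi> l" if "k < l" "l < ?m" for k l using J_mono[OF \<phi>[of k] \<phi>[of l]] that by simp
    have \<psi>_mono: "\<psi> k < \<psi> l" if "k < l" "l < ?n" for k l using J_mono[OF \<psi>[of k] \<psi>[of l]] that by simp
    have "i \<le> \<phi> i" by (rule strict_mono_ge_index[OF \<phi>_mono J_bound(1)[OF that]])
    moreover have "j \<le> \<psi> j" by (rule strict_mono_ge_index[OF \<psi>_mono J_bound(2)[OF that]])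
    moreover have "\<phi> i = j" "\<psi> j = i"
      using J_mono[OF that \<phi>[OF J_bound(1)[OF that]]] J_mono[OF \<phi>[OF J_bound(1)[OF that]] that]
        J_mono[OF that \<psi>[OF J_bound(2)[OF that]]] J_mono[OF \<psi>[OF J_bound(2)[OF that]] that] by auto
    ultimately show ?thesis by simp
  qed
  have "?m \<le> ?n" using \<phi> J_eq J_bound(2) by (metis leI less_irrefl)
  moreover have "?n \<le> ?m" using \<psi> J_eq J_bound(1) by (metis leI less_irrefl)
  ultimately have len: "?m = ?n" by simp
  have id: "J i i" if "i < ?m" for i using \<phi>[OF that] J_eq by metis
  have "w ! i = w' ! i" if "i < ?m" for i
    using id[OF that] matching_mem(1,2)[OF m, of "Up i" "Lo i"] matching_mem(1,2)[OF m, of "Lo i" "Up i"]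
    unfolding J_def by auto
  then have eq: "w = w'" using len by (simp add: list_eq_iff_nth_eq)
  have "id_diagram w = D"
  proof (rule matching_subset_eq[OF _ m])
    show "matching w w' (id_diagram w)" using matching_id eq by simp
    show "id_diagram w \<subseteq> D"
    proof (rule subrelI)
      fix s t assume "(s, t) \<in> id_diagram w"
      then obtain i where i: "i < ?m" "(s, t) = (Up i, Lo i) \<and> w ! i = X \<or> (s, t) = (Lo i, Up i) \<and> w ! i = X_star"
        unfolding id_diagram_def by auto
      then show "(s, t) \<in> D"
        using id[OF i(1)] matching_mem(1)[OF m, of "Up i" "Lo i"] matching_mem(1)[OF m, of "Lo i" "Up i"] eq
        unfolding J_def by auto
    qed
  qed
  then show ?thesis using eq by simp
qed

text \<open>The cap and cup cases give \<open>D\<close> in two forms: as a composite, to be used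
  with associativity, and as a set with one string inserted, to be used with products over
  strings.\<close>

lemma K_cases [consumes 1, case_names id cap cup]:
  assumes D: "D \<in> K w w'"
  obtains (id) "w = w'" "D = id_diagram w"
    | (cap) u x v D1 where "w = u @ [x, dual x] @ v" "D1 \<in> K (u @ v) w'" "D = vconcat (cap u x v) D1"
        "D = insert (up_arc x (length u)) (relabel (skip_up (length u)) D1)"
    | (cup) u x v D1 where "w' = u @ [x, dual x] @ v" "D1 \<in> K w (u @ v)" "D = vconcat D1 (cup u x v)"
        "D = insert (lo_arc x (length u)) (relabel (skip_lo (length u)) D1)"
proof -
  let ?m = "length w" and ?n = "length w'" and ?r = "rank (length w) (length w')"
  have m: "matching w w' D" and nc: "noncrossing ?m ?n D" using D by (simp_all add: K_iff)
  consider (up) i j where "(Up i, Up j) \<in> D" | (lo) i j where "(Lo i, Lo j) \<in> D"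
    | (through) "\<And>s t. (s, t) \<in> D \<Longrightarrow> \<exists>i j. (s, t) = (Up i, Lo j) \<or> (s, t) = (Lo j, Up i)"
    by (metis point.exhaust)
  then show ?thesis
  proof cases
    case up
    obtain i j where ij: "(Up i, Up j) \<in> D \<or> (Up j, Up i) \<in> D" "i < j"
      using up matching_mem(5)[OF m up] by (metis linorder_neqE_nat)
    then have "j < ?m" using matching_mem(3,4)[OF m] by fastforce
    obtain p q where pq: "(p, q) \<in> D \<or> (q, p) \<in> D" "?r q = Suc (?r p)" "?r q \<le> j"
      using innermost[OF m nc refl refl ij(1)] ij(2) by (metis rank.simps(1))
    then obtain k where k: "p = Up k" "q = Up (Suc k)"
      using \<open>j < ?m\<close> by (cases p; cases q) auto
    then have arc: "up_arc (w ! k) k \<in> D" and w: "Suc k < ?m" "w ! Suc k = dual (w ! k)"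
      using pq(1) matching_mem(1,2)[OF m] by (fastforce simp: up_arc_def)+
    from split_at_arc[OF w] obtain u v where uv: "length u = k" "w = u @ [w ! k, dual (w ! k)] @ v" by blast
    define x where "x = w ! k"
    have uv': "w = u @ [x, dual x] @ v" "k = length u" using uv by (simp_all add: x_def)
    have arc': "up_arc x (length u) \<in> D" using arc by (simp add: x_def uv(1))
    note m' = m[unfolded uv'(1)] and nc' = nc[unfolded uv'(1)]
    show ?thesis
      by (rule cap[OF uv'(1) _ vconcat_cap_delete[OF m' arc', symmetric] delete_up_arc(2)[OF m' arc']])
        (use delete_up_arc(1)[OF m' arc'] delete_up_arc(3)[OF m' arc' nc'] in \<open>simp add: K_iff\<close>)
  next
    case lo
    obtain i j where ij: "(Lo i, Lo j) \<in> D \<or> (Lo j, Lo i) \<in> D" "j < i"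
      using lo matching_mem(5)[OF m lo] by (metis linorder_neqE_nat)
    have "i < ?n" using ij matching_mem(3,4)[OF m] by fastforce
    \<comment> \<open>Ranks decrease from left to right on the lower edge, so the point further to
      the right comes first and the arc found joins \<open>Lo (Suc k)\<close> to
      \<open>Lo k\<close>.\<close>
    then have "?r (Lo i) < ?r (Lo j)" "?m \<le> ?r (Lo i)" using ij(2) by simp_all
    then obtain p q where pq: "(p, q) \<in> D \<or> (q, p) \<in> D" "?r q = Suc (?r p)" "?m \<le> ?r p"
      using innermost[OF m nc refl refl ij(1)] by (meson le_trans)
    have "p \<in> points ?m ?n" "q \<in> points ?m ?n" using pq(1) matching_mem(3,4)[OF m] by auto
    with pq obtain k where k: "q = Lo k" "p = Lo (Suc k)"
      by (cases p; cases q) auto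
    then have arc: "lo_arc (w' ! k) k \<in> D" and w: "Suc k < ?n" "w' ! Suc k = dual (w' ! k)"
      using pq(1) matching_mem(1,2)[OF m] by (fastforce simp: lo_arc_def)+
    from split_at_arc[OF w] obtain u v where uv: "length u = k" "w' = u @ [w' ! k, dual (w' ! k)] @ v" by blast
    define x where "x = w' ! k"
    have uv': "w' = u @ [x, dual x] @ v" "k = length u" using uv by (simp_all add: x_def)
    have arc': "lo_arc x (length u) \<in> D" using arc by (simp add: x_def uv(1))
    note m' = m[unfolded uv'(1)] and nc' = nc[unfolded uv'(1)]
    show ?thesis
      by (rule cup[OF uv'(1) _ vconcat_delete_cup[OF m' arc', symmetric] delete_lo_arc(2)[OF m' arc']])
        (use delete_lo_arc(1)[OF m' arc'] delete_lo_arc(3)[OF m' arc' nc'] in \<open>simp add: K_iff\<close>)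
  next
    case through
    then show ?thesis using id through_eq_id[OF D] by blast
  qed
qed

subsection \<open>Closing two adjacent lower points\<close>

lemma cap_through_glue:
  shows "s \<in> starts w (u @ v) \<Longrightarrow>
      (outer s, upper_half (skip_lo (length u) s)) \<in> (glue D (cap u x v))\<^sup>*"
    "t \<in> ends w (u @ v) \<Longrightarrow>
      (upper_half (skip_lo (length u) t), outer t) \<in> (glue D (cap u x v))\<^sup>*"
proof -
  show "(outer s, upper_half (skip_lo (length u) s)) \<in> (glue D (cap u x v))\<^sup>*" if "s \<in> starts w (u @ v)"
    using that glueI(2)[OF cap_through(2)[of _ u v x], of _ D] by (cases s) (auto intro!: r_into_rtrancl)
  show "(upper_half (skip_lo (length u) t), outer t) \<in> (glue D (cap u x v))\<^sup>*" if "t \<in> ends w (u @ v)"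
    using that glueI(2)[OF cap_through(1)[of _ u v x], of _ D] by (cases t) (auto intro!: r_into_rtrancl)
qed

lemma Mid_eq_half: "Mid i = upper_half p \<longleftrightarrow> p = Lo i" "Mid i = lower_half p \<longleftrightarrow> p = Up i"
  by (cases p; auto)+

text \<open>A symmetric form of crossing: exactly one of \<open>y\<close> and \<open>z\<close> lies
  between \<open>c\<close> and \<open>e\<close>. It shows at once that replacing an end by an
  adjacent rank changes nothing.\<close>

lemma crossed_iff_between:
  assumes "y \<noteq> c" "y \<noteq> e" "z \<noteq> c" "z \<noteq> e" "c \<noteq> e"
  shows "crossed y z c e \<or> crossed c e y z \<longleftrightarrow>
    (min c e < y \<and> y < max c e) \<noteq> (min c e < z \<and> z < max c e)"
proof -
  have "crossed y z c e \<or> crossed c e y z \<longleftrightarrow> (l < y \<and> y < h) \<noteq> (l < z \<and> z < h)"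
    if "l = min c e" "h = max c e" for l h
  proof -
    have "y \<noteq> l" "y \<noteq> h" "z \<noteq> l" "z \<noteq> h" "l < h" using that assms by (auto simp: min_def max_def)
    then show ?thesis unfolding crossed_def that[symmetric] by (cases "y < z") (simp_all, linarith+)
  qed
  then show ?thesis by simp
qed

lemma cap_arc_unique:
  assumes "(Up i, Up j) \<in> cap u x v"
  shows "(Up i, Up j) = up_arc x (length u)"
proof -
  let ?k = "length u"
  note m = K_matching[OF K_cap[of u x v]]
  have i: "i = ?k \<or> i = Suc ?k"
  proof (rule ccontr)
    assume "\<not> ?thesis"
    then obtain i' where i': "i = skip ?k i'" using skip_surj by blast
    have "Up i \<in> starts (u @ [x, dual x] @ v) (u @ v)" using matching_mem(1)[OF m assms] .
    then have "i' < length (u @ v)" "(u @ v) ! i' = X" unfolding i' by simp_all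
    from matching_unique(1)[OF m assms[unfolded i'] cap_through(1)[OF this]] show False by simp
  qed
  obtain a b where ab: "up_arc x ?k = (Up a, Up b)" "{a, b} = {?k, Suc ?k}"
    unfolding up_arc_def by (cases "x = X") auto
  have arc: "(Up a, Up b) \<in> cap u x v" using cap_arc[of x u v] ab(1) by simp
  from matching_unique'[OF m assms arc] i ab(2) have "i = a" "j = b" by (auto simp: doubleton_eq_iff)
  then show ?thesis using ab(1) by simp
qed

context
  fixes u v x a b w D p q
  assumes D: "D \<in> K w (u @ [x, dual x] @ v)"
    and ab: "up_arc x (length u) = (Up a, Up b)"
    and pa: "(p, Lo a) \<in> D" and bq: "(Lo b, q) \<in> D"
begin

text \<open>The arc of the cap runs from \<open>a\<close> to \<open>b\<close>. The string of
  \<open>D\<close> arriving at \<open>a\<close> comes from \<open>p\<close>, and the one departing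
  from \<open>b\<close> leads to \<open>q\<close>; the lower arc in the same two places runs back
  from \<open>b\<close> to \<open>a\<close>.\<close>

lemma arc_ab: "lo_arc x (length u) = (Lo b, Lo a)"
  and ab_cases: "a = length u \<and> b = Suc (length u) \<or> a = Suc (length u) \<and> b = length u"
  using ab by (auto simp: up_arc_def lo_arc_def split: if_splits)

lemma matching_D: "matching w (u @ [x, dual x] @ v) D"
  using D by (rule K_matching)

text \<open>No cycle can be made from strings of \<open>D\<close> alone, so it contains the only
  string of the cap with both ends glued, the one from \<open>a\<close> to \<open>b\<close>. From
  \<open>b\<close> it continues to \<open>q\<close>, which must again be followed by that string of
  the cap; hence \<open>q\<close> is \<open>Lo a\<close>.\<close>

lemma cycle_through_cap:
  assumes cyc: "(y, y) \<in> (glue D (cap u x v))\<^sup>+"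
  shows "(y, Mid a) \<in> (glue D (cap u x v))\<^sup>*" "(Lo b, Lo a) \<in> D"
proof -
  let ?G = "glue D (cap u x v)"
  note m = matching_D and mc = K_matching[OF K_cap[of u x v]]
  note Mid = cycle_glue_Mid[OF m mc cyc] and sv = single_valued_glue(1)[OF m mc]
  have capM: "i = a \<and> j = b" if "(Mid i, Mid j) \<in> map_prod lower_half lower_half ` cap u x v" for i j
  proof -
    from that have "(Up i, Up j) \<in> cap u x v" by (auto simp: Mid_eq_half)
    from cap_arc_unique[OF this] show ?thesis using ab by simp
  qed
  obtain y1 y2 where e: "(y, y1) \<in> ?G" "(y2, y) \<in> ?G" "(y, y1) \<in> ?G\<^sup>*" "(y, y2) \<in> ?G\<^sup>*"
    using cycle_edges[OF cyc] by blast
  obtain k k1 k2 where k: "y = Mid k" "y1 = Mid k1" "y2 = Mid k2"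
    using Mid e by (metis rtrancl.rtrancl_refl)
  have "(Mid k, Mid k1) \<in> map_prod lower_half lower_half ` cap u x v \<or>
      (Mid k2, Mid k) \<in> map_prod lower_half lower_half ` cap u x v"
  proof (rule ccontr)
    assume "\<not> ?thesis"
    then have "(Mid k, Mid k1) \<in> map_prod upper_half upper_half ` D"
      "(Mid k2, Mid k) \<in> map_prod upper_half upper_half ` D"
      using e(1,2) unfolding k glue_def by auto
    from DomainI[OF this(1)] RangeI[OF this(2)] have "Lo k \<in> Domain D" "Lo k \<in> Range D"
      unfolding Domain_map_prod_image by simp_all
    then show False using m starts_Int_ends unfolding matching_def by blast
  qed
  then have "k = a \<or> k2 = a" using capM by metis
  then show ya: "(y, Mid a) \<in> ?G\<^sup>*" using e(4) unfolding k by auto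
  have "(Mid a, Mid b) \<in> ?G" using glueI(2)[of "Up a" "Up b" "cap u x v" D] cap_arc[of x u v] ab by simp
  then have yb: "(y, Mid b) \<in> ?G\<^sup>*" using ya by simp
  have bq': "(Mid b, upper_half q) \<in> ?G" using glueI(1)[OF bq, of "cap u x v"] by simp
  then have yq: "(y, upper_half q) \<in> ?G\<^sup>*" using yb by simp
  then obtain j where j: "upper_half q = Mid j" using Mid by blast
  then have q: "q = Lo j" by (cases q) auto
  have "(Mid j, Mid j) \<in> ?G\<^sup>+" using cycle_eq(2)[OF sv cyc yq] j by simp
  from cycle_edges[OF this] obtain z where z: "(Mid j, z) \<in> ?G" "(Mid j, z) \<in> ?G\<^sup>*" by blast
  obtain l where l: "z = Mid l" using Mid rtrancl_trans[OF yq[unfolded j] z(2)] by blast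
  have "(Mid j, Mid l) \<notin> map_prod upper_half upper_half ` D"
  proof
    assume "(Mid j, Mid l) \<in> map_prod upper_half upper_half ` D"
    from DomainI[OF this] have "Lo j \<in> Domain D" unfolding Domain_map_prod_image by simp
    moreover have "Lo j \<in> Range D" using bq q by blast
    ultimately show False using m starts_Int_ends unfolding matching_def by blast
  qed
  then have "j = a" using z(1) capM unfolding l glue_def by (metis UnE)
  then show "(Lo b, Lo a) \<in> D" using bq q by simp
qed

lemma loops_closed: "(Lo b, Lo a) \<in> D \<Longrightarrow> loops D (cap u x v) = 1"
proof -
  let ?G = "glue D (cap u x v)"
  assume ba: "(Lo b, Lo a) \<in> D"
  note sv = single_valued_glue(1)[OF matching_D K_matching[OF K_cap[of u x v]]]
  have "(Mid a, Mid b) \<in> ?G" using glueI(2)[of "Up a" "Up b" "cap u x v" D] cap_arc[of x u v] ab by simp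
  moreover have "(Mid b, Mid a) \<in> ?G" using glueI(1)[OF ba, of "cap u x v"] by simp
  ultimately have "(Mid a, Mid a) \<in> ?G\<^sup>+" by (meson r_into_trancl' trancl_into_trancl)
  moreover have "?G\<^sup>* `` {y} = ?G\<^sup>* `` {Mid a}" if "(y, y) \<in> ?G\<^sup>+" for y
    using cycle_eq(1)[OF sv that cycle_through_cap(1)[OF that]] by simp
  ultimately have "cycles ?G = {?G\<^sup>* `` {Mid a}}" unfolding cycles_def by blast
  then show ?thesis by (simp add: loops_eq_cycles)
qed

lemma loops_open: "(Lo b, Lo a) \<notin> D \<Longrightarrow> loops D (cap u x v) = 0"
proof -
  assume "(Lo b, Lo a) \<notin> D"
  then have "cycles (glue D (cap u x v)) = {}" unfolding cycles_def using cycle_through_cap(2) by blast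
  then show ?thesis by (simp add: loops_eq_cycles)
qed

text \<open>Instead of closing up the lower points \<open>a\<close> and \<open>b\<close>, first join them by an arc of their own and
  connect their partners (a saddle move); the number of points is unchanged and noncrossing is a
  statement about adjacent ranks. The composite with the cap arises by deleting the new arc.\<close>

definition surgery :: diagram where
  "surgery = (if (Lo b, Lo a) \<in> D then D
     else insert (Lo b, Lo a) (insert (p, q) (D - {(p, Lo a), (Lo b, q)})))"

lemma arc_surgery: "(Lo b, Lo a) \<in> surgery"
  by (simp add: surgery_def)

lemma open_neq:
  assumes "(Lo b, Lo a) \<notin> D"
  shows "p \<noteq> Lo a" "p \<noteq> Lo b" "q \<noteq> Lo a" "q \<noteq> Lo b" "p \<noteq> q"
  using assms matching_unique'[OF matching_D pa bq] matching_mem(5)[OF matching_D pa]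
    matching_mem(5)[OF matching_D bq] pa bq by auto

lemma matching_surgery: "matching w (u @ [x, dual x] @ v) surgery"
proof (cases "(Lo b, Lo a) \<in> D")
  case True
  then show ?thesis using matching_D by (simp add: surgery_def)
next
  case False
  note u = matching_unique[OF matching_D]
  have "Domain surgery = Domain D" "Range surgery = Range D"
    using pa bq False by (auto simp: surgery_def)
  moreover have "single_valued surgery" "single_valued (surgery\<inverse>)"
    using u pa bq False unfolding surgery_def single_valued_def by auto
  ultimately show ?thesis using matching_D unfolding matching_def by simp
qed

lemma not_crossed_adjacent:
  assumes "c \<noteq> r" "c \<noteq> Suc r" "e \<noteq> r" "e \<noteq> Suc r"
  shows "\<not> crossed r (Suc r) c e" "\<not> crossed (Suc r) r c e" "\<not> crossed c e r (Suc r)" "\<not> crossed c e (Suc r) r"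
  using assms unfolding crossed_def by (auto simp: min_def max_def)

text \<open>The adjacent ranks \<open>r\<close> and \<open>r'\<close> lie on the same side of every
  other chord. If neither \<open>y r\<close> nor \<open>r' z\<close> crosses it, then
  \<open>y\<close> and \<open>z\<close> lie on that side too.\<close>

lemma not_crossed_merge:
  assumes "r' = Suc r \<or> r = Suc r'" "c \<noteq> r" "c \<noteq> r'" "e \<noteq> r" "e \<noteq> r'"
    "\<not> crossed y r c e" "\<not> crossed c e y r" "\<not> crossed r' z c e" "\<not> crossed c e r' z"
    "y \<noteq> c" "y \<noteq> e" "z \<noteq> c" "z \<noteq> e" "c \<noteq> e"
  shows "\<not> crossed y z c e" "\<not> crossed c e y z"
proof -
  have "(min c e < r \<and> r < max c e) = (min c e < r' \<and> r' < max c e)"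
    using assms(1-5) by (auto simp: min_def max_def)
  then have "\<not> (crossed y z c e \<or> crossed c e y z)"
    using crossed_iff_between[of y c e r] crossed_iff_between[of r' c e z] crossed_iff_between[of y c e z] assms
    by metis
  then show "\<not> crossed y z c e" "\<not> crossed c e y z" by simp_all
qed

lemma K_surgery: "surgery \<in> K w (u @ [x, dual x] @ v)"
proof (cases "(Lo b, Lo a) \<in> D")
  case True
  then show ?thesis using D by (simp add: surgery_def)
next
  case False
  define m n where mn: "m = length w" "n = length (u @ [x, dual x] @ v)"
  let ?r = "rank m n" let ?P = "points m n"
  have nc: "noncrossing m n D" using D by (simp add: K_iff mn)
  have pts: "s \<in> ?P" "t \<in> ?P" if "(s, t) \<in> D" for s t
    using matching_mem(3,4)[OF matching_D that] unfolding mn by auto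
  have adj: "?r (Lo b) = Suc (?r (Lo a)) \<or> ?r (Lo a) = Suc (?r (Lo b))"
    using ab_cases by (auto simp: mn)
  \<comment> \<open>The kept strings are compared with the two new ones. For \<open>(p, q)\<close>
    the merging of two strings at adjacent ranks applies; the arc \<open>(Lo b, Lo a)\<close> is
    harmless because no rank lies between its feet.\<close>
  have rest: "\<not> crossed (?r p) (?r q) (?r s) (?r t)" "\<not> crossed (?r s) (?r t) (?r p) (?r q)"
    "\<not> crossed (?r (Lo b)) (?r (Lo a)) (?r s) (?r t)" "\<not> crossed (?r s) (?r t) (?r (Lo b)) (?r (Lo a))"
    if st: "(s, t) \<in> D" "(s, t) \<noteq> (p, Lo a)" "(s, t) \<noteq> (Lo b, q)" for s t
  proof -
    have "s \<noteq> p" "t \<noteq> Lo a" "s \<noteq> Lo a" "t \<noteq> p" "s \<noteq> Lo b" "t \<noteq> q" "s \<noteq> q" "t \<noteq> Lo b" "s \<noteq> t"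
      using matching_unique'[OF matching_D st(1) pa] matching_unique'[OF matching_D st(1) bq] st(2,3)
        matching_mem(5)[OF matching_D st(1)] by simp_all
    then have ne: "?r s \<noteq> ?r p" "?r t \<noteq> ?r (Lo a)" "?r s \<noteq> ?r (Lo a)" "?r t \<noteq> ?r p" "?r s \<noteq> ?r (Lo b)"
      "?r t \<noteq> ?r q" "?r s \<noteq> ?r q" "?r t \<noteq> ?r (Lo b)" "?r s \<noteq> ?r t"
      using rank_inj pts[OF st(1)] pts[OF pa] pts[OF bq] by blast+
    note n = noncrossingD[OF nc pa st(1)] noncrossingD[OF nc st(1) pa]
      noncrossingD[OF nc bq st(1)] noncrossingD[OF nc st(1) bq]
    show "\<not> crossed (?r p) (?r q) (?r s) (?r t)" "\<not> crossed (?r s) (?r t) (?r p) (?r q)"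
      by (rule not_crossed_merge[OF adj _ _ _ _ n]; use ne in metis)+
    show "\<not> crossed (?r (Lo b)) (?r (Lo a)) (?r s) (?r t)" "\<not> crossed (?r s) (?r t) (?r (Lo b)) (?r (Lo a))"
      using adj not_crossed_adjacent[of "?r s" "?r (Lo a)" "?r t"] not_crossed_adjacent[of "?r s" "?r (Lo b)" "?r t"] ne
      by metis+
  qed
  have "p \<in> ?P" "q \<in> ?P" "Lo a \<in> ?P" "Lo b \<in> ?P" using pts pa bq by blast+
  then have "?r p \<noteq> ?r (Lo a)" "?r p \<noteq> ?r (Lo b)" "?r q \<noteq> ?r (Lo a)" "?r q \<noteq> ?r (Lo b)"
    using open_neq[OF False] rank_inj by blast+
  then have pqab: "\<not> crossed (?r p) (?r q) (?r (Lo b)) (?r (Lo a))" "\<not> crossed (?r (Lo b)) (?r (Lo a)) (?r p) (?r q)"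
    using adj not_crossed_adjacent[of "?r p" "?r (Lo a)" "?r q"] not_crossed_adjacent[of "?r p" "?r (Lo b)" "?r q"]
    by metis+
  have self: "\<not> crossed c e c e" for c e by (simp add: crossed_def)
  have "\<not> crossed (?r s) (?r t) (?r s') (?r t')" if "(s, t) \<in> surgery" "(s', t') \<in> surgery" for s t s' t'
  proof -
    from that False have "(s, t) = (Lo b, Lo a) \<or> (s, t) = (p, q) \<or> (s, t) \<in> D - {(p, Lo a), (Lo b, q)}"
      "(s', t') = (Lo b, Lo a) \<or> (s', t') = (p, q) \<or> (s', t') \<in> D - {(p, Lo a), (Lo b, q)}"
      by (auto simp: surgery_def)
    then show ?thesis using rest pqab self noncrossingD[OF nc] by auto
  qed
  then have "noncrossing m n surgery" by (auto simp: noncrossing_iff)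
  then show ?thesis using matching_surgery by (simp add: K_iff mn)
qed

lemma vconcat_cap_eq: "vconcat D (cap u x v) = delete (skip_lo (length u)) surgery"
  and vconcat_cap_in_K: "vconcat D (cap u x v) \<in> K w (u @ v)"
proof -
  let ?f = "skip_lo (length u)" and ?G = "glue D (cap u x v)"
  have arc: "lo_arc x (length u) \<in> surgery" using arc_surgery arc_ab by simp
  note del = delete_lo_arc[OF matching_surgery arc]
  show eq: "vconcat D (cap u x v) = delete ?f surgery"
  proof (rule vconcat_eqI[OF matching_D K_matching[OF K_cap] del(1)])
    fix s t assume st: "(s, t) \<in> delete ?f surgery"
    \<comment> \<open>A surviving string is either a string of \<open>D\<close> or the new one from
      \<open>p\<close> to \<open>q\<close>; the latter is the path through \<open>Mid a\<close> and
      \<open>Mid b\<close>.\<close>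
    have "(upper_half (?f s), upper_half (?f t)) \<in> ?G\<^sup>+"
    proof (cases "(?f s, ?f t) \<in> D")
      case True
      then show ?thesis using glueI(1) by (metis r_into_trancl')
    next
      case False
      have "(?f s, ?f t) \<noteq> (Lo b, Lo a)" using ab_cases by (cases s) auto
      then have eq: "?f s = p" "?f t = q" using st False by (auto simp: delete_def surgery_def split: if_splits)
      have "(upper_half p, Mid a) \<in> ?G" using glueI(1)[OF pa, of "cap u x v"] by simp
      moreover have "(Mid a, Mid b) \<in> ?G" using glueI(2)[of "Up a" "Up b" "cap u x v" D] cap_arc[of x u v] ab by simp
      moreover have "(Mid b, upper_half q) \<in> ?G" using glueI(1)[OF bq, of "cap u x v"] by simp
      ultimately show ?thesis unfolding eq by (meson r_into_trancl' trancl_into_trancl)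
    qed
    with cap_through_glue(1)[OF matching_mem(1)[OF del(1) st]] cap_through_glue(2)[OF matching_mem(2)[OF del(1) st]]
    show "(outer s, outer t) \<in> ?G\<^sup>+" by (meson rtrancl_trancl_trancl trancl_rtrancl_trancl)
  qed
  show "vconcat D (cap u x v) \<in> K w (u @ v)"
    using del(1) del(3) K_surgery unfolding eq by (simp add: K_iff)
qed

end

subsection \<open>Matrix coefficients of diagrams\<close>

fun is_lo :: "point \<Rightarrow> bool" where
  "is_lo (Up i) = False"
| "is_lo (Lo j) = True"

text \<open>The exponent with which the matrix of the functor enters along a string: 1 on an upper arc and
  -1 on a lower arc running from right to left, 0 on all other strings. In this form, by ranks, it is
  visibly additive when strings are joined without crossings.\<close>

definition turn :: "nat \<Rightarrow> nat \<Rightarrow> point \<Rightarrow> point \<Rightarrow> int" where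
  "turn m n s t = of_bool (rank m n t < rank m n s) - of_bool (is_lo s)"

fun label :: "nat list \<Rightarrow> nat list \<Rightarrow> point \<Rightarrow> nat" where
  "label I J (Up i) = I ! i"
| "label I J (Lo j) = J ! j"

locale inverse_pair =
  fixes N :: nat and B C :: "nat \<Rightarrow> nat \<Rightarrow> complex" and d :: complex
  assumes BC: "i < N \<Longrightarrow> j < N \<Longrightarrow> (\<Sum>k<N. B i k * C k j) = (if i = j then 1 else 0)"
    and CB: "i < N \<Longrightarrow> j < N \<Longrightarrow> (\<Sum>k<N. C i k * B k j) = (if i = j then 1 else 0)"
    and trace_B: "(\<Sum>i<N. B i i) = d" and trace_C: "(\<Sum>i<N. C i i) = d"
begin

text \<open>The entries of the power of \<open>B\<close> with exponent 1, 0 or -1, the only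
  exponents that \<open>turn\<close> produces.\<close>

definition entry :: "int \<Rightarrow> nat \<Rightarrow> nat \<Rightarrow> complex" where
  "entry e i j = (if e = 1 then B i j else if e = -1 then C i j else if i = j then 1 else 0)"

lemma entry_mult:
  assumes "i < N" "j < N" "e \<in> {-1, 0, 1}" "f \<in> {-1, 0, 1}" "e + f \<in> {-1, 0, 1}"
  shows "(\<Sum>k<N. entry e i k * entry f k j) = entry (e + f) i j"
proof -
  have delta: "(\<Sum>k<N. (if i = k then 1 else 0) * g k) = (g i :: complex)"
    "(\<Sum>k<N. g k * (if k = j then 1 else 0)) = (g j :: complex)" for g
    using assms(1,2) by (simp_all add: if_distrib if_distribR cong: if_cong)
  consider "e = 0" | "f = 0" | "e = 1" "f = -1" | "e = -1" "f = 1" using assms(3-5) by auto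
  then show ?thesis
    by cases (use assms(1,2) BC CB delta in \<open>simp_all add: entry_def\<close>)
qed

text \<open>The end point gives the row and the starting point the column, so that following one
  string after another multiplies the later matrix from the left.\<close>

definition string_weight :: "nat \<Rightarrow> nat \<Rightarrow> (point \<Rightarrow> nat) \<Rightarrow> point \<times> point \<Rightarrow> complex" where
  "string_weight m n L = (\<lambda>(s, t). entry (turn m n s t) (L t) (L s))"

definition weight :: "diagram \<Rightarrow> nat list \<Rightarrow> nat list \<Rightarrow> complex" where
  "weight D I J = prod (string_weight (length I) (length J) (label I J)) D"

definition idx :: "nat \<Rightarrow> nat list set" where
  "idx k = {I. set I \<subseteq> {..<N} \<and> length I = k}"

lemma finite_idx [simp]: "finite (idx k)"
  unfolding idx_def by (rule finite_lists_length_eq) simp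

lemma idx_length: "I \<in> idx k \<Longrightarrow> length I = k"
  by (simp add: idx_def)

lemma idx_nth: "I \<in> idx k \<Longrightarrow> i < k \<Longrightarrow> I ! i < N"
  unfolding idx_def by (metis (mono_tags, lifting) lessThan_iff mem_Collect_eq nth_mem subsetD)

text \<open>The turning exponent depends only on the order of the ranks and on the edge of the
  starting point, and both survive an order-preserving relabelling that respects the edges.\<close>

lemma string_weight_relabel:
  assumes "rank_mono m n m' n' f" "\<And>p. is_lo (f p) = is_lo p" "inj f"
    "D \<subseteq> points m n \<times> points m n" "\<And>p. p \<in> points m n \<Longrightarrow> L' (f p) = L p"
  shows "prod (string_weight m' n' L') (relabel f D) = prod (string_weight m n L) D"
proof -
  have inj: "inj_on (map_prod f f) D" using assms(3) by (meson inj_on_subset prod.inj_map subset_UNIV)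
  have "string_weight m' n' L' (map_prod f f st) = string_weight m n L st" if "st \<in> D" for st
  proof (cases st)
    case (Pair s t)
    then have "s \<in> points m n" "t \<in> points m n" using that assms(4) by auto
    then show ?thesis using assms(1,2,5) unfolding Pair rank_mono_def by (simp add: string_weight_def turn_def)
  qed
  then show ?thesis by (simp add: prod.reindex[OF inj])
qed

lemma matching_points:
  "matching w w' D \<Longrightarrow> D \<subseteq> points (length w) (length w') \<times> points (length w) (length w')"
  using matching_mem(3,4) by auto

lemma weight_hconcat:
  assumes D: "matching w1 w1' D" and D': "matching w2 w2' D'"
    and len: "length I = length w1" "length J = length w1'" "length I' = length w2" "length J' = length w2'"
  shows "weight (hconcat (length w1) (length w1') D D') (I @ I') (J @ J') = weight D I J * weight D' I' J'"
proof -
  let ?s = "shift (length w1) (length w1')"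
  let ?w = "string_weight (length I + length I') (length J + length J') (label (I @ I') (J @ J'))"
  have "D \<inter> relabel ?s D' = {}"
    using matching_points[OF D] shift_notin_points by fastforce
  then have "weight (hconcat (length w1) (length w1') D D') (I @ I') (J @ J') = prod ?w D * prod ?w (relabel ?s D')"
    unfolding weight_def hconcat_def
    by (simp add: prod.union_disjoint matching_finite[OF D] matching_finite[OF D'])
  also have "prod ?w D = weight D I J"
  proof -
    have "label (I @ I') (J @ J') (id p) = label I J p" if "p \<in> points (length I) (length J)" for p
      using that by (cases p) (auto simp: nth_append)
    then have "prod ?w (relabel id D) = weight D I J"
      unfolding weight_def using matching_points[OF D]
      by (intro string_weight_relabel) (simp_all add: rank_mono_id len)
    then show ?thesis by (simp add: map_prod.id)
  qed
  also have "prod ?w (relabel ?s D') = weight D' I' J'"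
  proof -
    have "label (I @ I') (J @ J') (?s p) = label I' J' p" for p
      by (cases p) (auto simp: nth_append len)
    moreover have "is_lo (?s p) = is_lo p" for p by (cases p) auto
    ultimately show ?thesis
      unfolding weight_def using matching_points[OF D']
      by (intro string_weight_relabel[OF _ _ inj_shift]) (simp_all add: rank_mono_shift len)
  qed
  finally show ?thesis .
qed

lemma weight_id:
  assumes "length I = length w" "length J = length w"
  shows "weight (id_diagram w) I J = (if I = J then 1 else 0)"
proof -
  define g where "g i = (if w ! i = X then (Up i, Lo i) else (Lo i, Up i))" for i
  have "id_diagram w = g ` {..<length w}"
    by (auto simp: id_diagram_def g_def image_iff split: if_splits)
  moreover have "inj_on g {..<length w}" by (auto simp: inj_on_def g_def split: if_splits)
  ultimately have "weight (id_diagram w) I J =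
      (\<Prod>i<length w. string_weight (length w) (length w) (label I J) (g i))"
    using assms by (simp add: weight_def prod.reindex)
  also have "\<dots> = (\<Prod>i<length w. if I ! i = J ! i then 1 else 0)"
    by (rule prod.cong) (auto simp: string_weight_def g_def turn_def entry_def)
  also have "\<dots> = (if I = J then 1 else 0)"
  proof (cases "I = J")
    case False
    then obtain i where "i < length w" "I ! i \<noteq> J ! i" using assms by (metis nth_equalityI)
    then have "(\<Prod>i<length w. if I ! i = J ! i then 1 else 0) = (0 :: complex)"
      by (intro prod_zero) auto
    then show ?thesis using False by simp
  qed simp
  finally show ?thesis .
qed

text \<open>The values of the two forms in dual bases: the identity matrix for \<open>E\<close>, the
  matrix \<open>B\<close> for \<open>F\<close>. Correspondingly \<open>cup_entry\<close> holds the
  coefficients of the two coevaluation vectors.\<close>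

definition cap_entry :: "letter \<Rightarrow> nat \<Rightarrow> nat \<Rightarrow> complex" where
  "cap_entry x i j = (if x = X then if i = j then 1 else 0 else B i j)"

definition cup_entry :: "letter \<Rightarrow> nat \<Rightarrow> nat \<Rightarrow> complex" where
  "cup_entry x i j = (if x = X then C i j else if i = j then 1 else 0)"

lemma string_weight_up_arc:
  assumes "k < m" "Suc k < m"
  shows "string_weight m n L (up_arc x k) = cap_entry x (L (Up k)) (L (Up (Suc k)))"
  by (auto simp: string_weight_def up_arc_def turn_def entry_def cap_entry_def)

lemma string_weight_lo_arc:
  assumes "Suc k < n"
  shows "string_weight m n L (lo_arc x k) = cup_entry x (L (Lo k)) (L (Lo (Suc k)))"
  using assms by (auto simp: string_weight_def lo_arc_def turn_def entry_def cup_entry_def)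

lemma label_skip_up:
  "length I1 = k \<Longrightarrow> label (I1 @ [i, j] @ I2) J (skip_up k p) = label (I1 @ I2) J p"
  by (cases p) auto

lemma label_skip_lo:
  "length J1 = k \<Longrightarrow> label I (J1 @ [i, j] @ J2) (skip_lo k p) = label I (J1 @ J2) p"
  by (cases p) auto

lemma up_arc_notin: "up_arc x k \<notin> relabel (skip_up k) D"
proof -
  have "Up k \<noteq> skip_up k p" "Up (Suc k) \<noteq> skip_up k p" for p by (cases p; simp)+
  then show ?thesis by (auto simp: up_arc_def)
qed

lemma lo_arc_notin: "lo_arc x k \<notin> relabel (skip_lo k) D"
proof -
  have "Lo k \<noteq> skip_lo k p" "Lo (Suc k) \<noteq> skip_lo k p" for p by (cases p; simp)+
  then show ?thesis by (auto simp: lo_arc_def)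
qed

lemma weight_relabel_skip_up:
  assumes D: "matching (u @ v) w' D" and len: "length I1 = length u" "length I2 = length v" "length J = length w'"
  shows "prod (string_weight (Suc (Suc (length u + length v))) (length w') (label (I1 @ [i, j] @ I2) J))
    (relabel (skip_up (length u)) D) = weight D (I1 @ I2) J"
proof -
  have "is_lo (skip_up (length u) p) = is_lo p" for p by (cases p) auto
  then show ?thesis
    unfolding weight_def using matching_points[OF D] len
    by (intro string_weight_relabel[OF _ _ inj_skip_up])
      (simp_all add: rank_mono_skip_up label_skip_up del: append_Cons append_Nil)
qed

lemma weight_relabel_skip_lo:
  assumes D: "matching w (u @ v) D" and len: "length J1 = length u" "length J2 = length v" "length I = length w"
  shows "prod (string_weight (length w) (Suc (Suc (length u + length v))) (label I (J1 @ [i, j] @ J2)))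
    (relabel (skip_lo (length u)) D) = weight D I (J1 @ J2)"
proof -
  have "is_lo (skip_lo (length u) p) = is_lo p" for p by (cases p) auto
  then show ?thesis
    unfolding weight_def using matching_points[OF D] len
    by (intro string_weight_relabel[OF _ _ inj_skip_lo])
      (simp_all add: rank_mono_skip_lo label_skip_lo del: append_Cons append_Nil)
qed

lemma weight_insert_up_arc:
  assumes D: "matching (u @ v) w' D" and len: "length I1 = length u" "length I2 = length v" "length J = length w'"
  shows "weight (insert (up_arc x (length u)) (relabel (skip_up (length u)) D)) (I1 @ [i, j] @ I2) J =
    cap_entry x i j * weight D (I1 @ I2) J"
proof -
  have "label (I1 @ [i, j] @ I2) J (Up (length u)) = i" "label (I1 @ [i, j] @ I2) J (Up (Suc (length u))) = j"
    using len(1) by (simp_all add: nth_append)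
  then show ?thesis
    using weight_relabel_skip_up[OF D len, of i j] up_arc_notin matching_finite[OF D] len
    unfolding weight_def[of "insert _ _"] by (simp add: string_weight_up_arc)
qed

lemma weight_insert_lo_arc:
  assumes D: "matching w (u @ v) D" and len: "length J1 = length u" "length J2 = length v" "length I = length w"
  shows "weight (insert (lo_arc x (length u)) (relabel (skip_lo (length u)) D)) I (J1 @ [i, j] @ J2) =
    cup_entry x i j * weight D I (J1 @ J2)"
proof -
  have "label I (J1 @ [i, j] @ J2) (Lo (length u)) = i" "label I (J1 @ [i, j] @ J2) (Lo (Suc (length u))) = j"
    using len(1) by (simp_all add: nth_append)
  then show ?thesis
    using weight_relabel_skip_lo[OF D len, of i j] lo_arc_notin matching_finite[OF D] len
    unfolding weight_def[of "insert _ _"] by (simp add: string_weight_lo_arc)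
qed

section \<open>Weights of composites\<close>

lemma turn_range: "turn m n s t \<in> {-1, 0, 1}"
  by (auto simp: turn_def)

text \<open>Here \<open>P\<close>, \<open>Q\<close>, \<open>ra\<close>, \<open>rb\<close> are the
  ranks of \<open>p\<close>, \<open>q\<close> and the two feet of the cap, and \<open>c\<close> is
  the exponent of the cap. As \<open>ra\<close> and \<open>rb\<close> are adjacent, six orders
  remain. In each of them the identity holds for exactly one value of \<open>c\<close>, and for the
  other value the chords \<open>P ra\<close> and \<open>rb Q\<close> would cross.\<close>

lemma turn_merge:
  assumes "(ra = Suc rb \<and> c = 0) \<or> (rb = Suc ra \<and> c = 1)"
    "P \<noteq> ra" "P \<noteq> rb" "Q \<noteq> ra" "Q \<noteq> rb" "P \<noteq> Q" "\<not> crossed P ra rb Q" "\<not> crossed rb Q P ra"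
  shows "of_bool (ra < P) + c + of_bool (Q < rb) - 1 = (of_bool (Q < P) :: int)"
proof -
  have P: "P < min ra rb \<or> max ra rb < P" and Q: "Q < min ra rb \<or> max ra rb < Q"
    using assms(1-5) by (auto simp: min_def max_def)
  have "P < Q \<or> Q < P" using assms(6) by auto
  with P Q consider "P < min ra rb" "Q < min ra rb" "P < Q" | "P < min ra rb" "Q < min ra rb" "Q < P"
    | "P < min ra rb" "max ra rb < Q" "P < Q" | "max ra rb < P" "Q < min ra rb" "Q < P"
    | "max ra rb < P" "max ra rb < Q" "P < Q" | "max ra rb < P" "max ra rb < Q" "Q < P"
    by linarith
  then show ?thesis
    by cases (use assms(1,7,8) in \<open>auto simp: crossed_def\<close>)
qed

lemma sum_closed:
  assumes D: "matching w (u @ [x, dual x] @ v) D" and arc: "lo_arc x (length u) \<in> D"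
    and len: "length J1 = length u" "length J2 = length v" "length I = length w"
  shows "(\<Sum>i<N. \<Sum>j<N. weight D I (J1 @ [i, j] @ J2) * cap_entry x i j) =
    d * weight (delete (skip_lo (length u)) D) I (J1 @ J2)"
proof -
  note del = delete_lo_arc[OF D arc]
  have "weight D I (J1 @ [i, j] @ J2) = cup_entry x i j * weight (delete (skip_lo (length u)) D) I (J1 @ J2)" for i j
    by (subst del(2)) (rule weight_insert_lo_arc[OF del(1) len])
  then have "(\<Sum>i<N. \<Sum>j<N. weight D I (J1 @ [i, j] @ J2) * cap_entry x i j) =
      (\<Sum>i<N. \<Sum>j<N. cup_entry x i j * cap_entry x i j) * weight (delete (skip_lo (length u)) D) I (J1 @ J2)"
    by (simp add: sum_distrib_left sum_distrib_right mult_ac)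
  \<comment> \<open>The value of the closed loop: one of the two factors is an identity matrix,
    which leaves the trace of \<open>C\<close> for \<open>X\<close> and the trace of
    \<open>B\<close> for \<open>X_star\<close>.\<close>
  also have "(\<Sum>i<N. \<Sum>j<N. cup_entry x i j * cap_entry x i j) = d"
    using trace_B trace_C
    by (cases "x = X") (simp_all add: cup_entry_def cap_entry_def if_distrib if_distribR cong: if_cong)
  finally show ?thesis .
qed

text \<open>Only three factors depend on \<open>i\<close> and \<open>j\<close>: the string from
  \<open>p\<close> to \<open>a\<close>, the arc of the cap from \<open>a\<close> to
  \<open>b\<close>, and the string from \<open>b\<close> to \<open>q\<close>. Summation multiplies
  the three matrix powers, and their exponents add up to that of the joined string from
  \<open>p\<close> to \<open>q\<close>.\<close>

lemma sum_open:
  assumes D: "D \<in> K w (u @ [x, dual x] @ v)"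
    and ab: "up_arc x (length u) = (Up a, Up b)" and pa: "(p, Lo a) \<in> D" and bq: "(Lo b, q) \<in> D"
    and nba: "(Lo b, Lo a) \<notin> D"
    and I: "I \<in> idx (length w)" and J: "J1 \<in> idx (length u)" "J2 \<in> idx (length v)"
  shows "(\<Sum>i<N. \<Sum>j<N. weight D I (J1 @ [i, j] @ J2) * cap_entry x i j) =
    weight (vconcat D (cap u x v)) I (J1 @ J2)"
proof -
  define m n where mn: "m = length w" "n = Suc (Suc (length u + length v))"
  let ?k = "length u" let ?r = "rank m n"
  note len = idx_length[OF J(1)] idx_length[OF J(2)] idx_length[OF I]
  have m: "matching w (u @ [x, dual x] @ v) D" using D by (rule K_matching)
  have nc: "noncrossing m n D" using D by (simp add: K_iff mn)
  note sur = matching_surgery[OF D ab pa bq] and arc = arc_surgery[OF D ab pa bq, folded arc_ab[OF D ab pa bq]]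
  note del = delete_lo_arc[OF sur arc] and op = open_neq[OF D ab pa bq nba]
  have abk: "a = ?k \<and> b = Suc ?k \<and> x = X \<or> a = Suc ?k \<and> b = ?k \<and> x = X_star"
    using ab by (auto simp: up_arc_def split: if_splits)
  define R where "R = D - {(p, Lo a), (Lo b, q)}"
  have finR: "finite R" using matching_finite[OF m] by (simp add: R_def)
  have D_eq: "D = insert (p, Lo a) (insert (Lo b, q) R)" using pa bq by (auto simp: R_def)
  have "R \<subseteq> D" by (auto simp: R_def)
  have notR: "(p, Lo a) \<notin> R" "(Lo b, q) \<notin> R" "(p, q) \<notin> R" "(Lo b, Lo a) \<notin> insert (p, q) R"
    using op nba matching_unique(1)[OF m pa, of q] by (auto simp: R_def)
  define D1 where "D1 = vconcat D (cap u x v)"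
  have D1: "D1 = delete (skip_lo ?k) (surgery a b D p q)"
    unfolding D1_def by (rule vconcat_cap_eq[OF D ab pa bq])
  have "surgery a b D p q = insert (Lo b, Lo a) (insert (p, q) R)"
    using nba by (simp add: surgery_def[OF D ab pa bq] R_def)
  moreover have "surgery a b D p q = insert (Lo b, Lo a) (relabel (skip_lo ?k) D1)"
    using del(2) unfolding D1[symmetric] arc_ab[OF D ab pa bq] .
  moreover have "(Lo b, Lo a) \<notin> relabel (skip_lo ?k) D1"
    using lo_arc_notin[of x ?k] unfolding arc_ab[OF D ab pa bq] .
  \<comment> \<open>Two descriptions of the surgered diagram are compared and the arc
    \<open>(Lo b, Lo a)\<close> is cancelled from both.\<close>
  ultimately have rel: "relabel (skip_lo ?k) D1 = insert (p, q) R"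
    using notR(4) by (metis insert_ident)
  \<comment> \<open>Away from \<open>a\<close> and \<open>b\<close> the labelling does not depend on
    \<open>i\<close> and \<open>j\<close>; \<open>L 0 0\<close> with dummy labels stands for it
    there.\<close>
  define L where "L i j = label I (J1 @ [i, j] @ J2)" for i j
  have L_other: "L i j s = L 0 0 s" if "s \<noteq> Lo a" "s \<noteq> Lo b" for i j s
  proof (cases s)
    case (Lo l)
    then have "l \<noteq> ?k" "l \<noteq> Suc ?k" using that abk by auto
    then show ?thesis using Lo len(1) unfolding L_def by (auto simp: nth_append nth_Cons split: nat.splits)
  qed (simp add: L_def)
  have ptsP: "p \<in> points m n" "q \<in> points m n" "Lo a \<in> points m n" "Lo b \<in> points m n"
    using matching_mem(3,4)[OF m pa] matching_mem(3,4)[OF m bq] by (simp_all add: mn)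
  have L_bound: "L 0 0 s < N" if "s \<in> points m n" "s \<noteq> Lo a" "s \<noteq> Lo b" for s
  proof (cases s)
    case (Up i)
    then show ?thesis using that idx_nth[OF I] by (simp add: L_def mn)
  next
    case (Lo l)
    then have l: "l \<noteq> ?k" "l \<noteq> Suc ?k" using that abk by auto
    then obtain l' where l': "l = skip ?k l'" using skip_surj by blast
    then have "l' < ?k + length v" using that(1) Lo by (simp add: mn)
    moreover have "L 0 0 s = (J1 @ J2) ! l'" unfolding L_def Lo l' using len(1) nth_skip[of J1 0 0 J2 l'] by simp
    moreover have "J1 @ J2 \<in> idx (?k + length v)" using J by (auto simp: idx_def)
    ultimately show ?thesis using idx_nth by simp
  qed
  define P Q where PQ: "P = L 0 0 p" "Q = L 0 0 q"
  have PQ_bound: "P < N" "Q < N" using L_bound ptsP op unfolding PQ by blast+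
  define W where "W = prod (string_weight m n (L 0 0)) R"
  have WR: "prod (string_weight m n (L i j)) R = W" for i j
    unfolding W_def
  proof (rule prod.cong[OF refl])
    fix st assume st: "st \<in> R"
    obtain s t where st': "st = (s, t)" by force
    then have "(s, t) \<in> D" "(s, t) \<noteq> (p, Lo a)" "(s, t) \<noteq> (Lo b, q)" using st by (auto simp: R_def)
    then have "s \<noteq> Lo a" "s \<noteq> Lo b" "t \<noteq> Lo a" "t \<noteq> Lo b"
      using matching_unique'[OF m _ pa] matching_unique'[OF m _ bq] by blast+
    then show "string_weight m n (L i j) st = string_weight m n (L 0 0) st"
      by (simp add: string_weight_def st' L_other[of _ i j])
  qed
  define e1 e2 ec where e: "e1 = turn m n p (Lo a)" "e2 = turn m n (Lo b) q" "ec = (of_bool (x = X_star) :: int)"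
  have weight_D: "weight D I (J1 @ [i, j] @ J2) = entry e1 (L i j (Lo a)) P * entry e2 Q (L i j (Lo b)) * W" for i j
  proof -
    have "(p, Lo a) \<noteq> (Lo b, q)" using op by auto
    then have "weight D I (J1 @ [i, j] @ J2) = string_weight m n (L i j) (p, Lo a) *
        (string_weight m n (L i j) (Lo b, q) * W)"
      unfolding weight_def using notR finR len WR[of i j]
      by (subst D_eq) (simp add: mn L_def)
    then show ?thesis using L_other[of p i j] L_other[of q i j] op by (simp add: string_weight_def e PQ)
  qed
  have L_ab: "cap_entry x i j = entry ec (L i j (Lo b)) (L i j (Lo a))" for i j
    using abk len(1) by (auto simp: L_def cap_entry_def entry_def e nth_append)
  \<comment> \<open>Which of \<open>i\<close> and \<open>j\<close> labels \<open>a\<close> depends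
    on the letter \<open>x\<close>; the sum is rewritten once and for all with labels named after
    \<open>a\<close> and \<open>b\<close>.\<close>
  have sum_ab: "(\<Sum>i<N. \<Sum>j<N. g (L i j (Lo a)) (L i j (Lo b))) = (\<Sum>\<beta><N. \<Sum>\<alpha><N. g \<alpha> \<beta>)" for g :: "nat \<Rightarrow> nat \<Rightarrow> complex"
    using abk len(1) sum.swap[of g "{..<N}" "{..<N}"] by (auto simp: L_def nth_append)
  have ranks: "?r p \<noteq> ?r (Lo a)" "?r p \<noteq> ?r (Lo b)" "?r q \<noteq> ?r (Lo a)" "?r q \<noteq> ?r (Lo b)" "?r p \<noteq> ?r q"
    using rank_inj ptsP op by blast+
  have adj: "(?r (Lo a) = Suc (?r (Lo b)) \<and> ec = 0) \<or> (?r (Lo b) = Suc (?r (Lo a)) \<and> ec = 1)"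
    using abk by (auto simp: mn e)
  have total: "e2 + (ec + e1) = turn m n p q"
    using turn_merge[OF adj ranks noncrossingD[OF nc pa bq] noncrossingD[OF nc bq pa]]
    by (simp add: e(1,2) turn_def del: rank.simps)
  \<comment> \<open>The intermediate exponent must stay in the range of \<open>entry_mult\<close>. A
    string that ends at the bottom never has exponent 1, since a lower point outranks every upper
    one; hence adding the exponent 0 or 1 of the cap is safe.\<close>
  have "e1 \<in> {-1, 0}"
  proof (cases p)
    case (Up i)
    then have "?r p < ?r (Lo a)" using ptsP(1) by simp
    then show ?thesis using Up by (simp add: e turn_def)
  qed (auto simp: e turn_def)
  moreover have "ec \<in> {0, 1}" by (cases x) (simp_all add: e(3))
  ultimately have "e1 \<in> {-1, 0, 1}" "ec \<in> {-1, 0, 1}" "ec + e1 \<in> {-1, 0, 1}" by auto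
  moreover have "e2 \<in> {-1, 0, 1}" unfolding e(2) by (rule turn_range)
  moreover have "e2 + (ec + e1) \<in> {-1, 0, 1}" unfolding total by (rule turn_range)
  ultimately have range: "e1 \<in> {-1, 0, 1}" "e2 \<in> {-1, 0, 1}" "ec \<in> {-1, 0, 1}" "ec + e1 \<in> {-1, 0, 1}"
    "e2 + (ec + e1) \<in> {-1, 0, 1}" by blast+
  have "(\<Sum>i<N. \<Sum>j<N. weight D I (J1 @ [i, j] @ J2) * cap_entry x i j) =
      (\<Sum>\<beta><N. \<Sum>\<alpha><N. entry e1 \<alpha> P * entry e2 Q \<beta> * W * entry ec \<beta> \<alpha>)"
    unfolding weight_D L_ab by (rule sum_ab)
  also have "\<dots> = (\<Sum>\<beta><N. entry e2 Q \<beta> * (\<Sum>\<alpha><N. entry ec \<beta> \<alpha> * entry e1 \<alpha> P)) * W"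
    by (simp add: sum_distrib_left sum_distrib_right mult_ac)
  also have "\<dots> = (\<Sum>\<beta><N. entry e2 Q \<beta> * entry (ec + e1) \<beta> P) * W"
    using entry_mult[of _ P ec e1] PQ_bound range by simp
  also have "\<dots> = entry (turn m n p q) Q P * W"
    using entry_mult[of Q P e2 "ec + e1"] PQ_bound range unfolding total by simp
  also have "\<dots> = prod (string_weight m n (L 0 0)) (insert (p, q) R)"
    using notR(3) finR by (simp add: W_def string_weight_def PQ)
  also have "\<dots> = weight D1 I (J1 @ J2)"
    using weight_relabel_skip_lo[OF del(1) len, of 0 0] unfolding D1[symmetric] rel by (simp add: L_def mn)
  finally show ?thesis by (simp add: D1_def)
qed

lemma sum_cap:
  assumes D: "D \<in> K w (u @ [x, dual x] @ v)"
    and I: "I \<in> idx (length w)" and J: "J1 \<in> idx (length u)" "J2 \<in> idx (length v)"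
  shows "(\<Sum>i<N. \<Sum>j<N. weight D I (J1 @ [i, j] @ J2) * cap_entry x i j) =
    d ^ loops D (cap u x v) * weight (vconcat D (cap u x v)) I (J1 @ J2)"
proof -
  have m: "matching w (u @ [x, dual x] @ v) D" using D by (rule K_matching)
  obtain a b where ab: "up_arc x (length u) = (Up a, Up b)" unfolding up_arc_def by (cases "x = X") auto
  then have "Lo a \<in> ends w (u @ [x, dual x] @ v)" "Lo b \<in> starts w (u @ [x, dual x] @ v)"
    by (auto simp: up_arc_def nth_append split: if_splits)
  then obtain p q where pq: "(p, Lo a) \<in> D" "(Lo b, q) \<in> D"
    using matching_in[OF m] matching_out[OF m] by blast
  note len = idx_length[OF J(1)] idx_length[OF J(2)] idx_length[OF I]
  show ?thesis
  proof (cases "(Lo b, Lo a) \<in> D")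
    case True
    then have "vconcat D (cap u x v) = delete (skip_lo (length u)) D"
      using vconcat_cap_eq[OF D ab pq] by (simp add: surgery_def[OF D ab pq])
    then show ?thesis
      using sum_closed[OF m _ len] True loops_closed[OF D ab pq True] arc_ab[OF D ab pq] by simp
  next
    case False
    then show ?thesis
      using sum_open[OF D ab pq False I J] loops_open[OF D ab pq False] by simp
  qed
qed

lemma K_vconcat_cap: "D \<in> K w (u @ [x, dual x] @ v) \<Longrightarrow> vconcat D (cap u x v) \<in> K w (u @ v)"
proof -
  assume D: "D \<in> K w (u @ [x, dual x] @ v)"
  have m: "matching w (u @ [x, dual x] @ v) D" using D by (rule K_matching)
  obtain a b where ab: "up_arc x (length u) = (Up a, Up b)" unfolding up_arc_def by (cases "x = X") auto
  then have "Lo a \<in> ends w (u @ [x, dual x] @ v)" "Lo b \<in> starts w (u @ [x, dual x] @ v)"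
    by (auto simp: up_arc_def nth_append split: if_splits)
  then obtain p q where pq: "(p, Lo a) \<in> D" "(Lo b, q) \<in> D"
    using matching_in[OF m] matching_out[OF m] by blast
  show ?thesis by (rule vconcat_cap_in_K[OF D ab pq])
qed

lemma sum_idx_insert:
  fixes g :: "nat list \<Rightarrow> complex"
  shows "(\<Sum>M\<in>idx (k + 2 + l). g M) = (\<Sum>M\<in>idx (k + l). \<Sum>i<N. \<Sum>j<N. g (take k M @ [i, j] @ drop k M))"
proof -
  have "(\<Sum>M\<in>idx (k + l). \<Sum>i<N. \<Sum>j<N. g (take k M @ [i, j] @ drop k M)) =
      (\<Sum>(M, i, j)\<in>idx (k + l) \<times> {..<N} \<times> {..<N}. g (take k M @ [i, j] @ drop k M))"
    by (simp add: sum.cartesian_product)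
  also have "\<dots> = (\<Sum>M\<in>idx (k + 2 + l). g M)"
  proof (rule sum.reindex_bij_witness[where j = "\<lambda>(M, i, j). take k M @ [i, j] @ drop k M"
        and i = "\<lambda>M. (take k M @ drop (k + 2) M, M ! k, M ! Suc k)"])
    fix a assume a: "a \<in> idx (k + l) \<times> {..<N} \<times> {..<N}"
    obtain M i j where eq: "a = (M, i, j)" by (cases a) auto
    then have M: "M \<in> idx (k + l)" "i < N" "j < N" and len: "length (take k M) = k"
      using a by (auto simp: idx_def)
    define A B where AB: "A = take k M" "B = drop k M"
    have M_eq: "M = A @ B" "length A = k" using len by (simp_all add: AB)
    show "(\<lambda>M. (take k M @ drop (k + 2) M, M ! k, M ! Suc k)) (case a of (M, i, j) \<Rightarrow> take k M @ [i, j] @ drop k M) = a"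
      unfolding eq by (simp add: M_eq nth_append)
    show "(case a of (M, i, j) \<Rightarrow> take k M @ [i, j] @ drop k M) \<in> idx (k + 2 + l)"
      using M unfolding eq by (simp add: M_eq idx_def)
    show "g (case a of (M, i, j) \<Rightarrow> take k M @ [i, j] @ drop k M) = (case a of (M, i, j) \<Rightarrow> g (take k M @ [i, j] @ drop k M))"
      by (simp add: eq)
  next
    fix M assume M: "M \<in> idx (k + 2 + l)"
    then have len: "length M = k + 2 + l" by (simp add: idx_def)
    have M_eq: "M = take k M @ [M ! k, M ! Suc k] @ drop (k + 2) M"
      using len by (metis Cons_nth_drop_Suc Suc_eq_plus1 add_2_eq_Suc' append_Cons append_Nil append_take_drop_id
          less_add_Suc1 add_Suc_right plus_1_eq_Suc add.commute add_Suc)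
    show "(case (take k M @ drop (k + 2) M, M ! k, M ! Suc k) of (M, i, j) \<Rightarrow> take k M @ [i, j] @ drop k M) = M"
      using M_eq len by simp
    have "set M \<subseteq> {..<N}" using M by (simp add: idx_def)
    then show "(take k M @ drop (k + 2) M, M ! k, M ! Suc k) \<in> idx (k + l) \<times> {..<N} \<times> {..<N}"
      using len set_take_subset[of k M] set_drop_subset[of "k + 2" M] idx_nth[OF M, of k] idx_nth[OF M, of "Suc k"]
      by (auto simp: idx_def)
  qed
  finally show ?thesis by simp
qed

text \<open>Functoriality on basis diagrams. A cap on top of \<open>D'\<close> is moved to the upper
  factor, where \<open>sum_cap\<close> evaluates it; a cup at the bottom of \<open>D'\<close> only
  contributes a factor. The powers of \<open>d\<close> fit together by
  \<open>loops_assoc\<close>.\<close>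

lemma weight_vconcat:
  assumes "D \<in> K w w'" "D' \<in> K w' w''" "I \<in> idx (length w)" "J \<in> idx (length w'')"
  shows "(\<Sum>M\<in>idx (length w'). weight D I M * weight D' M J) = d ^ loops D D' * weight (vconcat D D') I J"
  using assms
\<comment> \<open>Removing a cap shortens the middle word and removing a cup shortens the last one.
  The upper factor may grow arbitrarily complicated and does not enter the measure.\<close>
proof (induction "length w' + length w''" arbitrary: D D' w' w'' J rule: less_induct)
  case less
  note D = less.prems(1) and D' = less.prems(2) and I = less.prems(3) and J = less.prems(4)
  note m = K_matching[OF D] and m' = K_matching[OF D']
  from D' show ?case
  proof (cases rule: K_cases)
    case id
    have "(\<Sum>M\<in>idx (length w'). weight D I M * weight D' M J) =
        (\<Sum>M\<in>idx (length w'). if M = J then weight D I M else 0)"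
      by (rule sum.cong) (use id J in \<open>auto simp: weight_id idx_length\<close>)
    also have "\<dots> = weight D I J" using J id by simp
    finally show ?thesis using id vconcat_id[OF m] loops_id[OF m] by simp
  next
    case (cap u x v D1)
    note m1 = K_matching[OF cap(2)]
    define k l where kl: "k = length u" "l = length v"
    have split: "take k M \<in> idx (length u)" "drop k M \<in> idx (length v)" if "M \<in> idx (k + l)" for M
      using that set_take_subset[of k M] set_drop_subset[of k M] by (auto simp: idx_def kl)
    have lJ: "length J = length w''" using J by (simp add: idx_length)
    have Dcap: "vconcat D (cap u x v) \<in> K w (u @ v)" using D unfolding cap(1) by (rule K_vconcat_cap)
    have "(\<Sum>M\<in>idx (length w'). weight D I M * weight D' M J) =
        (\<Sum>M\<in>idx (k + 2 + l). weight D I M * weight D' M J)"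
      by (simp add: cap(1) kl)
    also have "\<dots> = (\<Sum>M\<in>idx (k + l). \<Sum>i<N. \<Sum>j<N. weight D I (take k M @ [i, j] @ drop k M) *
        weight D' (take k M @ [i, j] @ drop k M) J)"
      by (rule sum_idx_insert)
    also have "\<dots> = (\<Sum>M\<in>idx (k + l). (\<Sum>i<N. \<Sum>j<N. weight D I (take k M @ [i, j] @ drop k M) * cap_entry x i j) *
        weight D1 M J)"
    proof (rule sum.cong[OF refl])
      fix M assume M: "M \<in> idx (k + l)"
      have "weight D' (take k M @ [i, j] @ drop k M) J = cap_entry x i j * weight D1 M J" for i j
        using weight_insert_up_arc[OF m1 idx_length[OF split(1)[OF M]] idx_length[OF split(2)[OF M]] lJ, of x i j]
        unfolding cap(4) by simp
      then show "(\<Sum>i<N. \<Sum>j<N. weight D I (take k M @ [i, j] @ drop k M) *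
          weight D' (take k M @ [i, j] @ drop k M) J) =
        (\<Sum>i<N. \<Sum>j<N. weight D I (take k M @ [i, j] @ drop k M) * cap_entry x i j) * weight D1 M J"
        by (simp only: sum_distrib_right mult.assoc)
    qed
    also have "\<dots> = (\<Sum>M\<in>idx (k + l). d ^ loops D (cap u x v) * weight (vconcat D (cap u x v)) I M * weight D1 M J)"
      by (rule sum.cong[OF refl]) (use sum_cap[OF D[unfolded cap(1)] I split] in simp)
    also have "\<dots> = d ^ loops D (cap u x v) *
        (\<Sum>M\<in>idx (length (u @ v)). weight (vconcat D (cap u x v)) I M * weight D1 M J)"
      by (simp add: sum_distrib_left mult.assoc kl)
    also have "(\<Sum>M\<in>idx (length (u @ v)). weight (vconcat D (cap u x v)) I M * weight D1 M J) =
        d ^ loops (vconcat D (cap u x v)) D1 * weight (vconcat (vconcat D (cap u x v)) D1) I J"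
      by (rule less.hyps[OF _ Dcap cap(2) I J]) (simp add: cap(1))
    finally show ?thesis
      using vconcat_assoc[OF m[unfolded cap(1)] K_matching[OF K_cap] m1]
        loops_assoc[OF m[unfolded cap(1)] K_matching[OF K_cap] m1] loops_cap[OF m1]
      unfolding cap(3) by (simp flip: power_add mult.assoc)
  next
    case (cup u x v D1)
    note m1 = K_matching[OF cup(2)]
    define k where "k = length u"
    define J1 i j J2 where J12: "J1 = take k J" "i = J ! k" "j = J ! Suc k" "J2 = drop (k + 2) J"
    have lJ: "length J = k + 2 + length v" using J by (simp add: idx_length cup(1) k_def)
    have J_eq: "J = J1 @ [i, j] @ J2"
      using lJ unfolding J12 by (metis Cons_nth_drop_Suc Suc_eq_plus1 add_2_eq_Suc' append_Cons append_Nil append_take_drop_id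
          less_add_Suc1 add_Suc_right plus_1_eq_Suc add.commute add_Suc)
    have len: "length J1 = length u" "length J2 = length v" using lJ by (simp_all add: J12 k_def)
    have J': "J1 @ J2 \<in> idx (length (u @ v))"
      using J len unfolding J_eq by (auto simp: idx_def)
    note m2 = matching_vconcat[OF m m1]
    have "(\<Sum>M\<in>idx (length w'). weight D I M * weight D' M J) =
        (\<Sum>M\<in>idx (length w'). weight D I M * (cup_entry x i j * weight D1 M (J1 @ J2)))"
      by (rule sum.cong[OF refl])
        (simp only: cup(4) J_eq weight_insert_lo_arc[OF m1 len idx_length])
    also have "\<dots> = cup_entry x i j * (\<Sum>M\<in>idx (length w'). weight D I M * weight D1 M (J1 @ J2))"
      by (simp add: sum_distrib_left mult_ac)
    also have "(\<Sum>M\<in>idx (length w'). weight D I M * weight D1 M (J1 @ J2)) =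
        d ^ loops D D1 * weight (vconcat D D1) I (J1 @ J2)"
      by (rule less.hyps[OF _ D cup(2) I J']) (simp add: cup(1))
    also have "cup_entry x i j * (d ^ loops D D1 * weight (vconcat D D1) I (J1 @ J2)) =
        d ^ loops D D1 * weight (vconcat (vconcat D D1) (cup u x v)) I J"
      unfolding vconcat_cup[OF m2 insert_lo_arc[OF m2]] J_eq
      by (simp only: weight_insert_lo_arc[OF m2 len idx_length[OF I]] mult_ac)
    finally show ?thesis
      using vconcat_assoc[OF m m1 K_matching[OF K_cup]] loops_assoc[OF m m1 K_matching[OF K_cup]]
        loops_cup[OF m2] loops_cup[OF m1]
      unfolding cup(3) by simp
  qed
qed

end

subsection \<open>Linear maps and tensor products of subspaces\<close>

context vect_universe
begin

lemma linear_between_mem: "linear_between U V f \<Longrightarrow> x \<in> U \<Longrightarrow> f x \<in> V"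
  by (auto simp: linear_between_def)

lemma linear_between_add: "linear_between U V f \<Longrightarrow> x \<in> U \<Longrightarrow> y \<in> U \<Longrightarrow> f (x + y) = f x + f y"
  by (auto simp: linear_between_def)

lemma linear_between_scale: "linear_between U V f \<Longrightarrow> x \<in> U \<Longrightarrow> f (c *s x) = c *s f x"
  by (auto simp: linear_between_def)

lemma linear_between_0: "linear_between U V f \<Longrightarrow> subspace U \<Longrightarrow> f 0 = 0"
  using linear_between_scale[of U V f 0 0] subspace_0[of U] by simp

lemma linear_between_sum:
  assumes f: "linear_between U V f" and U: "subspace U" and "finite A" "\<And>i. i \<in> A \<Longrightarrow> g i \<in> U"
  shows "f (\<Sum>i\<in>A. g i) = (\<Sum>i\<in>A. f (g i))"
  using assms(3,4)
proof (induction A rule: finite_induct)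
  case empty
  then show ?case using linear_between_0[OF f U] by simp
next
  case (insert a A)
  then have "(\<Sum>i\<in>A. g i) \<in> U" by (intro subspace_sum[OF U]) auto
  then show ?case using insert linear_between_add[OF f] by simp
qed

lemma linear_between_lincomb:
  assumes f: "linear_between U V f" and U: "subspace U" and "finite A" "\<And>i. i \<in> A \<Longrightarrow> g i \<in> U"
  shows "f (\<Sum>i\<in>A. c i *s g i) = (\<Sum>i\<in>A. c i *s f (g i))"
proof -
  have "f (\<Sum>i\<in>A. c i *s g i) = (\<Sum>i\<in>A. f (c i *s g i))"
    by (rule linear_between_sum[OF f U assms(3)]) (use assms(4) subspace_scale[OF U] in auto)
  also have "\<dots> = (\<Sum>i\<in>A. c i *s f (g i))"
    by (rule sum.cong) (use assms(4) linear_between_scale[OF f] in auto)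
  finally show ?thesis .
qed

lemma linear_between_comp:
  "linear_between U V f \<Longrightarrow> linear_between V Z g \<Longrightarrow> linear_between U Z (\<lambda>x. g (f x))"
  by (auto simp: linear_between_def Pi_iff)

lemma fin_dim_subspace: "fin_dim U \<Longrightarrow> subspace U"
  by (simp add: fin_dim_def)

lemma basis_ofI:
  assumes V: "subspace V" and mem: "\<And>i. i < n \<Longrightarrow> v i \<in> V"
    and ind: "\<And>c i. (\<Sum>i<n. c i *s v i) = 0 \<Longrightarrow> i < n \<Longrightarrow> c i = 0"
    and span: "\<And>x. x \<in> V \<Longrightarrow> \<exists>c. x = (\<Sum>i<n. c i *s v i)"
  shows "basis_of V n v"
proof -
  have inj: "inj_on v {..<n}"
  proof (rule inj_onI, rule ccontr)
    fix i j assume ij: "i \<in> {..<n}" "j \<in> {..<n}" "v i = v j" "i \<noteq> j"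
    define c where "c k = (if k = i then 1 else if k = j then -1 else (0::complex))" for k
    have "(\<Sum>k<n. c k *s v k) = (\<Sum>k\<in>{i, j}. c k *s v k)"
      by (rule sum.mono_neutral_right) (use ij in \<open>auto simp: c_def\<close>)
    also have "\<dots> = 0" using ij by (simp add: c_def)
    finally show False using ind[of c i] ij by (simp add: c_def)
  qed
  have "independent (v ` {..<n})"
    unfolding dependent_finite[OF finite_imageI[OF finite_lessThan]]
  proof (rule notI, elim exE conjE bexE)
    fix u x assume u: "x \<in> v ` {..<n}" "u x \<noteq> 0" "(\<Sum>x\<in>v ` {..<n}. u x *s x) = 0"
    then have "(\<Sum>i<n. u (v i) *s v i) = 0" by (simp add: sum.reindex[OF inj])
    then show False using ind[of "\<lambda>i. u (v i)"] u by auto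
  qed
  moreover have "span (v ` {..<n}) = V"
  proof
    show "span (v ` {..<n}) \<subseteq> V" by (rule span_minimal) (use mem V in auto)
    show "V \<subseteq> span (v ` {..<n})"
    proof
      fix x assume "x \<in> V"
      then obtain c where x: "x = (\<Sum>i<n. c i *s v i)" using span by blast
      show "x \<in> span (v ` {..<n})"
        unfolding x by (intro span_sum span_scale span_base imageI)
    qed
  qed
  ultimately show ?thesis using inj by (simp add: basis_of_def)
qed

lemma basis_of_mem: "basis_of V n v \<Longrightarrow> i < n \<Longrightarrow> v i \<in> V"
  using span_base[of "v i" "v ` {..<n}"] by (simp add: basis_of_def)

lemma basis_of_expand:
  assumes "basis_of V n v" "x \<in> V"
  shows "\<exists>c. x = (\<Sum>i<n. c i *s v i)"
proof -
  have "x \<in> range (\<lambda>u. \<Sum>y\<in>v ` {..<n}. u y *s y)"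
    using assms span_finite[of "v ` {..<n}"] by (simp add: basis_of_def)
  then obtain u where "x = (\<Sum>y\<in>v ` {..<n}. u y *s y)" by blast
  also have "\<dots> = (\<Sum>i<n. u (v i) *s v i)" using assms(1) by (simp add: basis_of_def sum.reindex)
  finally show ?thesis by (rule exI[of _ "\<lambda>i. u (v i)"])
qed

lemma basis_of_independent:
  assumes "basis_of V n v" "(\<Sum>i<n. c i *s v i) = 0" "i < n"
  shows "c i = 0"
proof -
  have inj: "inj_on v {..<n}" and ind: "independent (v ` {..<n})" using assms(1) by (simp_all add: basis_of_def)
  define u where "u x = c (the_inv_into {..<n} v x)" for x
  have u: "u (v j) = c j" if "j < n" for j using that by (simp add: u_def the_inv_into_f_f[OF inj])
  have "(\<Sum>x\<in>v ` {..<n}. u x *s x) = (\<Sum>j<n. u (v j) *s v j)" by (simp add: sum.reindex[OF inj])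
  also have "\<dots> = 0" using u assms(2) by simp
  finally have "u (v i) = 0" using independentD[OF ind, of "v ` {..<n}" u "v i"] assms(3) by simp
  then show ?thesis using u assms(3) by simp
qed

lemma basis_of_unique:
  assumes "basis_of V n v" "(\<Sum>i<n. c i *s v i) = (\<Sum>i<n. c' i *s v i)" "i < n"
  shows "c i = c' i"
  using basis_of_independent[OF assms(1), of "\<lambda>i. c i - c' i"] assms(2,3)
  by (simp add: scale_left_diff_distrib sum_subtractf)

lemma basis_of_card:
  assumes "basis_of V n v" "basis_of V n' v'"
  shows "n = n'"
proof -
  have "dim V = card (v ` {..<n})" "dim V = card (v' ` {..<n'})"
    using assms dim_span_eq_card_independent unfolding basis_of_def by metis+
  then show ?thesis using assms by (simp add: basis_of_def card_image)
qed

lemma basis_of_exists: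
  assumes "fin_dim V"
  shows "\<exists>n v. basis_of V n v"
proof -
  obtain S where S: "finite S" "span S = V" using assms by (auto simp: fin_dim_def)
  obtain T where T: "T \<subseteq> S" "independent T" "S \<subseteq> span T" using maximal_independent_subset by metis
  have "finite T" using T S finite_subset by blast
  then obtain v where v: "bij_betw v {..<card T} T"
    using ex_bij_betw_nat_finite[of T] by (auto simp: atLeast0LessThan)
  have "span T = V" using T S by (metis span_mono span_span subset_antisym)
  then have "basis_of V (card T) v" using v T by (auto simp: basis_of_def bij_betw_def)
  then show ?thesis by blast
qed

lemma tensor_bilinear: "is_tensor_product U V T t \<Longrightarrow> bilinear_between U V T t"
  by (simp add: is_tensor_product_def)

lemma bilinear_betweenD:
  assumes "bilinear_between U V Z b"
  shows "x \<in> U \<Longrightarrow> linear_between V Z (b x)" "y \<in> V \<Longrightarrow> linear_between U Z (\<lambda>x. b x y)"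
  using assms by (auto simp: bilinear_between_def)

lemma bilinear_mem: "bilinear_between U V Z b \<Longrightarrow> x \<in> U \<Longrightarrow> y \<in> V \<Longrightarrow> b x y \<in> Z"
  using bilinear_betweenD(1) linear_between_mem by metis

lemma bilinear_comp:
  assumes "bilinear_between U V T t" "linear_between T Z f"
  shows "bilinear_between U V Z (\<lambda>x y. f (t x y))"
  using assms linear_between_comp unfolding bilinear_between_def by blast

lemma tensor_lift:
  assumes "is_tensor_product U V T t" "subspace Z" "bilinear_between U V Z b"
  obtains L where "linear_between T Z L" "\<And>x y. x \<in> U \<Longrightarrow> y \<in> V \<Longrightarrow> L (t x y) = b x y"
  using assms unfolding is_tensor_product_def by blast

lemma tensor_ext:
  assumes t: "is_tensor_product U V T t" and Z: "subspace Z"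
    and L: "linear_between T Z L" and L': "linear_between T Z L'"
    and eq: "\<And>x y. x \<in> U \<Longrightarrow> y \<in> V \<Longrightarrow> L (t x y) = L' (t x y)" and z: "z \<in> T"
  shows "L z = L' z"
proof -
  have bil: "bilinear_between U V Z (\<lambda>x y. L (t x y))"
    by (rule bilinear_comp[OF tensor_bilinear[OF t] L])
  from t[unfolded is_tensor_product_def, THEN conjunct2, rule_format, OF Z bil]
  obtain M where M: "\<forall>L'. linear_between T Z L' \<longrightarrow>
      (\<forall>x\<in>U. \<forall>y\<in>V. L' (t x y) = L (t x y)) \<longrightarrow> (\<forall>z\<in>T. L' z = M z)"
    by blast
  have "L z = M z" using M[THEN spec[of _ L]] L z by simp
  moreover have "L' z = M z" using M[THEN spec[of _ L']] L' eq z by simp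
  ultimately show ?thesis by simp
qed

lemma bilinear_shrink:
  assumes "bilinear_between U V T t" "\<And>x y. x \<in> U \<Longrightarrow> y \<in> V \<Longrightarrow> t x y \<in> Z"
  shows "bilinear_between U V Z t"
  using assms unfolding bilinear_between_def linear_between_def by auto

text \<open>Factoring the tensor map through the span of the pure tensors and comparing with the identity
  shows that there are no further elements.\<close>

lemma tensor_span:
  assumes t: "is_tensor_product U V T t" and T: "subspace T" and z: "z \<in> T"
  shows "z \<in> span {t x y |x y. x \<in> U \<and> y \<in> V}"
proof -
  let ?Z = "span {t x y |x y. x \<in> U \<and> y \<in> V}"
  have ZT: "?Z \<subseteq> T"
    by (rule span_minimal) (use T bilinear_mem[OF tensor_bilinear[OF t]] in auto)
  have "bilinear_between U V ?Z t"
    by (rule bilinear_shrink[OF tensor_bilinear[OF t]]) (auto intro: span_base)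
  then obtain L where L: "linear_between T ?Z L" "\<And>x y. x \<in> U \<Longrightarrow> y \<in> V \<Longrightarrow> L (t x y) = t x y"
    using tensor_lift[OF t subspace_span] by blast
  have "linear_between T T L" using L(1) ZT by (auto simp: linear_between_def)
  moreover have "linear_between T T (\<lambda>x. x)" by (auto simp: linear_between_def)
  ultimately have "L z = z" using tensor_ext[OF t T, of L "\<lambda>x. x"] L(2) z by simp
  then show ?thesis using linear_between_mem[OF L(1) z] by simp
qed

text \<open>Only the first factors are expanded over a basis; by bilinearity the second factors are
  collected into one vector for each basis element. These vectors are the unknowns that the snake
  identities determine later.\<close>

lemma tensor_expand:
  assumes t: "is_tensor_product U V T t" and sub: "subspace U" "subspace V" "subspace T"
    and u: "basis_of U n u" and z: "z \<in> T"
  shows "\<exists>\<xi>. (\<forall>j<n. \<xi> j \<in> V) \<and> z = (\<Sum>j<n. t (u j) (\<xi> j))"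
  using tensor_span[OF t sub(3) z]
proof (induction rule: span_induct_alt)
  case base
  have "t (u j) 0 = 0" if "j < n" for j
    using bilinear_betweenD(1)[OF tensor_bilinear[OF t] basis_of_mem[OF u that]] linear_between_0 sub(2) by blast
  then show ?case using subspace_0[OF sub(2)] by (intro exI[of _ "\<lambda>_. 0"]) simp
next
  case (step c p y)
  note lin = bilinear_betweenD[OF tensor_bilinear[OF t]]
  obtain x' y' where xy: "p = t x' y'" "x' \<in> U" "y' \<in> V" using step.hyps by blast
  obtain e where e: "x' = (\<Sum>j<n. e j *s u j)" using basis_of_expand[OF u xy(2)] by blast
  obtain \<xi> where \<xi>: "\<forall>j<n. \<xi> j \<in> V" "y = (\<Sum>j<n. t (u j) (\<xi> j))" using step.IH by blast
  have "p = (\<Sum>j<n. e j *s t (u j) y')"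
    unfolding xy(1) e
    by (rule linear_between_lincomb[OF lin(2)[OF xy(3)] sub(1)]) (use basis_of_mem[OF u] in auto)
  then have "c *s p + y = (\<Sum>j<n. c *s (e j *s t (u j) y') + t (u j) (\<xi> j))"
    using \<xi>(2) by (simp add: scale_sum_right sum.distrib)
  also have "\<dots> = (\<Sum>j<n. t (u j) ((c * e j) *s y' + \<xi> j))"
  proof (rule sum.cong[OF refl])
    fix j assume "j \<in> {..<n}"
    then have l: "linear_between V T (t (u j))" "\<xi> j \<in> V" using lin(1) basis_of_mem[OF u] \<xi>(1) by auto
    then show "c *s (e j *s t (u j) y') + t (u j) (\<xi> j) = t (u j) ((c * e j) *s y' + \<xi> j)"
      using linear_between_add[OF l(1) subspace_scale[OF sub(2) xy(3)] l(2)] linear_between_scale[OF l(1) xy(3)]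
      by simp
  qed
  finally show ?case
    using \<xi>(1) xy(3) sub(2) by (intro exI[of _ "\<lambda>j. (c * e j) *s y' + \<xi> j"]) (simp add: subspace_add subspace_scale)
qed

end

subsection \<open>Zigzag identities in the diagram category\<close>

lemma loops_0_increasing:
  fixes f :: "glued_point \<Rightarrow> nat"
  assumes "\<And>x y. (x, y) \<in> glue D D' \<Longrightarrow> f x < f y"
  shows "loops D D' = 0"
proof -
  have "f x < f y" if "(x, y) \<in> (glue D D')\<^sup>+" for x y
    using that by (induction rule: trancl_induct) (auto dest: assms)
  then have "cycles (glue D D') = {}" unfolding cycles_def by fastforce
  then show ?thesis by (simp add: loops_eq_cycles)
qed

lemma dual_dual [simp]: "dual (dual x) = x"
  by (cases x) auto

text \<open>The halves of the two S-shaped diagrams on one string. The letters of the arcs are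
  chosen such that all halves meet in the middle word \<open>[x, dual x, x]\<close>; left and right
  tell where the arc sits.\<close>

definition cup_right :: "letter \<Rightarrow> diagram" where
  "cup_right x = hconcat 1 1 (id_diagram [x]) {lo_arc (dual x) 0}"

definition cap_left :: "letter \<Rightarrow> diagram" where
  "cap_left x = hconcat 2 0 {up_arc x 0} (id_diagram [x])"

definition cup_left :: "letter \<Rightarrow> diagram" where
  "cup_left x = hconcat 0 2 {lo_arc x 0} (id_diagram [x])"

definition cap_right :: "letter \<Rightarrow> diagram" where
  "cap_right x = hconcat 1 1 (id_diagram [x]) {up_arc (dual x) 0}"

lemma K_zigzag:
  "cup_right x \<in> K [x] [x, dual x, x]" "cap_left x \<in> K [x, dual x, x] [x]"
  "cup_left x \<in> K [x] [x, dual x, x]" "cap_right x \<in> K [x, dual x, x] [x]"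
  using K_hconcat[OF K_id[of "[x]"] K_lo_arc[of "dual x"]] K_hconcat[OF K_up_arc[of x] K_id[of "[x]"]]
    K_hconcat[OF K_lo_arc[of x] K_id[of "[x]"]] K_hconcat[OF K_id[of "[x]"] K_up_arc[of "dual x"]]
  by (simp_all add: cup_right_def cap_left_def cup_left_def cap_right_def numeral_2_eq_2)

lemma id_diagram_single: "id_diagram [x] = {if x = X then (Up 0, Lo 0) else (Lo 0, Up 0)}"
  by (cases x) (auto simp: id_diagram_def)

lemma trancl4: "(a, b) \<in> G \<Longrightarrow> (b, c) \<in> G \<Longrightarrow> (c, e) \<in> G \<Longrightarrow> (e, f) \<in> G \<Longrightarrow> (a, f) \<in> G\<^sup>+"
  by (meson r_into_trancl' trancl_into_trancl)

text \<open>Potentials that increase along the snake in its four variants (arc side and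
  orientation), which rules out cycles.\<close>

fun height1 :: "glued_point \<Rightarrow> nat" where
  "height1 (Top i) = 0" | "height1 (Mid i) = Suc i" | "height1 (Bot i) = 4"

fun height2 :: "glued_point \<Rightarrow> nat" where
  "height2 (Top i) = 4" | "height2 (Mid i) = Suc i" | "height2 (Bot i) = 0"

fun height3 :: "glued_point \<Rightarrow> nat" where
  "height3 (Top i) = 0" | "height3 (Mid i) = 3 - i" | "height3 (Bot i) = 4"

fun height4 :: "glued_point \<Rightarrow> nat" where
  "height4 (Top i) = 4" | "height4 (Mid i) = 3 - i" | "height4 (Bot i) = 0"

lemma glue_right_left: "glue (cup_right x) (cap_left x) = (if x = X
    then {(Top 0, Mid 0), (Mid 0, Mid 1), (Mid 1, Mid 2), (Mid 2, Bot 0)}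
    else {(Bot 0, Mid 2), (Mid 2, Mid 1), (Mid 1, Mid 0), (Mid 0, Top 0)})"
  by (cases x) (auto simp: glue_def cup_right_def cap_left_def hconcat_def id_diagram_single lo_arc_def up_arc_def)

lemma glue_left_right: "glue (cup_left x) (cap_right x) = (if x = X
    then {(Top 0, Mid 2), (Mid 2, Mid 1), (Mid 1, Mid 0), (Mid 0, Bot 0)}
    else {(Bot 0, Mid 0), (Mid 0, Mid 1), (Mid 1, Mid 2), (Mid 2, Top 0)})"
  by (cases x) (auto simp: glue_def cup_left_def cap_right_def hconcat_def id_diagram_single lo_arc_def up_arc_def)

lemma zigzag_left:
  "vconcat (cup_right x) (cap_left x) = id_diagram [x]" "loops (cup_right x) (cap_left x) = 0"
proof -
  show "vconcat (cup_right x) (cap_left x) = id_diagram [x]"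
  proof (rule vconcat_eqI[OF K_matching[OF K_zigzag(1)] K_matching[OF K_zigzag(2)] matching_id])
    fix s t assume "(s, t) \<in> id_diagram [x]"
    then have st: "(s, t) = (if x = X then (Up 0, Lo 0) else (Lo 0, Up 0))"
      unfolding id_diagram_single by blast
    show "(outer s, outer t) \<in> (glue (cup_right x) (cap_left x))\<^sup>+"
    proof (cases "x = X")
      case True
      then show ?thesis using st unfolding glue_right_left
        by (simp only: if_True prod.inject outer.simps) (rule trancl4[of _ "Mid 0" _ "Mid 1" "Mid 2"]; simp)
    next
      case False
      then show ?thesis using st unfolding glue_right_left
        by (simp only: if_False prod.inject outer.simps) (rule trancl4[of _ "Mid 2" _ "Mid 1" "Mid 0"]; simp)
    qed
  qed
  show "loops (cup_right x) (cap_left x) = 0"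
    by (rule loops_0_increasing[of _ _ "if x = X then height1 else height4"])
      (cases x; simp add: glue_right_left; elim disjE conjE; simp)
qed

lemma zigzag_right:
  "vconcat (cup_left x) (cap_right x) = id_diagram [x]" "loops (cup_left x) (cap_right x) = 0"
proof -
  show "vconcat (cup_left x) (cap_right x) = id_diagram [x]"
  proof (rule vconcat_eqI[OF K_matching[OF K_zigzag(3)] K_matching[OF K_zigzag(4)] matching_id])
    fix s t assume "(s, t) \<in> id_diagram [x]"
    then have st: "(s, t) = (if x = X then (Up 0, Lo 0) else (Lo 0, Up 0))"
      unfolding id_diagram_single by blast
    show "(outer s, outer t) \<in> (glue (cup_left x) (cap_right x))\<^sup>+"
    proof (cases "x = X")
      case True
      then show ?thesis using st unfolding glue_left_right
        by (simp only: if_True prod.inject outer.simps) (rule trancl4[of _ "Mid 2" _ "Mid 1" "Mid 0"]; simp)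
    next
      case False
      then show ?thesis using st unfolding glue_left_right
        by (simp only: if_False prod.inject outer.simps) (rule trancl4[of _ "Mid 0" _ "Mid 1" "Mid 2"]; simp)
    qed
  qed
  show "loops (cup_left x) (cap_right x) = 0"
    by (rule loops_0_increasing[of _ _ "if x = X then height3 else height2"])
      (cases x; simp add: glue_left_right; elim disjE conjE; simp)
qed

text \<open>The glued graph is a 2-cycle on \<open>Mid 0\<close> and \<open>Mid 1\<close>: it has no
  outer points and a single cycle.\<close>

lemma circle: "vconcat {lo_arc x 0} {up_arc x 0} = id_diagram []" "loops {lo_arc x 0} {up_arc x 0} = 1"
proof -
  have id: "id_diagram [] = {}" by (simp add: id_diagram_def)
  have m: "matching [] [] (id_diagram [])" by (rule matching_id)
  show "vconcat {lo_arc x 0} {up_arc x 0} = id_diagram []"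
    by (rule vconcat_eqI[OF K_matching[OF K_lo_arc] K_matching[OF K_up_arc] m]) (simp add: id)
  let ?G = "glue {lo_arc x 0} {up_arc x 0}"
  have G: "?G = {(Mid 0, Mid 1), (Mid 1, Mid 0)}"
    by (cases x) (auto simp: glue_def lo_arc_def up_arc_def)
  then have e: "(Mid 0, Mid 1) \<in> ?G" "(Mid 1, Mid 0) \<in> ?G" by auto
  then have cyc: "(Mid 0, Mid 0) \<in> ?G\<^sup>+" by (meson r_into_trancl' trancl_into_trancl)
  have sv: "single_valued ?G" unfolding G by (auto simp: single_valued_def)
  have "?G\<^sup>* `` {p} = ?G\<^sup>* `` {Mid 0}" if "(p, p) \<in> ?G\<^sup>+" for p
  proof -
    have "p = Mid 0 \<or> p = Mid 1" using tranclD[OF that] unfolding G by auto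
    then show ?thesis using cycle_eq(1)[OF sv cyc r_into_rtrancl[OF e(1)]] by metis
  qed
  then have "cycles ?G = {?G\<^sup>* `` {Mid 0}}" using cyc unfolding cycles_def by blast
  then show "loops {lo_arc x 0} {up_arc x 0} = 1" by (simp add: loops_eq_cycles)
qed

subsection \<open>Dual bases of a fiber functor\<close>

lemma single_hom: "D \<in> K w w' \<Longrightarrow> Poly_Mapping.single D c \<in> hom w w'"
  by (cases "c = 0") (auto simp: hom_def)

lemma comp_single:
  "comp d (Poly_Mapping.single D' 1) (Poly_Mapping.single D 1) =
    Defs.smult (d ^ loops D D') (Poly_Mapping.single (vconcat D D') 1)"
  by (simp add: comp_def Defs.smult_def)

lemma tensor_single:
  "tensor m n (Poly_Mapping.single D 1) (Poly_Mapping.single D' 1) = Poly_Mapping.single (hconcat m n D D') 1"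
  by (simp add: tensor_def)

lemma sum_mult_delta:
  fixes c :: "nat \<Rightarrow> complex"
  shows "i < n \<Longrightarrow> (\<Sum>j<n. c j * (if j = i then 1 else 0)) = c i"
    "i < n \<Longrightarrow> (\<Sum>j<n. c j * (if i = j then 1 else 0)) = c i"
  by (simp_all add: if_distrib cong: if_cong)

context fiber_functor
begin

abbreviation dmor :: "word \<Rightarrow> word \<Rightarrow> diagram \<Rightarrow> 'v \<Rightarrow> 'v" where
  "dmor w w' D \<equiv> mor \<Phi> w w' (Poly_Mapping.single D 1)"

lemma subspace_obj: "subspace (obj \<Phi> w)"
  using obj_fin_dim fin_dim_subspace by blast

lemma dmor_linear: "D \<in> K w w' \<Longrightarrow> linear_between (obj \<Phi> w) (obj \<Phi> w') (dmor w w' D)"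
  by (rule mor_linear[OF single_hom])

lemma dmor_mem: "D \<in> K w w' \<Longrightarrow> a \<in> obj \<Phi> w \<Longrightarrow> dmor w w' D a \<in> obj \<Phi> w'"
  using dmor_linear linear_between_mem by blast

lemma dmor_id: "a \<in> obj \<Phi> w \<Longrightarrow> dmor w w (id_diagram w) a = a"
  using mor_ident by (simp add: ident_def)

lemma dmor_vconcat:
  assumes "D \<in> K w w'" "D' \<in> K w' w''" "vconcat D D' \<in> K w w''" "a \<in> obj \<Phi> w"
  shows "dmor w' w'' D' (dmor w w' D a) = d ^ loops D D' *s dmor w w'' (vconcat D D') a"
  using mor_comp[OF single_hom[OF assms(1), of 1] single_hom[OF assms(2), of 1] assms(4)]
    mor_smult[OF single_hom[OF assms(3), of 1] assms(4), of "d ^ loops D D'"]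
  by (simp add: comp_single)

lemma dmor_hconcat:
  assumes "D \<in> K w1 w1'" "D' \<in> K w2 w2'" "a \<in> obj \<Phi> w1" "b \<in> obj \<Phi> w2"
  shows "dmor (w1 @ w2) (w1' @ w2') (hconcat (length w1) (length w1') D D') (tens \<Phi> w1 w2 a b) =
    tens \<Phi> w1' w2' (dmor w1 w1' D a) (dmor w2 w2' D' b)"
  using mor_tensor[OF single_hom[OF assms(1), of 1] single_hom[OF assms(2), of 1] assms(3,4)]
  by (simp add: tensor_single)

lemma tens_bilinear: "bilinear_between (obj \<Phi> w) (obj \<Phi> w') (obj \<Phi> (w @ w')) (tens \<Phi> w w')"
  by (rule tensor_bilinear[OF tens_tensor_product])

lemma tens_mem: "a \<in> obj \<Phi> w \<Longrightarrow> b \<in> obj \<Phi> w' \<Longrightarrow> tens \<Phi> w w' a b \<in> obj \<Phi> (w @ w')"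
  by (rule bilinear_mem[OF tens_bilinear])

lemmas tens_linear_right = bilinear_betweenD(1)[OF tens_bilinear]
lemmas tens_linear_left = bilinear_betweenD(2)[OF tens_bilinear]

lemma one_mem: "one \<Phi> \<in> obj \<Phi> []"
  by (simp add: one_basis span_base)

lemma scalar_of_scale: "scalar_of \<Phi> (c *s one \<Phi>) = c"
  unfolding scalar_of_def by (rule the_equality) (use one_basis(1) in auto)

lemma scalar_of_eq: "z \<in> obj \<Phi> [] \<Longrightarrow> scalar_of \<Phi> z *s one \<Phi> = z"
  unfolding one_basis span_singleton by (auto simp: scalar_of_scale)

lemma scalar_of_linear: "z \<in> obj \<Phi> [] \<Longrightarrow> z' \<in> obj \<Phi> [] \<Longrightarrow> scalar_of \<Phi> (z + z') = scalar_of \<Phi> z + scalar_of \<Phi> z'"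
  "z \<in> obj \<Phi> [] \<Longrightarrow> scalar_of \<Phi> (c *s z) = c * scalar_of \<Phi> z"
proof -
  show "scalar_of \<Phi> (z + z') = scalar_of \<Phi> z + scalar_of \<Phi> z'" if "z \<in> obj \<Phi> []" "z' \<in> obj \<Phi> []"
    using scalar_of_scale[of "scalar_of \<Phi> z + scalar_of \<Phi> z'"] scalar_of_eq[OF that(1)] scalar_of_eq[OF that(2)]
    by (simp add: scale_left_distrib)
  show "scalar_of \<Phi> (c *s z) = c * scalar_of \<Phi> z" if "z \<in> obj \<Phi> []"
    using scalar_of_scale[of "c * scalar_of \<Phi> z"] scalar_of_eq[OF that] by (metis scale_scale)
qed

text \<open>The two bilinear forms \<open>E\<close> and \<open>F\<close> are treated uniformly, as the forms attached to the two
  letters; likewise \<open>coev x\<close> are the two coevaluation vectors.\<close>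

definition form :: "letter \<Rightarrow> 'v \<Rightarrow> 'v \<Rightarrow> complex" where
  "form x a b = scalar_of \<Phi> (dmor [x, dual x] [] {up_arc x 0} (tens \<Phi> [x] [dual x] a b))"

definition coev :: "letter \<Rightarrow> 'v" where
  "coev x = dmor [] [x, dual x] {lo_arc x 0} (one \<Phi>)"

lemma form_X: "form X = E_form \<Phi>" and form_X_star: "form X_star = F_form \<Phi>"
  by (simp_all add: fun_eq_iff form_def E_form_def F_form_def eps_X_def eps_X_star_def up_arc_def)

lemma tens2_mem: "a \<in> obj \<Phi> [x] \<Longrightarrow> b \<in> obj \<Phi> [y] \<Longrightarrow> tens \<Phi> [x] [y] a b \<in> obj \<Phi> [x, y]"
  using tens_mem[of a "[x]" b "[y]"] by simp

lemma form_eq: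
  assumes "a \<in> obj \<Phi> [x]" "b \<in> obj \<Phi> [dual x]"
  shows "dmor [x, dual x] [] {up_arc x 0} (tens \<Phi> [x] [dual x] a b) = form x a b *s one \<Phi>"
  unfolding form_def using scalar_of_eq[OF dmor_mem[OF K_up_arc tens2_mem[OF assms]]] by simp

lemma coev_mem: "coev x \<in> obj \<Phi> [x, dual x]"
  unfolding coev_def by (rule dmor_mem[OF K_lo_arc one_mem])

section \<open>Snake identities and circles in coordinates\<close>

lemma form_sum_left:
  fixes n :: nat
  assumes "\<And>i. i < n \<Longrightarrow> a i \<in> obj \<Phi> [x]" "b \<in> obj \<Phi> [dual x]"
  shows "form x (\<Sum>i<n. c i *s a i) b = (\<Sum>i<n. c i * form x (a i) b)"
proof -
  have sum_mem: "(\<Sum>i<n. c i *s a i) \<in> obj \<Phi> [x]"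
    using assms(1) by (intro subspace_sum[OF subspace_obj] subspace_scale[OF subspace_obj]) auto
  have l: "linear_between (obj \<Phi> [x]) (obj \<Phi> []) (\<lambda>a. dmor [x, dual x] [] {up_arc x 0} (tens \<Phi> [x] [dual x] a b))"
    using linear_between_comp[OF _ dmor_linear[OF K_up_arc]] tens_linear_left[OF assms(2), of "[x]"] by simp
  have "form x (\<Sum>i<n. c i *s a i) b *s one \<Phi> = (\<Sum>i<n. c i *s (form x (a i) b *s one \<Phi>))"
    unfolding form_eq[OF sum_mem assms(2), symmetric]
    using linear_between_lincomb[OF l subspace_obj, of "{..<n}" a c] assms by (simp add: form_eq)
  also have "\<dots> = (\<Sum>i<n. c i * form x (a i) b) *s one \<Phi>" by (simp add: scale_sum_left)
  finally show ?thesis by (metis scalar_of_scale)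
qed

lemma form_sum_right:
  fixes n :: nat
  assumes "a \<in> obj \<Phi> [x]" "\<And>i. i < n \<Longrightarrow> b i \<in> obj \<Phi> [dual x]"
  shows "form x a (\<Sum>i<n. c i *s b i) = (\<Sum>i<n. c i * form x a (b i))"
proof -
  have sum_mem: "(\<Sum>i<n. c i *s b i) \<in> obj \<Phi> [dual x]"
    using assms(2) by (intro subspace_sum[OF subspace_obj] subspace_scale[OF subspace_obj]) auto
  have l: "linear_between (obj \<Phi> [dual x]) (obj \<Phi> []) (\<lambda>b. dmor [x, dual x] [] {up_arc x 0} (tens \<Phi> [x] [dual x] a b))"
    using linear_between_comp[OF _ dmor_linear[OF K_up_arc]] tens_linear_right[OF assms(1), of "[dual x]"] by simp
  have "form x a (\<Sum>i<n. c i *s b i) *s one \<Phi> = (\<Sum>i<n. c i *s (form x a (b i) *s one \<Phi>))"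
    unfolding form_eq[OF assms(1) sum_mem, symmetric]
    using linear_between_lincomb[OF l subspace_obj, of "{..<n}" b c] assms by (simp add: form_eq)
  also have "\<dots> = (\<Sum>i<n. c i * form x a (b i)) *s one \<Phi>" by (simp add: scale_sum_left)
  finally show ?thesis by (metis scalar_of_scale)
qed

lemma tens_scalar_left: "a \<in> obj \<Phi> w \<Longrightarrow> tens \<Phi> [] w (c *s one \<Phi>) a = c *s a"
  using linear_between_scale[OF tens_linear_left[of a w "[]"] one_mem, of c] tens_one(1) by simp

lemma tens_scalar_right: "a \<in> obj \<Phi> w \<Longrightarrow> tens \<Phi> w [] a (c *s one \<Phi>) = c *s a"
  using linear_between_scale[OF tens_linear_right[of a w "[]"] one_mem, of c] tens_one(2) by simp

text \<open>The S-shaped diagram is straightened to the identity. Evaluated step by step it first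
  appends the coevaluation vector to \<open>a\<close>, then rebrackets, and then pairs
  \<open>a\<close> with the first tensor factors.\<close>

lemma snake_left:
  fixes n :: nat
  assumes a: "a \<in> obj \<Phi> [x]" and u: "\<And>j. j < n \<Longrightarrow> u j \<in> obj \<Phi> [dual x]" and \<xi>: "\<And>j. j < n \<Longrightarrow> \<xi> j \<in> obj \<Phi> [x]"
    and coev: "coev (dual x) = (\<Sum>j<n. tens \<Phi> [dual x] [x] (u j) (\<xi> j))"
  shows "a = (\<Sum>j<n. form x a (u j) *s \<xi> j)"
proof -
  have coev': "coev (dual x) \<in> obj \<Phi> [dual x, x]" using coev_mem[of "dual x"] by simp
  have "a = dmor [x] [x] (vconcat (cup_right x) (cap_left x)) a"
    using dmor_id[OF a] by (simp add: zigzag_left)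
  also have "\<dots> = dmor [x, dual x, x] [x] (cap_left x) (dmor [x] [x, dual x, x] (cup_right x) a)"
    using dmor_vconcat[OF K_zigzag(1,2) _ a] K_id[of "[x]"] by (simp add: zigzag_left)
  also have "dmor [x] [x, dual x, x] (cup_right x) a = tens \<Phi> [x] [dual x, x] a (coev (dual x))"
    using dmor_hconcat[OF K_id[of "[x]"] K_lo_arc[of "dual x"] a one_mem] tens_one(2)[OF a] dmor_id[OF a]
    by (simp add: cup_right_def coev_def)
  also have "\<dots> = (\<Sum>j<n. tens \<Phi> [x] [dual x, x] a (tens \<Phi> [dual x] [x] (u j) (\<xi> j)))"
    unfolding coev
    by (rule linear_between_sum[OF tens_linear_right[OF a] subspace_obj]) (use tens2_mem u \<xi> in auto)
  also have "\<dots> = (\<Sum>j<n. tens \<Phi> [x, dual x] [x] (tens \<Phi> [x] [dual x] a (u j)) (\<xi> j))"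
    using tens_assoc[OF a, of _ "[dual x]" _ "[x]"] u \<xi> by simp
  also have "dmor [x, dual x, x] [x] (cap_left x) \<dots> =
      (\<Sum>j<n. dmor [x, dual x, x] [x] (cap_left x) (tens \<Phi> [x, dual x] [x] (tens \<Phi> [x] [dual x] a (u j)) (\<xi> j)))"
    by (rule linear_between_sum[OF dmor_linear[OF K_zigzag(2)] subspace_obj])
      (use tens_mem[OF tens2_mem[OF a u] \<xi>] in auto)
  also have "\<dots> = (\<Sum>j<n. form x a (u j) *s \<xi> j)"
  proof (rule sum.cong[OF refl])
    fix j assume "j \<in> {..<n}"
    then have m: "u j \<in> obj \<Phi> [dual x]" "\<xi> j \<in> obj \<Phi> [x]" using u \<xi> by auto
    show "dmor [x, dual x, x] [x] (cap_left x) (tens \<Phi> [x, dual x] [x] (tens \<Phi> [x] [dual x] a (u j)) (\<xi> j)) =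
        form x a (u j) *s \<xi> j"
      using dmor_hconcat[OF K_up_arc[of x] K_id[of "[x]"] tens2_mem[OF a m(1)] m(2)] dmor_id[OF m(2)]
        tens_scalar_left[OF m(2)] form_eq[OF a m(1)]
      by (simp add: cap_left_def numeral_2_eq_2)
  qed
  finally show ?thesis .
qed

lemma snake_right:
  fixes n :: nat
  assumes a: "a \<in> obj \<Phi> [x]" and u: "\<And>j. j < n \<Longrightarrow> u j \<in> obj \<Phi> [x]" and \<xi>: "\<And>j. j < n \<Longrightarrow> \<xi> j \<in> obj \<Phi> [dual x]"
    and coev: "coev x = (\<Sum>j<n. tens \<Phi> [x] [dual x] (u j) (\<xi> j))"
  shows "a = (\<Sum>j<n. form (dual x) (\<xi> j) a *s u j)"
proof -
  have "a = dmor [x] [x] (vconcat (cup_left x) (cap_right x)) a"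
    using dmor_id[OF a] by (simp add: zigzag_right)
  also have "\<dots> = dmor [x, dual x, x] [x] (cap_right x) (dmor [x] [x, dual x, x] (cup_left x) a)"
    using dmor_vconcat[OF K_zigzag(3,4) _ a] K_id[of "[x]"] by (simp add: zigzag_right)
  also have "dmor [x] [x, dual x, x] (cup_left x) a = tens \<Phi> [x, dual x] [x] (coev x) a"
    using dmor_hconcat[OF K_lo_arc[of x] K_id[of "[x]"] one_mem a] tens_one(1)[OF a] dmor_id[OF a]
    by (simp add: cup_left_def coev_def numeral_2_eq_2)
  also have "\<dots> = (\<Sum>j<n. tens \<Phi> [x, dual x] [x] (tens \<Phi> [x] [dual x] (u j) (\<xi> j)) a)"
    unfolding coev
    by (rule linear_between_sum[OF tens_linear_left[OF a] subspace_obj]) (use tens2_mem u \<xi> in auto)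
  also have "\<dots> = (\<Sum>j<n. tens \<Phi> [x] [dual x, x] (u j) (tens \<Phi> [dual x] [x] (\<xi> j) a))"
    using tens_assoc[of _ "[x]" _ "[dual x]" a "[x]"] a u \<xi> by simp
  also have "dmor [x, dual x, x] [x] (cap_right x) \<dots> =
      (\<Sum>j<n. dmor [x, dual x, x] [x] (cap_right x) (tens \<Phi> [x] [dual x, x] (u j) (tens \<Phi> [dual x] [x] (\<xi> j) a)))"
    by (rule linear_between_sum[OF dmor_linear[OF K_zigzag(4)] subspace_obj])
      (use tens_mem[OF u tens2_mem[OF \<xi> a]] in auto)
  also have "\<dots> = (\<Sum>j<n. form (dual x) (\<xi> j) a *s u j)"
  proof (rule sum.cong[OF refl])
    fix j assume "j \<in> {..<n}"
    then have m: "u j \<in> obj \<Phi> [x]" "\<xi> j \<in> obj \<Phi> [dual x]" using u \<xi> by auto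
    have a': "a \<in> obj \<Phi> [dual (dual x)]" using a by simp
    show "dmor [x, dual x, x] [x] (cap_right x) (tens \<Phi> [x] [dual x, x] (u j) (tens \<Phi> [dual x] [x] (\<xi> j) a)) =
        form (dual x) (\<xi> j) a *s u j"
      using dmor_hconcat[OF K_id[of "[x]"] K_up_arc[of "dual x"] m(1), of "tens \<Phi> [dual x] [x] (\<xi> j) a"]
        tens2_mem[OF m(2) a] dmor_id[OF m(1)] tens_scalar_right[OF m(1)] form_eq[OF m(2) a']
      by (simp add: cap_right_def)
  qed
  finally show ?thesis .
qed

text \<open>The circle acts on the unit space as the scalar \<open>d\<close>; computed as form after
  coevaluation it becomes the sum on the left.\<close>

lemma circle_value:
  fixes n :: nat
  assumes u: "\<And>j. j < n \<Longrightarrow> u j \<in> obj \<Phi> [x]" and \<xi>: "\<And>j. j < n \<Longrightarrow> \<xi> j \<in> obj \<Phi> [dual x]"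
    and coev: "coev x = (\<Sum>j<n. tens \<Phi> [x] [dual x] (u j) (\<xi> j))"
  shows "(\<Sum>j<n. form x (u j) (\<xi> j)) = d"
proof -
  have "d *s one \<Phi> = dmor [x, dual x] [] {up_arc x 0} (coev x)"
    using dmor_vconcat[OF K_lo_arc[of x] K_up_arc[of x] _ one_mem] K_id[of "[]"] dmor_id[OF one_mem]
    by (simp add: circle coev_def)
  also have "\<dots> = (\<Sum>j<n. dmor [x, dual x] [] {up_arc x 0} (tens \<Phi> [x] [dual x] (u j) (\<xi> j)))"
    unfolding coev
    by (rule linear_between_sum[OF dmor_linear[OF K_up_arc] subspace_obj]) (use tens2_mem u \<xi> in auto)
  also have "\<dots> = (\<Sum>j<n. form x (u j) (\<xi> j)) *s one \<Phi>"
    using form_eq u \<xi> by (simp add: scale_sum_left)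
  finally show ?thesis by (metis scalar_of_scale)
qed

lemma coev_expand:
  assumes "basis_of (obj \<Phi> [x]) n u"
  shows "\<exists>\<xi>. (\<forall>j<n. \<xi> j \<in> obj \<Phi> [dual x]) \<and> coev x = (\<Sum>j<n. tens \<Phi> [x] [dual x] (u j) (\<xi> j))"
  using tensor_expand[OF tens_tensor_product subspace_obj subspace_obj subspace_obj assms, of "coev x" "[dual x]"] coev_mem[of x]
  by simp

definition dual_bases :: "nat \<Rightarrow> (nat \<Rightarrow> 'v) \<Rightarrow> (nat \<Rightarrow> 'v) \<Rightarrow> bool" where
  "dual_bases n v w \<longleftrightarrow> basis_of (obj \<Phi> [X]) n v \<and> basis_of (obj \<Phi> [X_star]) n w \<and>
     (\<forall>i<n. \<forall>j<n. E_form \<Phi> (v i) (w j) = (if i = j then 1 else 0))"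

definition form_matrix :: "nat \<Rightarrow> (nat \<Rightarrow> 'v) \<Rightarrow> (nat \<Rightarrow> 'v) \<Rightarrow> complex mat" where
  "form_matrix n v w = mat n n (\<lambda>(j, i). F_form \<Phi> (w j) (v i))"

lemma attached_iff: "M \<in> attached_matrices \<Phi> \<longleftrightarrow> (\<exists>n v w. dual_bases n v w \<and> M = form_matrix n v w)"
  unfolding attached_matrices_def dual_bases_def form_matrix_def by blast

text \<open>Expanding the coevaluation vector over a basis of \<open>obj \<Phi> [X_star]\<close> yields the dual basis:
  by one snake identity its coefficients span, by the other one they are dual.\<close>

lemma dual_bases_exist: "\<exists>n v w. dual_bases n v w"
proof -
  obtain n w where w: "basis_of (obj \<Phi> [X_star]) n w" using basis_of_exists[OF obj_fin_dim] by blast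
  from coev_expand[OF w] obtain v where v: "\<And>j. j < n \<Longrightarrow> v j \<in> obj \<Phi> [X]"
    and coev: "coev X_star = (\<Sum>j<n. tens \<Phi> [X_star] [X] (w j) (v j))" by auto
  note wm = basis_of_mem[OF w]
  have E: "E_form \<Phi> (v j) (w i) = (if j = i then 1 else 0)" if "i < n" "j < n" for i j
  proof -
    have "(\<Sum>j<n. E_form \<Phi> (v j) (w i) *s w j) = w i"
      using snake_right[OF wm[OF that(1)] wm, where \<xi> = v] v coev by (simp add: form_X)
    also have "\<dots> = (\<Sum>j<n. (if j = i then 1 else 0) *s w j)"
      using that(1) by (simp add: if_distribR if_distrib[of "\<lambda>c. c *s _"] cong: if_cong)
    finally show ?thesis by (rule basis_of_unique[OF w _ that(2)])
  qed
  have "basis_of (obj \<Phi> [X]) n v"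
  proof (rule basis_ofI[OF subspace_obj v])
    fix c i assume c: "(\<Sum>j<n. c j *s v j) = 0" "i < n"
    have "(\<Sum>j<n. c j * E_form \<Phi> (v j) (w i)) = E_form \<Phi> 0 (w i)"
      using form_sum_left[of n v X "w i" c] v wm[OF c(2)] c(1) by (simp add: form_X)
    \<comment> \<open>The form vanishes at the zero vector because that vector is an empty linear
      combination.\<close>
    also have "\<dots> = 0"
      using form_sum_left[of 0 v X "w i" c] wm[OF c(2)] by (simp add: form_X)
    finally show "c i = 0" using E c(2) by (simp add: sum_mult_delta)
  next
    fix a assume "a \<in> obj \<Phi> [X]"
    then have "a = (\<Sum>j<n. E_form \<Phi> a (w j) *s v j)"
      using snake_left[of a X n w v] wm v coev by (simp add: form_X)
    then show "\<exists>c. a = (\<Sum>j<n. c j *s v j)" by (rule exI[of _ "\<lambda>j. E_form \<Phi> a (w j)"])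
  qed
  then show ?thesis using w E unfolding dual_bases_def by blast
qed

lemma dual_bases_mem:
  "dual_bases n v w \<Longrightarrow> i < n \<Longrightarrow> v i \<in> obj \<Phi> [X]" "dual_bases n v w \<Longrightarrow> i < n \<Longrightarrow> w i \<in> obj \<Phi> [X_star]"
  unfolding dual_bases_def by (auto intro: basis_of_mem)

text \<open>The coefficient vectors over the basis \<open>w\<close> are at first unknown; the snake
  identity applied to \<open>v i\<close>, where the form takes the values 0 and 1, identifies them
  as the \<open>v i\<close>.\<close>

lemma coev_X_star:
  assumes vw: "dual_bases n v w"
  shows "coev X_star = (\<Sum>j<n. tens \<Phi> [X_star] [X] (w j) (v j))"
proof -
  note mem = dual_bases_mem[OF vw]
  have w: "basis_of (obj \<Phi> [X_star]) n w" using vw by (simp add: dual_bases_def)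
  from coev_expand[OF w] obtain \<xi> where \<xi>: "\<And>j. j < n \<Longrightarrow> \<xi> j \<in> obj \<Phi> [X]"
    and coev: "coev X_star = (\<Sum>j<n. tens \<Phi> [X_star] [X] (w j) (\<xi> j))" by auto
  have "v i = \<xi> i" if i: "i < n" for i
  proof -
    have "v i = (\<Sum>j<n. E_form \<Phi> (v i) (w j) *s \<xi> j)"
      using snake_left[OF mem(1)[OF i], of n w \<xi>] mem \<xi> coev by (simp add: form_X)
    also have "\<dots> = (\<Sum>j<n. (if i = j then 1 else 0) *s \<xi> j)"
      using vw i by (intro sum.cong) (auto simp: dual_bases_def)
    also have "\<dots> = \<xi> i" using i by (simp add: if_distribR if_distrib[of "\<lambda>c. c *s _"] cong: if_cong)
    finally show ?thesis .
  qed
  then show ?thesis using coev by simp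
qed

text \<open>The matrix \<open>C\<close> collects the coordinates in \<open>w\<close> of the
  coefficients of \<open>coev X\<close> over \<open>v\<close>. The snake identity for
  \<open>F\<close> says that \<open>C\<close> is a left inverse of the form matrix, and the circle
  for \<open>X\<close> is the trace of \<open>C\<close>.\<close>

lemma coev_X:
  assumes vw: "dual_bases n v w"
  shows "\<exists>C \<in> carrier_mat n n. C * form_matrix n v w = 1\<^sub>m n \<and>
    coev X = (\<Sum>i<n. tens \<Phi> [X] [X_star] (v i) (\<Sum>j<n. C $$ (i, j) *s w j)) \<and> mat_trace C = d"
proof -
  note mem = dual_bases_mem[OF vw]
  have v: "basis_of (obj \<Phi> [X]) n v" and w: "basis_of (obj \<Phi> [X_star]) n w"
    and E: "\<And>i j. i < n \<Longrightarrow> j < n \<Longrightarrow> E_form \<Phi> (v i) (w j) = (if i = j then 1 else 0)"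
    using vw by (simp_all add: dual_bases_def)
  from coev_expand[OF v] obtain \<zeta> where \<zeta>: "\<And>i. i < n \<Longrightarrow> \<zeta> i \<in> obj \<Phi> [X_star]"
    and coev: "coev X = (\<Sum>i<n. tens \<Phi> [X] [X_star] (v i) (\<zeta> i))" by auto
  have "\<forall>i. \<exists>c. i < n \<longrightarrow> \<zeta> i = (\<Sum>j<n. c j *s w j)" using basis_of_expand[OF w \<zeta>] by blast
  then obtain c where c: "\<And>i. i < n \<Longrightarrow> \<zeta> i = (\<Sum>j<n. c i j *s w j)" by metis
  define C where "C = mat n n (\<lambda>(i, j). c i j)"
  have F: "F_form \<Phi> (\<zeta> i) (v l) = (if i = l then 1 else 0)" if "i < n" "l < n" for i l
  proof -
    have "(\<Sum>i<n. F_form \<Phi> (\<zeta> i) (v l) *s v i) = v l"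
      using snake_right[OF mem(1)[OF that(2)] mem(1), where \<xi> = \<zeta>] \<zeta> coev by (simp add: form_X_star)
    also have "\<dots> = (\<Sum>i<n. (if i = l then 1 else 0) *s v i)"
      using that(2) by (simp add: if_distribR if_distrib[of "\<lambda>c. c *s _"] cong: if_cong)
    finally show ?thesis by (rule basis_of_unique[OF v _ that(1)])
  qed
  have "C * form_matrix n v w = 1\<^sub>m n"
  proof (rule eq_matI)
    fix i l assume "i < dim_row (1\<^sub>m n)" "l < dim_col (1\<^sub>m n)"
    then have il: "i < n" "l < n" by simp_all
    have "(C * form_matrix n v w) $$ (i, l) = (\<Sum>j<n. c i j * F_form \<Phi> (w j) (v l))"
      using il by (simp add: C_def form_matrix_def scalar_prod_def atLeast0LessThan)
    also have "\<dots> = F_form \<Phi> (\<zeta> i) (v l)"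
      using form_sum_left[of n w X_star "v l" "c i"] mem il c by (simp add: form_X_star)
    finally show "(C * form_matrix n v w) $$ (i, l) = 1\<^sub>m n $$ (i, l)" using F il by simp
  qed (simp_all add: C_def form_matrix_def)
  moreover have "mat_trace C = d"
  proof -
    have "mat_trace C = (\<Sum>i<n. \<Sum>j<n. c i j * (if i = j then 1 else 0))"
      by (simp add: mat_trace_def C_def sum_mult_delta)
    also have "\<dots> = (\<Sum>i<n. E_form \<Phi> (v i) (\<zeta> i))"
    proof (rule sum.cong[OF refl])
      fix i assume "i \<in> {..<n}"
      then have i: "i < n" by simp
      show "(\<Sum>j<n. c i j * (if i = j then 1 else 0)) = E_form \<Phi> (v i) (\<zeta> i)"
        using form_sum_right[of "v i" X n w "c i"] mem i c E by (simp add: form_X cong: if_cong)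
    qed
    also have "\<dots> = d" using circle_value[of n v X \<zeta>] mem \<zeta> coev by (simp add: form_X)
    finally show ?thesis .
  qed
  moreover have "coev X = (\<Sum>i<n. tens \<Phi> [X] [X_star] (v i) (\<Sum>j<n. C $$ (i, j) *s w j))"
    unfolding coev by (rule sum.cong) (auto simp: c C_def)
  ultimately show ?thesis by (intro bexI[of _ C]) (auto simp: C_def)
qed

lemma form_matrix_carrier [simp]: "form_matrix n v w \<in> carrier_mat n n"
  by (simp add: form_matrix_def)

text \<open>One orientation of the circle yields the trace of the matrix, the other one that of its
  inverse.\<close>

lemma form_matrix_trace_matrices:
  assumes vw: "dual_bases n v w"
  shows "form_matrix n v w \<in> trace_matrices n d"
proof -
  note mem = dual_bases_mem[OF vw]
  let ?B = "form_matrix n v w"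
  obtain C where C: "C \<in> carrier_mat n n" "C * ?B = 1\<^sub>m n" "mat_trace C = d" using coev_X[OF vw] by blast
  have "?B * C = 1\<^sub>m n" by (rule mat_mult_left_right_inverse[OF C(1) _ C(2)]) simp
  moreover have "mat_trace ?B = d"
    using circle_value[of n w X_star v] mem coev_X_star[OF vw]
    by (simp add: mat_trace_def form_matrix_def form_X_star)
  ultimately show ?thesis using C unfolding trace_matrices_def inverts_mat_def by (auto simp: form_matrix_def)
qed

section \<open>Change of dual bases\<close>

lemma form_F_sum:
  fixes n :: nat
  assumes "\<And>j. j < n \<Longrightarrow> w j \<in> obj \<Phi> [X_star]" "\<And>j. j < n \<Longrightarrow> v j \<in> obj \<Phi> [X]"
  shows "F_form \<Phi> (\<Sum>k<n. p k *s w k) (\<Sum>l<n. q l *s v l) = (\<Sum>k<n. \<Sum>l<n. p k * q l * F_form \<Phi> (w k) (v l))"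
proof -
  have "(\<Sum>l<n. q l *s v l) \<in> obj \<Phi> [X]"
    using assms(2) by (intro subspace_sum[OF subspace_obj] subspace_scale[OF subspace_obj]) auto
  then show ?thesis
    using form_sum_left[of n w X_star "\<Sum>l<n. q l *s v l" p] form_sum_right[of _ X_star n v q] assms
    by (simp add: form_X_star sum_distrib_left mult.assoc)
qed

lemma form_E_sum:
  assumes vw: "dual_bases n v w"
  shows "E_form \<Phi> (\<Sum>l<n. q l *s v l) (\<Sum>k<n. p k *s w k) = (\<Sum>k<n. p k * q k)"
proof -
  note mem = dual_bases_mem[OF vw]
  have E: "\<And>i j. i < n \<Longrightarrow> j < n \<Longrightarrow> E_form \<Phi> (v i) (w j) = (if i = j then 1 else 0)"
    using vw by (simp add: dual_bases_def)
  have "(\<Sum>k<n. p k *s w k) \<in> obj \<Phi> [X_star]"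
    using mem(2) by (intro subspace_sum[OF subspace_obj] subspace_scale[OF subspace_obj]) auto
  then have "E_form \<Phi> (\<Sum>l<n. q l *s v l) (\<Sum>k<n. p k *s w k) = (\<Sum>l<n. q l * (\<Sum>k<n. p k * E_form \<Phi> (v l) (w k)))"
    using form_sum_left[of n v X "\<Sum>k<n. p k *s w k" q] form_sum_right[of _ X n w p] mem
    by (simp add: form_X)
  also have "\<dots> = (\<Sum>l<n. q l * p l)"
  proof (rule sum.cong[OF refl])
    fix l assume l: "l \<in> {..<n}"
    then have "(\<Sum>k<n. p k * E_form \<Phi> (v l) (w k)) = (\<Sum>k<n. if k = l then p k else 0)"
      using E by (intro sum.cong) auto
    then show "q l * (\<Sum>k<n. p k * E_form \<Phi> (v l) (w k)) = q l * p l" using l by simp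
  qed
  finally show ?thesis by (simp add: mult.commute)
qed

text \<open>The duality condition forces the coordinate matrices of the two new bases to be inverse
  to each other, so the form matrix is conjugated; conversely every conjugation comes from such a
  change of bases.\<close>

lemma attached_class:
  assumes vw: "dual_bases n v w"
  shows "attached_matrices \<Phi> = {A. similar_mat A (form_matrix n v w)}"
proof (intro subset_antisym subsetI)
  let ?B = "form_matrix n v w"
  note mem = dual_bases_mem[OF vw]
  have v: "basis_of (obj \<Phi> [X]) n v" and w: "basis_of (obj \<Phi> [X_star]) n w"
    using vw by (simp_all add: dual_bases_def)
  fix A assume "A \<in> attached_matrices \<Phi>"
  then obtain n' v' w' where vw': "dual_bases n' v' w'" and A: "A = form_matrix n' v' w'"
    by (auto simp: attached_iff)
  have n': "n' = n" using vw' v basis_of_card unfolding dual_bases_def by blast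
  note mem' = dual_bases_mem[OF vw'[unfolded n']]
  have "\<forall>i. \<exists>c. i < n \<longrightarrow> v' i = (\<Sum>l<n. c l *s v l)" using basis_of_expand[OF v mem'(1)] by blast
  then obtain q where q: "\<And>i. i < n \<Longrightarrow> v' i = (\<Sum>l<n. q i l *s v l)" by metis
  have "\<forall>j. \<exists>c. j < n \<longrightarrow> w' j = (\<Sum>k<n. c k *s w k)" using basis_of_expand[OF w mem'(2)] by blast
  then obtain p where p: "\<And>j. j < n \<Longrightarrow> w' j = (\<Sum>k<n. p j k *s w k)" by metis
  \<comment> \<open>Coordinates of \<open>w'\<close> become rows and those of \<open>v'\<close>
    columns, in accordance with the row index of the form matrix belonging to
    \<open>w\<close>.\<close>
  define P Q where PQ: "P = mat n n (\<lambda>(j, k). p j k)" "Q = mat n n (\<lambda>(l, i). q i l)"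
  have "P * Q = 1\<^sub>m n"
  proof (rule eq_matI)
    fix j i assume "j < dim_row (1\<^sub>m n)" "i < dim_col (1\<^sub>m n)"
    then have ji: "j < n" "i < n" by simp_all
    have "(P * Q) $$ (j, i) = E_form \<Phi> (v' i) (w' j)"
      using ji form_E_sum[OF vw, of "q i" "p j"] p q
      by (simp add: PQ scalar_prod_def atLeast0LessThan)
    then show "(P * Q) $$ (j, i) = 1\<^sub>m n $$ (j, i)" using vw' ji unfolding n' dual_bases_def by auto
  qed (simp_all add: PQ)
  moreover from this have "Q * P = 1\<^sub>m n" by (rule mat_mult_left_right_inverse[rotated 2]) (simp_all add: PQ)
  moreover have "A = P * ?B * Q"
  proof (rule eq_matI)
    fix j i assume "j < dim_row (P * ?B * Q)" "i < dim_col (P * ?B * Q)"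
    then have ji: "j < n" "i < n" by (simp_all add: PQ)
    have "(P * ?B * Q) $$ (j, i) = (\<Sum>l<n. (\<Sum>k<n. p j k * F_form \<Phi> (w k) (v l)) * q i l)"
      using ji by (simp add: PQ form_matrix_def scalar_prod_def atLeast0LessThan)
    also have "\<dots> = (\<Sum>k<n. \<Sum>l<n. p j k * q i l * F_form \<Phi> (w k) (v l))"
      by (subst sum.swap) (simp add: sum_distrib_left sum_distrib_right mult_ac)
    also have "\<dots> = A $$ (j, i)"
      using form_F_sum[of n w v "p j" "q i"] mem p q ji unfolding A n' by (simp add: form_matrix_def)
    finally show "A $$ (j, i) = (P * ?B * Q) $$ (j, i)" by simp
  qed (simp_all add: A n' PQ form_matrix_def)
  ultimately show "A \<in> {A. similar_mat A ?B}"
    unfolding similar_mat_def similar_mat_wit_def Let_def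
    by (intro CollectI exI[of _ P] exI[of _ Q]) (auto simp: A n' PQ form_matrix_def)
next
  let ?B = "form_matrix n v w"
  note mem = dual_bases_mem[OF vw]
  have v: "basis_of (obj \<Phi> [X]) n v" and w: "basis_of (obj \<Phi> [X_star]) n w"
    using vw by (simp_all add: dual_bases_def)
  fix A assume "A \<in> {A. similar_mat A ?B}"
  then obtain m P Q where mPQ: "{A, ?B, P, Q} \<subseteq> carrier_mat m m" "P * Q = 1\<^sub>m m" "Q * P = 1\<^sub>m m" "A = P * ?B * Q"
    using similar_matD by blast
  then have "m = n" using carrier_matD(1)[of ?B m m] carrier_matD(1)[OF form_matrix_carrier[of n v w]] by simp
  with mPQ have PQ: "P \<in> carrier_mat n n" "Q \<in> carrier_mat n n" "P * Q = 1\<^sub>m n" "Q * P = 1\<^sub>m n" "A = P * ?B * Q"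
    by auto
  have PQ': "(\<Sum>l<n. P $$ (j, l) * Q $$ (l, i)) = (if j = i then 1 else 0)"
    "(\<Sum>l<n. Q $$ (j, l) * P $$ (l, i)) = (if j = i then 1 else 0)" if "j < n" "i < n" for i j
    using arg_cong[OF PQ(3), of "\<lambda>M. M $$ (j, i)"] arg_cong[OF PQ(4), of "\<lambda>M. M $$ (j, i)"] PQ(1,2) that
    by (simp_all add: scalar_prod_def atLeast0LessThan)
  \<comment> \<open>Columns of \<open>Q\<close> transform \<open>v\<close> and rows of
    \<open>P\<close> transform \<open>w\<close>, so that the pairing of the new vectors is
    \<open>P * Q\<close>.\<close>
  define v' w' where vw': "v' i = (\<Sum>l<n. Q $$ (l, i) *s v l)" "w' j = (\<Sum>k<n. P $$ (j, k) *s w k)" for i j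
  have mem': "v' i \<in> obj \<Phi> [X]" "w' i \<in> obj \<Phi> [X_star]" for i
    unfolding vw' using mem by (intro subspace_sum[OF subspace_obj] subspace_scale[OF subspace_obj]; simp)+
  have E: "E_form \<Phi> (v' i) (w' j) = (if i = j then 1 else 0)" if "i < n" "j < n" for i j
    unfolding vw' using form_E_sum[OF vw] PQ'(1)[OF that(2,1)] by auto
  have delta: "(\<Sum>l<n. (if l = i then 1 else 0) *s g l) = g i" if "i < n" for i and g :: "nat \<Rightarrow> 'v"
    using that by (simp add: if_distribR if_distrib[of "\<lambda>c. c *s _"] cong: if_cong)
  have v_eq: "v l = (\<Sum>i<n. P $$ (i, l) *s v' i)" if "l < n" for l
  proof -
    have "(\<Sum>i<n. P $$ (i, l) *s v' i) = (\<Sum>m<n. (\<Sum>i<n. Q $$ (m, i) * P $$ (i, l)) *s v m)"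
      unfolding vw' scale_sum_right scale_sum_left by (subst sum.swap) (simp add: mult.commute)
    also have "\<dots> = (\<Sum>m<n. (if m = l then 1 else 0) *s v m)" using PQ'(2) that by simp
    finally show ?thesis using delta that by simp
  qed
  have w_eq: "w k = (\<Sum>j<n. Q $$ (k, j) *s w' j)" if "k < n" for k
  proof -
    have "(\<Sum>j<n. Q $$ (k, j) *s w' j) = (\<Sum>m<n. (\<Sum>j<n. Q $$ (k, j) * P $$ (j, m)) *s w m)"
      unfolding vw' scale_sum_right scale_sum_left by (subst sum.swap) simp
    also have "\<dots> = (\<Sum>m<n. (if m = k then 1 else 0) *s w m)" using PQ'(2)[OF that] by (intro sum.cong) auto
    finally show ?thesis using delta that by simp
  qed
  have "basis_of (obj \<Phi> [X]) n v'"
  proof (rule basis_ofI[OF subspace_obj mem'(1)])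
    fix c i assume c: "(\<Sum>j<n. c j *s v' j) = 0" "i < n"
    have "(\<Sum>j<n. c j * E_form \<Phi> (v' j) (w' i)) = E_form \<Phi> 0 (w' i)"
      using form_sum_left[of n v' X "w' i" c] mem' c(1) by (simp add: form_X)
    also have "\<dots> = 0" using form_sum_left[of 0 v' X "w' i" c] mem' by (simp add: form_X)
    finally show "c i = 0" using E c(2) by (simp add: sum_mult_delta)
  next
    fix a assume "a \<in> obj \<Phi> [X]"
    then obtain c where c: "a = (\<Sum>l<n. c l *s v l)" using basis_of_expand[OF v] by blast
    also have "\<dots> = (\<Sum>l<n. c l *s (\<Sum>i<n. P $$ (i, l) *s v' i))" using v_eq by (intro sum.cong) auto
    also have "\<dots> = (\<Sum>i<n. (\<Sum>l<n. c l * P $$ (i, l)) *s v' i)"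
      unfolding scale_sum_right scale_sum_left by (subst sum.swap) simp
    finally show "\<exists>c. a = (\<Sum>j<n. c j *s v' j)" by (rule exI[of _ "\<lambda>i. \<Sum>l<n. c l * P $$ (i, l)"])
  qed
  moreover have "basis_of (obj \<Phi> [X_star]) n w'"
  proof (rule basis_ofI[OF subspace_obj mem'(2)])
    fix c i assume c: "(\<Sum>j<n. c j *s w' j) = 0" "i < n"
    have "(\<Sum>j<n. c j * E_form \<Phi> (v' i) (w' j)) = E_form \<Phi> (v' i) 0"
      using form_sum_right[of "v' i" X n w' c] mem' c(1) by (simp add: form_X)
    also have "\<dots> = 0" using form_sum_right[of "v' i" X 0 w' c] mem' by (simp add: form_X)
    finally show "c i = 0" using E c(2) by (simp add: sum_mult_delta)
  next
    fix a assume "a \<in> obj \<Phi> [X_star]"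
    then obtain c where c: "a = (\<Sum>l<n. c l *s w l)" using basis_of_expand[OF w] by blast
    also have "\<dots> = (\<Sum>l<n. c l *s (\<Sum>j<n. Q $$ (l, j) *s w' j))" using w_eq by (intro sum.cong) auto
    also have "\<dots> = (\<Sum>j<n. (\<Sum>l<n. c l * Q $$ (l, j)) *s w' j)"
      unfolding scale_sum_right scale_sum_left by (subst sum.swap) simp
    finally show "\<exists>c. a = (\<Sum>j<n. c j *s w' j)" by (rule exI[of _ "\<lambda>j. \<Sum>l<n. c l * Q $$ (l, j)"])
  qed
  ultimately have "dual_bases n v' w'" using E by (simp add: dual_bases_def)
  moreover have "A = form_matrix n v' w'"
  proof (rule eq_matI)
    fix j i assume "j < dim_row (form_matrix n v' w')" "i < dim_col (form_matrix n v' w')"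
    then have ji: "j < n" "i < n" by (simp_all add: form_matrix_def)
    have "A $$ (j, i) = (\<Sum>l<n. (\<Sum>k<n. P $$ (j, k) * F_form \<Phi> (w k) (v l)) * Q $$ (l, i))"
      unfolding PQ(5) using ji PQ(1,2) by (simp add: form_matrix_def scalar_prod_def atLeast0LessThan)
    also have "\<dots> = (\<Sum>k<n. \<Sum>l<n. P $$ (j, k) * Q $$ (l, i) * F_form \<Phi> (w k) (v l))"
      by (subst sum.swap) (simp add: sum_distrib_left sum_distrib_right mult_ac)
    also have "\<dots> = F_form \<Phi> (w' j) (v' i)"
      using form_F_sum[of n w v "\<lambda>k. P $$ (j, k)" "\<lambda>l. Q $$ (l, i)"] mem unfolding vw' by simp
    finally show "A $$ (j, i) = form_matrix n v' w' $$ (j, i)" using ji by (simp add: form_matrix_def)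
  qed (use PQ in \<open>auto simp: form_matrix_def\<close>)
  ultimately show "A \<in> attached_matrices \<Phi>" unfolding attached_iff by blast
qed

lemma attached_in_orbits:
  assumes "d \<noteq> 0"
  shows "attached_matrices \<Phi> \<in> similarity_orbits d"
proof -
  obtain n v w where vw: "dual_bases n v w" using dual_bases_exist by blast
  have tm: "form_matrix n v w \<in> trace_matrices n d" by (rule form_matrix_trace_matrices[OF vw])
  \<comment> \<open>The zero space would give the empty matrix, whose trace 0 is not
    \<open>d\<close>.\<close>
  moreover have "n \<noteq> 0"
  proof
    assume "n = 0"
    then have "mat_trace (form_matrix n v w) = 0" by (simp add: mat_trace_def form_matrix_def)
    then show False using tm assms by (simp add: trace_matrices_def)
  qed
  ultimately show ?thesis unfolding similarity_orbits_def attached_class[OF vw]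
    by (intro UN_I[of n] imageI) auto
qed

end

subsection \<open>Natural equivalence\<close>

context vect_universe
begin

lemma basis_of_image:
  assumes f: "linear_between U V f" "bij_betw f U V" and U: "subspace U" "subspace V" and u: "basis_of U n u"
  shows "basis_of V n (\<lambda>i. f (u i))"
proof (rule basis_ofI[OF U(2)])
  note um = basis_of_mem[OF u]
  show "f (u i) \<in> V" if "i < n" for i using linear_between_mem[OF f(1) um[OF that]] .
  have img: "f (\<Sum>i<n. c i *s u i) = (\<Sum>i<n. c i *s f (u i))" for c
    by (rule linear_between_lincomb[OF f(1) U(1)]) (use um in auto)
  have mem: "(\<Sum>i<n. c i *s u i) \<in> U" for c
    using um by (intro subspace_sum[OF U(1)] subspace_scale[OF U(1)]) auto
  show "c i = 0" if "(\<Sum>i<n. c i *s f (u i)) = 0" "i < n" for c i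
  proof -
    have "f (\<Sum>i<n. c i *s u i) = f 0" using that(1) img linear_between_0[OF f(1) U(1)] by simp
    then have "(\<Sum>i<n. c i *s u i) = 0"
      using f(2) mem subspace_0[OF U(1)] unfolding bij_betw_def inj_on_def by blast
    then show ?thesis using basis_of_independent[OF u _ that(2)] by blast
  qed
  show "\<exists>c. y = (\<Sum>i<n. c i *s f (u i))" if y: "y \<in> V" for y
  proof -
    obtain x where "x \<in> U" "y = f x" using f(2) y unfolding bij_betw_def by blast
    then obtain c where "y = f (\<Sum>i<n. c i *s u i)" using basis_of_expand[OF u] by blast
    then show ?thesis using img by auto
  qed
qed

lemma linear_between_basis:
  assumes U: "subspace U" "subspace V" and u: "basis_of U n u" and v: "\<And>i. i < n \<Longrightarrow> v i \<in> V"
  obtains f where "linear_between U V f" "\<And>i. i < n \<Longrightarrow> f (u i) = v i"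
proof -
  define c where "c x = (SOME c. x = (\<Sum>i<n. c i *s u i))" for x
  have c: "x = (\<Sum>i<n. c x i *s u i)" if "x \<in> U" for x
    unfolding c_def by (rule someI_ex[OF basis_of_expand[OF u that]])
  have c_eq: "c x i = b i" if "x \<in> U" "x = (\<Sum>i<n. b i *s u i)" "i < n" for x b i
    using basis_of_unique[OF u _ that(3), of "c x" b] c[OF that(1)] that(2) by simp
  define f where "f x = (\<Sum>i<n. c x i *s v i)" for x
  have "f x \<in> V" for x unfolding f_def using v by (intro subspace_sum[OF U(2)] subspace_scale[OF U(2)]) auto
  moreover have "f (x + y) = f x + f y" if xy: "x \<in> U" "y \<in> U" for x y
  proof -
    have "x + y = (\<Sum>i<n. (c x i + c y i) *s u i)"
      using c[OF xy(1)] c[OF xy(2)] by (simp add: scale_left_distrib sum.distrib)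
    from c_eq[OF subspace_add[OF U(1) xy] this] show ?thesis
      by (simp add: f_def scale_left_distrib sum.distrib)
  qed
  moreover have "f (e *s x) = e *s f x" if x: "x \<in> U" for e x
  proof -
    have "e *s x = (\<Sum>i<n. (e * c x i) *s u i)"
      using arg_cong[OF c[OF x], of "\<lambda>y. e *s y"] by (simp add: scale_sum_right)
    from c_eq[OF subspace_scale[OF U(1) x] this] show ?thesis by (simp add: f_def scale_sum_right)
  qed
  ultimately have "linear_between U V f" by (simp add: linear_between_def)
  moreover have "f (u i) = v i" if i: "i < n" for i
  proof -
    have delta: "(\<Sum>j<n. (if j = i then 1 else 0) *s g j) = g i" for g :: "nat \<Rightarrow> 'v"
      using i by (simp add: if_distribR if_distrib[of "\<lambda>c. c *s _"] cong: if_cong)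
    have "c (u i) j = (if j = i then 1 else 0)" if "j < n" for j
      by (rule c_eq[OF basis_of_mem[OF u i] delta[symmetric] that])
    then show ?thesis unfolding f_def using delta[of v] by simp
  qed
  ultimately show ?thesis using that by blast
qed

end

lemma smult_single: "Defs.smult c (Poly_Mapping.single D 1) = Poly_Mapping.single D c"
  by (simp add: Defs.smult_def)

lemma sum_single_lookup:
  "(\<Sum>D\<in>Poly_Mapping.keys f. Poly_Mapping.single D (Poly_Mapping.lookup f D)) = f"
proof (rule poly_mapping_eqI)
  fix k
  have "(\<Sum>D\<in>Poly_Mapping.keys f. Poly_Mapping.lookup f D when D = k) = Poly_Mapping.lookup f k"
    by (cases "k \<in> Poly_Mapping.keys f") (auto simp: when_def in_keys_iff)
  then show "Poly_Mapping.lookup (\<Sum>D\<in>Poly_Mapping.keys f. Poly_Mapping.single D (Poly_Mapping.lookup f D)) k =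
      Poly_Mapping.lookup f k"
    by (simp add: lookup_sum lookup_single)
qed

lemma smult_zero: "Defs.smult 0 f = 0"
  by (rule poly_mapping_eqI) (simp add: Defs.smult_def Poly_Mapping.map.rep_eq when_def)

context fiber_functor
begin

lemma mor_expand:
  assumes f: "f \<in> hom w w'" and a: "a \<in> obj \<Phi> w"
  shows "mor \<Phi> w w' f a = (\<Sum>D\<in>Poly_Mapping.keys f. Poly_Mapping.lookup f D *s dmor w w' D a)"
proof -
  have hom_0: "0 \<in> hom w w'" by (simp add: hom_def)
  have hom_add: "g \<in> hom w w' \<Longrightarrow> h \<in> hom w w' \<Longrightarrow> g + h \<in> hom w w'" for g h
    using Poly_Mapping.keys_add[of g h] by (auto simp: hom_def)
  have "(\<Sum>D\<in>S. Poly_Mapping.single D (c D)) \<in> hom w w' \<and>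
      mor \<Phi> w w' (\<Sum>D\<in>S. Poly_Mapping.single D (c D)) a = (\<Sum>D\<in>S. c D *s dmor w w' D a)"
    if "finite S" "S \<subseteq> K w w'" for S and c :: "diagram \<Rightarrow> complex"
    using that
  proof (induction S rule: finite_induct)
    case empty
    \<comment> \<open>The zero morphism goes to zero because it is 0 times itself.\<close>
    then show ?case using mor_smult[OF hom_0 a, of 0] hom_0 by (simp add: smult_zero)
  next
    case (insert D S)
    then have D: "Poly_Mapping.single D e \<in> hom w w'" for e by (simp add: single_hom)
    have "mor \<Phi> w w' (Poly_Mapping.single D (c D)) a = c D *s dmor w w' D a"
      using mor_smult[OF D[of 1] a, of "c D"] by (simp add: smult_single)
    then show ?case using insert mor_add[OF D _ a] hom_add[OF D] by simp
  qed
  from this[of "Poly_Mapping.keys f" "Poly_Mapping.lookup f"] show ?thesis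
    using f by (simp add: hom_def sum_single_lookup)
qed

end

locale two_fiber_functors = vect_universe scale + A: fiber_functor scale d \<Phi> + B: fiber_functor scale d \<Psi>
  for scale :: "complex \<Rightarrow> 'v::ab_group_add \<Rightarrow> 'v" (infixr \<open>*s\<close> 75) and d \<Phi> \<Psi>
begin

text \<open>A monoidal natural isomorphism preserves both forms, hence carries dual bases to dual
  bases with the same matrix. One common matrix suffices, since by \<open>attached_class\<close>
  each side is the whole similarity class of it.\<close>

lemma naturally_equivalent_imp:
  assumes "naturally_equivalent \<Phi> \<Psi>"
  shows "attached_matrices \<Phi> = attached_matrices \<Psi>"
proof -
  from assms obtain \<theta> where
    H: "\<forall>w. linear_between (obj \<Phi> w) (obj \<Psi> w) (\<theta> w) \<and> bij_betw (\<theta> w) (obj \<Phi> w) (obj \<Psi> w)"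
      "\<forall>w w'. \<forall>f\<in>hom w w'. \<forall>a\<in>obj \<Phi> w. \<theta> w' (mor \<Phi> w w' f a) = mor \<Psi> w w' f (\<theta> w a)"
      "\<forall>w w'. \<forall>a\<in>obj \<Phi> w. \<forall>b\<in>obj \<Phi> w'. \<theta> (w @ w') (tens \<Phi> w w' a b) = tens \<Psi> w w' (\<theta> w a) (\<theta> w' b)"
    and one: "\<theta> [] (one \<Phi>) = one \<Psi>"
    unfolding naturally_equivalent_def by blast
  have lin: "linear_between (obj \<Phi> w) (obj \<Psi> w) (\<theta> w)" and bij: "bij_betw (\<theta> w) (obj \<Phi> w) (obj \<Psi> w)" for w
    using H(1) by simp_all
  have nat: "\<theta> w' (mor \<Phi> w w' f a) = mor \<Psi> w w' f (\<theta> w a)" if "f \<in> hom w w'" "a \<in> obj \<Phi> w" for w w' f a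
    using H(2) that by simp
  have tens: "\<theta> (w @ w') (tens \<Phi> w w' a b) = tens \<Psi> w w' (\<theta> w a) (\<theta> w' b)"
    if "a \<in> obj \<Phi> w" "b \<in> obj \<Phi> w'" for w w' a b
    using H(3) that by simp
  have form: "B.form x (\<theta> [x] a) (\<theta> [dual x] b) = A.form x a b" if ab: "a \<in> obj \<Phi> [x]" "b \<in> obj \<Phi> [dual x]" for x a b
  proof -
    have "B.form x (\<theta> [x] a) (\<theta> [dual x] b) *s one \<Psi> =
        B.dmor [x, dual x] [] {up_arc x 0} (tens \<Psi> [x] [dual x] (\<theta> [x] a) (\<theta> [dual x] b))"
      by (rule B.form_eq[symmetric]) (use linear_between_mem[OF lin] ab in auto)
    also have "\<dots> = \<theta> [] (A.dmor [x, dual x] [] {up_arc x 0} (tens \<Phi> [x] [dual x] a b))"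
      using nat[OF single_hom[OF K_up_arc] A.tens2_mem[OF ab], of 1] tens[OF ab] by simp
    also have "\<dots> = A.form x a b *s one \<Psi>"
      using linear_between_scale[OF lin A.one_mem] one by (simp add: A.form_eq[OF ab])
    finally show ?thesis by (metis B.scalar_of_scale)
  qed
  obtain n v w where vw: "A.dual_bases n v w" using A.dual_bases_exist by blast
  note mem = A.dual_bases_mem[OF vw]
  have "B.dual_bases n (\<lambda>i. \<theta> [X] (v i)) (\<lambda>j. \<theta> [X_star] (w j))"
    using vw basis_of_image[OF lin bij A.subspace_obj B.subspace_obj] form[of _ X] mem
    unfolding A.dual_bases_def B.dual_bases_def by (simp add: A.form_X B.form_X)
  moreover have "B.form_matrix n (\<lambda>i. \<theta> [X] (v i)) (\<lambda>j. \<theta> [X_star] (w j)) = A.form_matrix n v w"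
    using form[of _ X_star] mem unfolding A.form_matrix_def B.form_matrix_def
    by (intro eq_matI) (simp_all add: A.form_X_star B.form_X_star)
  ultimately show ?thesis using A.attached_class[OF vw] B.attached_class by metis
qed

text \<open>The tensor product along a word of two linear maps, one for each letter. It is a choice
  because only the universal property of \<open>tens\<close> is available; on the object itself the
  choice is unique.\<close>

fun extend :: "(letter \<Rightarrow> 'v \<Rightarrow> 'v) \<Rightarrow> word \<Rightarrow> 'v \<Rightarrow> 'v" where
  "extend \<theta> [] = (\<lambda>z. scalar_of \<Phi> z *s one \<Psi>)"
| "extend \<theta> (x # w) = (SOME L. linear_between (obj \<Phi> (x # w)) (obj \<Psi> (x # w)) L \<and>
     (\<forall>a\<in>obj \<Phi> [x]. \<forall>b\<in>obj \<Phi> w. L (tens \<Phi> [x] w a b) = tens \<Psi> [x] w (\<theta> x a) (extend \<theta> w b)))"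

context
  fixes \<theta> :: "letter \<Rightarrow> 'v \<Rightarrow> 'v"
  assumes lin1: "\<And>x. linear_between (obj \<Phi> [x]) (obj \<Psi> [x]) (\<theta> x)"
begin

lemma extend_one: "extend \<theta> [] (one \<Phi>) = one \<Psi>"
  using A.scalar_of_scale[of 1] by simp

lemma extend_cons_ex:
  assumes "linear_between (obj \<Phi> w) (obj \<Psi> w) (extend \<theta> w)"
  shows "linear_between (obj \<Phi> (x # w)) (obj \<Psi> (x # w)) (extend \<theta> (x # w)) \<and>
    (\<forall>a\<in>obj \<Phi> [x]. \<forall>b\<in>obj \<Phi> w. extend \<theta> (x # w) (tens \<Phi> [x] w a b) = tens \<Psi> [x] w (\<theta> x a) (extend \<theta> w b))"
proof -
  have tp: "is_tensor_product (obj \<Phi> [x]) (obj \<Phi> w) (obj \<Phi> (x # w)) (tens \<Phi> [x] w)"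
    using A.tens_tensor_product[of "[x]" w] by simp
  have "bilinear_between (obj \<Phi> [x]) (obj \<Phi> w) (obj \<Psi> (x # w)) (\<lambda>a b. tens \<Psi> [x] w (\<theta> x a) (extend \<theta> w b))"
    unfolding bilinear_between_def
  proof (intro conjI ballI)
    fix a assume "a \<in> obj \<Phi> [x]"
    then have "\<theta> x a \<in> obj \<Psi> [x]" by (rule linear_between_mem[OF lin1])
    then show "linear_between (obj \<Phi> w) (obj \<Psi> (x # w)) (\<lambda>b. tens \<Psi> [x] w (\<theta> x a) (extend \<theta> w b))"
      using linear_between_comp[OF assms B.tens_linear_right] by fastforce
  next
    fix b assume "b \<in> obj \<Phi> w"
    then have "extend \<theta> w b \<in> obj \<Psi> w" by (rule linear_between_mem[OF assms])
    then show "linear_between (obj \<Phi> [x]) (obj \<Psi> (x # w)) (\<lambda>a. tens \<Psi> [x] w (\<theta> x a) (extend \<theta> w b))"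
      using linear_between_comp[OF lin1 B.tens_linear_left] by fastforce
  qed
  from tensor_lift[OF tp B.subspace_obj this]
  have "\<exists>L. linear_between (obj \<Phi> (x # w)) (obj \<Psi> (x # w)) L \<and>
      (\<forall>a\<in>obj \<Phi> [x]. \<forall>b\<in>obj \<Phi> w. L (tens \<Phi> [x] w a b) = tens \<Psi> [x] w (\<theta> x a) (extend \<theta> w b))"
    by metis
  then show ?thesis unfolding extend.simps(2) by (rule someI_ex)
qed

lemma extend_linear: "linear_between (obj \<Phi> w) (obj \<Psi> w) (extend \<theta> w)"
proof (induction w)
  case Nil
  show ?case unfolding linear_between_def
    using A.scalar_of_linear subspace_scale[OF B.subspace_obj B.one_mem] by (auto simp: scale_left_distrib)
next
  case (Cons x w)
  then show ?case using extend_cons_ex by blast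
qed

lemma extend_mem: "a \<in> obj \<Phi> w \<Longrightarrow> extend \<theta> w a \<in> obj \<Psi> w"
  by (rule linear_between_mem[OF extend_linear])

lemma extend_cons:
  "a \<in> obj \<Phi> [x] \<Longrightarrow> b \<in> obj \<Phi> w \<Longrightarrow> extend \<theta> (x # w) (tens \<Phi> [x] w a b) = tens \<Psi> [x] w (\<theta> x a) (extend \<theta> w b)"
  using extend_cons_ex[OF extend_linear] by blast

lemma extend_single: "a \<in> obj \<Phi> [x] \<Longrightarrow> extend \<theta> [x] a = \<theta> x a"
  using extend_cons[of a x "one \<Phi>" "[]"] A.one_mem A.tens_one(2)[of a "[x]"] extend_one
    B.tens_one(2)[OF linear_between_mem[OF lin1]] by (simp del: extend.simps)

text \<open>The recursion splits off one letter at a time. For a general splitting the first letter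
  is moved out by associativity, and it is enough to test on pure tensors.\<close>

lemma extend_append:
  assumes "a \<in> obj \<Phi> w" "b \<in> obj \<Phi> w'"
  shows "extend \<theta> (w @ w') (tens \<Phi> w w' a b) = tens \<Psi> w w' (extend \<theta> w a) (extend \<theta> w' b)"
  using assms(1)
proof (induction w arbitrary: a)
  case Nil
  then show ?case
    using A.tens_scalar_left[OF assms(2), of "scalar_of \<Phi> a"] A.scalar_of_eq[OF Nil]
      B.tens_scalar_left[OF extend_mem[OF assms(2)], of "scalar_of \<Phi> a"]
      linear_between_scale[OF extend_linear assms(2)] by simp
next
  case (Cons x w)
  have tp: "is_tensor_product (obj \<Phi> [x]) (obj \<Phi> w) (obj \<Phi> (x # w)) (tens \<Phi> [x] w)"
    using A.tens_tensor_product[of "[x]" w] by simp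
  note b = assms(2) and b' = extend_mem[OF assms(2)]
  show ?case
  proof (rule tensor_ext[OF tp B.subspace_obj _ _ _ Cons.prems, of "(x # w) @ w'"])
    show "linear_between (obj \<Phi> (x # w)) (obj \<Psi> ((x # w) @ w')) (\<lambda>a. extend \<theta> ((x # w) @ w') (tens \<Phi> (x # w) w' a b))"
      by (rule linear_between_comp[OF A.tens_linear_left[OF b] extend_linear])
    show "linear_between (obj \<Phi> (x # w)) (obj \<Psi> ((x # w) @ w')) (\<lambda>a. tens \<Psi> (x # w) w' (extend \<theta> (x # w) a) (extend \<theta> w' b))"
      by (rule linear_between_comp[OF extend_linear B.tens_linear_left[OF b']])
    fix a1 a2 assume a: "a1 \<in> obj \<Phi> [x]" "a2 \<in> obj \<Phi> w"
    have "extend \<theta> ((x # w) @ w') (tens \<Phi> (x # w) w' (tens \<Phi> [x] w a1 a2) b) =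
        extend \<theta> (x # w @ w') (tens \<Phi> [x] (w @ w') a1 (tens \<Phi> w w' a2 b))"
      using A.tens_assoc[OF a b] by simp
    also have "\<dots> = tens \<Psi> [x] (w @ w') (\<theta> x a1) (tens \<Psi> w w' (extend \<theta> w a2) (extend \<theta> w' b))"
      using extend_cons[OF a(1) A.tens_mem[OF a(2) b]] Cons.IH[OF a(2)] by (simp del: extend.simps)
    also have "\<dots> = tens \<Psi> (x # w) w' (extend \<theta> (x # w) (tens \<Phi> [x] w a1 a2)) (extend \<theta> w' b)"
      using B.tens_assoc[OF linear_between_mem[OF lin1 a(1)] extend_mem[OF a(2)] b'] extend_cons[OF a]
      by (simp del: extend.simps)
    finally show "extend \<theta> ((x # w) @ w') (tens \<Phi> (x # w) w' (tens \<Phi> [x] w a1 a2) b) =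
      tens \<Psi> (x # w) w' (extend \<theta> (x # w) (tens \<Phi> [x] w a1 a2)) (extend \<theta> w' b)" .
  qed
qed

definition natural :: "word \<Rightarrow> word \<Rightarrow> diagram \<Rightarrow> bool" where
  "natural w w' D \<longleftrightarrow> (\<forall>a\<in>obj \<Phi> w. extend \<theta> w' (A.dmor w w' D a) = B.dmor w w' D (extend \<theta> w a))"

lemma natural_id: "natural w w (id_diagram w)"
  unfolding natural_def using A.dmor_id B.dmor_id extend_mem by simp

text \<open>Peeling off an elementary diagram creates no loop, so the composite carries no power of
  \<open>d\<close> and its naturality can be read off from the factors.\<close>

lemma natural_vconcat:
  assumes "D \<in> K w w'" "D' \<in> K w' w''" "vconcat D D' \<in> K w w''" "loops D D' = 0"
    and nat: "natural w w' D" "natural w' w'' D'"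
  shows "natural w w'' (vconcat D D')"
  unfolding natural_def
proof
  fix a assume a: "a \<in> obj \<Phi> w"
  have "extend \<theta> w'' (A.dmor w w'' (vconcat D D') a) = extend \<theta> w'' (A.dmor w' w'' D' (A.dmor w w' D a))"
    using A.dmor_vconcat[OF assms(1-3) a] assms(4) by simp
  also have "\<dots> = B.dmor w' w'' D' (B.dmor w w' D (extend \<theta> w a))"
    using nat a A.dmor_mem[OF assms(1) a] unfolding natural_def by simp
  also have "\<dots> = B.dmor w w'' (vconcat D D') (extend \<theta> w a)"
    using B.dmor_vconcat[OF assms(1-3) extend_mem[OF a]] assms(4) by simp
  finally show "extend \<theta> w'' (A.dmor w w'' (vconcat D D') a) = B.dmor w w'' (vconcat D D') (extend \<theta> w a)" .
qed

lemma natural_hconcat: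
  assumes D: "D \<in> K w1 w1'" "D' \<in> K w2 w2'" and nat: "natural w1 w1' D" "natural w2 w2' D'"
  shows "natural (w1 @ w2) (w1' @ w2') (hconcat (length w1) (length w1') D D')"
  unfolding natural_def
proof
  let ?D = "hconcat (length w1) (length w1') D D'"
  have KD: "?D \<in> K (w1 @ w2) (w1' @ w2')" by (rule K_hconcat[OF D])
  fix a assume a: "a \<in> obj \<Phi> (w1 @ w2)"
  show "extend \<theta> (w1' @ w2') (A.dmor (w1 @ w2) (w1' @ w2') ?D a) =
      B.dmor (w1 @ w2) (w1' @ w2') ?D (extend \<theta> (w1 @ w2) a)"
  proof (rule tensor_ext[OF A.tens_tensor_product B.subspace_obj _ _ _ a, of "w1' @ w2'"])
    show "linear_between (obj \<Phi> (w1 @ w2)) (obj \<Psi> (w1' @ w2'))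
        (\<lambda>a. extend \<theta> (w1' @ w2') (A.dmor (w1 @ w2) (w1' @ w2') ?D a))"
      by (rule linear_between_comp[OF A.dmor_linear[OF KD] extend_linear])
    show "linear_between (obj \<Phi> (w1 @ w2)) (obj \<Psi> (w1' @ w2'))
        (\<lambda>a. B.dmor (w1 @ w2) (w1' @ w2') ?D (extend \<theta> (w1 @ w2) a))"
      by (rule linear_between_comp[OF extend_linear B.dmor_linear[OF KD]])
    fix x y assume xy: "x \<in> obj \<Phi> w1" "y \<in> obj \<Phi> w2"
    show "extend \<theta> (w1' @ w2') (A.dmor (w1 @ w2) (w1' @ w2') ?D (tens \<Phi> w1 w2 x y)) =
        B.dmor (w1 @ w2) (w1' @ w2') ?D (extend \<theta> (w1 @ w2) (tens \<Phi> w1 w2 x y))"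
      using nat xy A.dmor_hconcat[OF D xy] B.dmor_hconcat[OF D extend_mem[OF xy(1)] extend_mem[OF xy(2)]]
        extend_append[OF xy] extend_append[OF A.dmor_mem[OF D(1) xy(1)] A.dmor_mem[OF D(2) xy(2)]]
      unfolding natural_def by simp
  qed
qed

lemma natural_all:
  assumes arcs: "\<And>x. natural [x, dual x] [] {up_arc x 0}" "\<And>x. natural [] [x, dual x] {lo_arc x 0}"
    and D: "D \<in> K w w'"
  shows "natural w w' D"
  using D
proof (induction "length w + length w'" arbitrary: w w' D rule: less_induct)
  case less
  have nat_cap: "natural (u @ [x, dual x] @ v) (u @ v) (cap u x v)" for u x v
    using natural_hconcat[OF K_id[of u] K_hconcat[OF K_up_arc[of x] K_id[of v]] natural_id
        natural_hconcat[OF K_up_arc[of x] K_id[of v] arcs(1) natural_id]]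
    by (simp add: cap_def numeral_2_eq_2)
  have nat_cup: "natural (u @ v) (u @ [x, dual x] @ v) (cup u x v)" for u x v
    using natural_hconcat[OF K_id[of u] K_hconcat[OF K_lo_arc[of x] K_id[of v]] natural_id
        natural_hconcat[OF K_lo_arc[of x] K_id[of v] arcs(2) natural_id]]
    by (simp add: cup_def numeral_2_eq_2)
  from less.prems show ?case
  proof (cases rule: K_cases)
    case id
    then show ?thesis using natural_id by simp
  next
    case (cap u x v D1)
    have "natural (u @ v) w' D1" by (rule less.hyps[OF _ cap(2)]) (simp add: cap(1))
    then show ?thesis
      using natural_vconcat[OF K_cap cap(2) _ loops_cap[OF K_matching[OF cap(2)]] nat_cap] less.prems
      unfolding cap(1,3) by blast
  next
    case (cup u x v D1)
    have "natural w (u @ v) D1" by (rule less.hyps[OF _ cup(2)]) (simp add: cup(1))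
    then show ?thesis
      using natural_vconcat[OF cup(2) K_cup _ loops_cup[OF K_matching[OF cup(2)]] _ nat_cup] less.prems
      unfolding cup(1,3) by blast
  qed
qed

lemma natural_hom:
  assumes "\<And>w w' D. D \<in> K w w' \<Longrightarrow> natural w w' D" "f \<in> hom w w'" "a \<in> obj \<Phi> w"
  shows "extend \<theta> w' (mor \<Phi> w w' f a) = mor \<Psi> w w' f (extend \<theta> w a)"
proof -
  have K: "D \<in> K w w'" if "D \<in> Poly_Mapping.keys f" for D using assms(2) that by (auto simp: hom_def)
  have "extend \<theta> w' (mor \<Phi> w w' f a) =
      (\<Sum>D\<in>Poly_Mapping.keys f. Poly_Mapping.lookup f D *s extend \<theta> w' (A.dmor w w' D a))"
    unfolding A.mor_expand[OF assms(2,3)]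
    by (rule linear_between_lincomb[OF extend_linear A.subspace_obj]) (use A.dmor_mem[OF K assms(3)] in auto)
  also have "\<dots> = mor \<Psi> w w' f (extend \<theta> w a)"
    unfolding B.mor_expand[OF assms(2) extend_mem[OF assms(3)]]
    using assms(1)[OF K] assms(3) by (intro sum.cong) (simp_all add: natural_def)
  finally show ?thesis .
qed

text \<open>On a pure tensor the upper arc is the form itself, so naturality amounts to preservation
  of the form. For the lower arc it is enough to test on the unit vector, which gives the
  coevaluation.\<close>

lemma natural_up_arc:
  assumes "\<And>a b. a \<in> obj \<Phi> [x] \<Longrightarrow> b \<in> obj \<Phi> [dual x] \<Longrightarrow> B.form x (\<theta> x a) (\<theta> (dual x) b) = A.form x a b"
  shows "natural [x, dual x] [] {up_arc x 0}"
  unfolding natural_def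
proof
  fix a assume a: "a \<in> obj \<Phi> [x, dual x]"
  have tp: "is_tensor_product (obj \<Phi> [x]) (obj \<Phi> [dual x]) (obj \<Phi> [x, dual x]) (tens \<Phi> [x] [dual x])"
    using A.tens_tensor_product[of "[x]" "[dual x]"] by simp
  show "extend \<theta> [] (A.dmor [x, dual x] [] {up_arc x 0} a) = B.dmor [x, dual x] [] {up_arc x 0} (extend \<theta> [x, dual x] a)"
  proof (rule tensor_ext[OF tp B.subspace_obj _ _ _ a, of "[]"])
    show "linear_between (obj \<Phi> [x, dual x]) (obj \<Psi> []) (\<lambda>a. extend \<theta> [] (A.dmor [x, dual x] [] {up_arc x 0} a))"
      by (rule linear_between_comp[OF A.dmor_linear[OF K_up_arc] extend_linear])
    show "linear_between (obj \<Phi> [x, dual x]) (obj \<Psi> []) (\<lambda>a. B.dmor [x, dual x] [] {up_arc x 0} (extend \<theta> [x, dual x] a))"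
      by (rule linear_between_comp[OF extend_linear B.dmor_linear[OF K_up_arc]])
    fix p q assume pq: "p \<in> obj \<Phi> [x]" "q \<in> obj \<Phi> [dual x]"
    have "extend \<theta> [x, dual x] (tens \<Phi> [x] [dual x] p q) = tens \<Psi> [x] [dual x] (\<theta> x p) (\<theta> (dual x) q)"
      using extend_append[OF pq] extend_single[OF pq(1)] extend_single[OF pq(2)] by (simp del: extend.simps)
    then show "extend \<theta> [] (A.dmor [x, dual x] [] {up_arc x 0} (tens \<Phi> [x] [dual x] p q)) =
        B.dmor [x, dual x] [] {up_arc x 0} (extend \<theta> [x, dual x] (tens \<Phi> [x] [dual x] p q))"
      using assms[OF pq] A.form_eq[OF pq] B.form_eq[OF linear_between_mem[OF lin1 pq(1)] linear_between_mem[OF lin1 pq(2)]]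
        A.scalar_of_scale by (simp del: extend.simps(2))
  qed
qed

lemma natural_lo_arc:
  assumes "extend \<theta> [x, dual x] (A.coev x) = B.coev x"
  shows "natural [] [x, dual x] {lo_arc x 0}"
  unfolding natural_def
proof
  fix a assume a: "a \<in> obj \<Phi> []"
  define c where "c = scalar_of \<Phi> a"
  have a_eq: "a = c *s one \<Phi>" using A.scalar_of_eq[OF a] by (simp add: c_def)
  have "extend \<theta> [x, dual x] (A.dmor [] [x, dual x] {lo_arc x 0} a) = c *s extend \<theta> [x, dual x] (A.coev x)"
    unfolding a_eq A.coev_def
    using linear_between_scale[OF A.dmor_linear[OF K_lo_arc[of x]] A.one_mem]
      linear_between_scale[OF extend_linear A.coev_mem[of x], of c] by (simp del: extend.simps add: A.coev_def)
  also have "\<dots> = B.dmor [] [x, dual x] {lo_arc x 0} (extend \<theta> [] a)"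
    unfolding assms B.coev_def a_eq
    using linear_between_scale[OF B.dmor_linear[OF K_lo_arc[of x]] B.one_mem] A.scalar_of_scale by simp
  finally show "extend \<theta> [x, dual x] (A.dmor [] [x, dual x] {lo_arc x 0} a) =
    B.dmor [] [x, dual x] {lo_arc x 0} (extend \<theta> [] a)" .
qed

lemma extend_tens2:
  "a \<in> obj \<Phi> [x] \<Longrightarrow> b \<in> obj \<Phi> [y] \<Longrightarrow> extend \<theta> [x, y] (tens \<Phi> [x] [y] a b) = tens \<Psi> [x] [y] (\<theta> x a) (\<theta> y b)"
  using extend_append[of a "[x]" b "[y]"] extend_single by (simp del: extend.simps)

end

end

text \<open>The extension in the opposite direction belongs to the same locale with the two functors
  exchanged, hence the qualified constant.\<close>

lemma (in two_fiber_functors) extend_inverse: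
  assumes \<theta>: "\<And>x. linear_between (obj \<Phi> [x]) (obj \<Psi> [x]) (\<theta> x)"
    and \<eta>: "\<And>x. linear_between (obj \<Psi> [x]) (obj \<Phi> [x]) (\<eta> x)"
    and inv: "\<And>x a. a \<in> obj \<Phi> [x] \<Longrightarrow> \<eta> x (\<theta> x a) = a" and a: "a \<in> obj \<Phi> w"
  shows "two_fiber_functors.extend scale \<Psi> \<Phi> \<eta> w (extend \<theta> w a) = a"
  using a
proof (induction w arbitrary: a)
  case Nil
  interpret inverse: two_fiber_functors scale d \<Psi> \<Phi> ..
  show ?case using B.scalar_of_scale A.scalar_of_eq[OF Nil] by simp
next
  case (Cons x w)
  interpret inverse: two_fiber_functors scale d \<Psi> \<Phi> ..
  have tp: "is_tensor_product (obj \<Phi> [x]) (obj \<Phi> w) (obj \<Phi> (x # w)) (tens \<Phi> [x] w)"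
    using A.tens_tensor_product[of "[x]" w] by simp
  show ?case
  proof (rule tensor_ext[OF tp A.subspace_obj _ _ _ Cons.prems, of "x # w"])
    show "linear_between (obj \<Phi> (x # w)) (obj \<Phi> (x # w)) (\<lambda>a. inverse.extend \<eta> (x # w) (extend \<theta> (x # w) a))"
      by (rule linear_between_comp[OF extend_linear[of \<theta>, OF \<theta>] inverse.extend_linear[of \<eta>, OF \<eta>]])
    show "linear_between (obj \<Phi> (x # w)) (obj \<Phi> (x # w)) (\<lambda>a. a)" by (simp add: linear_between_def)
    fix p q assume pq: "p \<in> obj \<Phi> [x]" "q \<in> obj \<Phi> w"
    show "inverse.extend \<eta> (x # w) (extend \<theta> (x # w) (tens \<Phi> [x] w p q)) = tens \<Phi> [x] w p q"
      using extend_cons[of \<theta>, OF \<theta> pq]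
        inverse.extend_cons[of \<eta>, OF \<eta> linear_between_mem[OF \<theta> pq(1)] extend_mem[of \<theta>, OF \<theta> pq(2)]]
        Cons.IH[OF pq(2)] inv[OF pq(1)] by (simp del: extend.simps inverse.extend.simps)
  qed
qed

context two_fiber_functors
begin

lemma attached_eq_imp:
  assumes eq: "attached_matrices \<Phi> = attached_matrices \<Psi>"
  shows "naturally_equivalent \<Phi> \<Psi>"
proof -
  interpret inverse: two_fiber_functors scale d \<Psi> \<Phi> ..
  obtain n v w where vw: "A.dual_bases n v w" using A.dual_bases_exist by blast
  define M where "M = A.form_matrix n v w"
  have "M \<in> attached_matrices \<Phi>" using vw unfolding M_def A.attached_iff by blast
  \<comment> \<open>Equality of the full sets of attached matrices provides dual bases of the second
    functor with the very matrix \<open>M\<close>, not merely a similar one.\<close>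
  then obtain n' v' w' where vw': "B.dual_bases n' v' w'" and M': "M = B.form_matrix n' v' w'"
    unfolding eq B.attached_iff by blast
  have n': "n' = n"
    using carrier_matD(1)[OF A.form_matrix_carrier[of n v w]] carrier_matD(1)[OF B.form_matrix_carrier[of n' v' w']]
      M' M_def by simp
  note vw' = vw'[unfolded n'] and M' = M'[unfolded n']
  note mem = A.dual_bases_mem[OF vw] and mem' = B.dual_bases_mem[OF vw']
  define u u' where "u x = (if x = X then v else w)" and "u' x = (if x = X then v' else w')" for x
  have bas: "basis_of (obj \<Phi> [x]) n (u x)" "basis_of (obj \<Psi> [x]) n (u' x)" for x
    using vw vw' unfolding A.dual_bases_def B.dual_bases_def u_def u'_def by (cases x; simp)+
  have "\<forall>x. \<exists>f. linear_between (obj \<Phi> [x]) (obj \<Psi> [x]) f \<and> (\<forall>i<n. f (u x i) = u' x i)"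
  proof
    fix x
    show "\<exists>f. linear_between (obj \<Phi> [x]) (obj \<Psi> [x]) f \<and> (\<forall>i<n. f (u x i) = u' x i)"
      by (rule linear_between_basis[OF A.subspace_obj B.subspace_obj bas(1)[of x] basis_of_mem[OF bas(2)[of x]]]) blast+
  qed
  then obtain \<theta> where \<theta>: "\<And>x. linear_between (obj \<Phi> [x]) (obj \<Psi> [x]) (\<theta> x)"
    and \<theta>_u: "\<And>x i. i < n \<Longrightarrow> \<theta> x (u x i) = u' x i" by metis
  have "\<forall>x. \<exists>f. linear_between (obj \<Psi> [x]) (obj \<Phi> [x]) f \<and> (\<forall>i<n. f (u' x i) = u x i)"
  proof
    fix x
    show "\<exists>f. linear_between (obj \<Psi> [x]) (obj \<Phi> [x]) f \<and> (\<forall>i<n. f (u' x i) = u x i)"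
      by (rule linear_between_basis[OF B.subspace_obj A.subspace_obj bas(2)[of x] basis_of_mem[OF bas(1)[of x]]]) blast+
  qed
  then obtain \<eta> where \<eta>: "\<And>x. linear_between (obj \<Psi> [x]) (obj \<Phi> [x]) (\<eta> x)"
    and \<eta>_u: "\<And>x i. i < n \<Longrightarrow> \<eta> x (u' x i) = u x i" by metis
  have \<theta>_sum: "\<theta> x (\<Sum>i<n. c i *s u x i) = (\<Sum>i<n. c i *s u' x i)" for x c
    using linear_between_lincomb[OF \<theta> A.subspace_obj, of "{..<n}" "u x" x c] basis_of_mem[OF bas(1)] \<theta>_u by simp
  have \<eta>_sum: "\<eta> x (\<Sum>i<n. c i *s u' x i) = (\<Sum>i<n. c i *s u x i)" for x c
    using linear_between_lincomb[OF \<eta> B.subspace_obj, of "{..<n}" "u' x" x c] basis_of_mem[OF bas(2)] \<eta>_u by simp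
  have \<eta>\<theta>: "\<eta> x (\<theta> x a) = a" if "a \<in> obj \<Phi> [x]" for x a
    using basis_of_expand[OF bas(1) that] \<theta>_sum \<eta>_sum by metis
  have \<theta>\<eta>: "\<theta> x (\<eta> x a) = a" if "a \<in> obj \<Psi> [x]" for x a
    using basis_of_expand[OF bas(2) that] \<theta>_sum \<eta>_sum by metis
  have F_eq: "F_form \<Psi> (w' j) (v' i) = F_form \<Phi> (w j) (v i)" if "i < n" "j < n" for i j
  proof -
    have "M $$ (j, i) = F_form \<Phi> (w j) (v i)" using that by (simp add: M_def A.form_matrix_def)
    moreover have "M $$ (j, i) = F_form \<Psi> (w' j) (v' i)" using that unfolding M' by (simp add: B.form_matrix_def)
    ultimately show ?thesis by simp
  qed
  have form: "B.form x (\<theta> x a) (\<theta> (dual x) b) = A.form x a b" if ab: "a \<in> obj \<Phi> [x]" "b \<in> obj \<Phi> [dual x]" for x a b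
  proof -
    obtain c e where ce: "a = (\<Sum>i<n. c i *s u x i)" "b = (\<Sum>i<n. e i *s u (dual x) i)"
      using basis_of_expand[OF bas(1)] ab by metis
    show ?thesis
    proof (cases x)
      case X
      then show ?thesis unfolding ce \<theta>_sum
        using A.form_E_sum[OF vw, of c e] B.form_E_sum[OF vw', of c e] by (simp add: u_def u'_def A.form_X B.form_X)
    next
      case X_star
      then show ?thesis unfolding ce \<theta>_sum
        using A.form_F_sum[of n w v c e] B.form_F_sum[of n w' v' c e] mem mem' F_eq
        by (simp add: u_def u'_def A.form_X_star B.form_X_star)
    qed
  qed
  have coev: "extend \<theta> [x, dual x] (A.coev x) = B.coev x" for x
  proof (cases x)
    case X_star
    have "extend \<theta> [X_star, X] (A.coev X_star) = (\<Sum>j<n. extend \<theta> [X_star, X] (tens \<Phi> [X_star] [X] (w j) (v j)))"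
      unfolding A.coev_X_star[OF vw]
      by (rule linear_between_sum[OF extend_linear[of \<theta>, OF \<theta>] A.subspace_obj]) (use A.tens2_mem mem in auto)
    also have "\<dots> = B.coev X_star"
      unfolding B.coev_X_star[OF vw']
      using extend_tens2[of \<theta>, OF \<theta>] mem \<theta>_u[of _ X] \<theta>_u[of _ X_star]
      by (intro sum.cong) (simp_all del: extend.simps add: u_def u'_def)
    finally show ?thesis using X_star by (simp del: extend.simps)
  next
    case X
    obtain C where C: "C \<in> carrier_mat n n" "C * M = 1\<^sub>m n"
      "A.coev X = (\<Sum>i<n. tens \<Phi> [X] [X_star] (v i) (\<Sum>j<n. C $$ (i, j) *s w j))"
      using A.coev_X[OF vw] unfolding M_def by blast
    obtain C' where C': "C' \<in> carrier_mat n n" "C' * M = 1\<^sub>m n"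
      "B.coev X = (\<Sum>i<n. tens \<Psi> [X] [X_star] (v' i) (\<Sum>j<n. C' $$ (i, j) *s w' j))"
      using B.coev_X[OF vw'] unfolding M' by blast
    have M: "M \<in> carrier_mat n n" by (simp add: M_def)
    \<comment> \<open>The coefficients of \<open>coev X\<close> are the inverse of \<open>M\<close>
      for both functors, and inverses are unique.\<close>
    have "M * C' = 1\<^sub>m n" by (rule mat_mult_left_right_inverse[OF C'(1) M C'(2)])
    then have "C' = C" using assoc_mult_mat[OF C(1) M C'(1)] C C' by simp
    have w_mem: "(\<Sum>j<n. C $$ (i, j) *s w j) \<in> obj \<Phi> [X_star]" for i
      using mem by (intro subspace_sum[OF A.subspace_obj] subspace_scale[OF A.subspace_obj]) auto
    have "extend \<theta> [X, X_star] (A.coev X) =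
        (\<Sum>i<n. extend \<theta> [X, X_star] (tens \<Phi> [X] [X_star] (v i) (\<Sum>j<n. C $$ (i, j) *s w j)))"
      unfolding C(3)
      by (rule linear_between_sum[OF extend_linear[of \<theta>, OF \<theta>] A.subspace_obj]) (use A.tens2_mem mem w_mem in auto)
    also have "\<dots> = B.coev X"
      unfolding C'(3) \<open>C' = C\<close>
      using extend_tens2[of \<theta>, OF \<theta>] mem w_mem \<theta>_u[of _ X] \<theta>_sum[of X_star]
      by (intro sum.cong) (simp_all del: extend.simps add: u_def u'_def)
    finally show ?thesis using X by (simp del: extend.simps)
  qed
  have nat: "natural \<theta> w w' D" if "D \<in> K w w'" for w w' D
    by (rule natural_all[of \<theta>, OF \<theta> natural_up_arc[of \<theta>, OF \<theta> form] natural_lo_arc[of \<theta>, OF \<theta> coev] that])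
  have bij: "bij_betw (extend \<theta> w) (obj \<Phi> w) (obj \<Psi> w)" for w
  proof (rule bij_betw_byWitness[where f' = "inverse.extend \<eta> w"])
    show "\<forall>a\<in>obj \<Phi> w. inverse.extend \<eta> w (extend \<theta> w a) = a"
      using extend_inverse[of \<theta> \<eta>, OF \<theta> \<eta> \<eta>\<theta>] by blast
    show "\<forall>a\<in>obj \<Psi> w. extend \<theta> w (inverse.extend \<eta> w a) = a"
      using inverse.extend_inverse[of \<eta> \<theta>, OF \<eta> \<theta> \<theta>\<eta>] by blast
    show "extend \<theta> w ` obj \<Phi> w \<subseteq> obj \<Psi> w" using extend_mem[of \<theta>, OF \<theta>] by blast
    show "inverse.extend \<eta> w ` obj \<Psi> w \<subseteq> obj \<Phi> w" using inverse.extend_mem[of \<eta>, OF \<eta>] by blast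
  qed
  show ?thesis
    unfolding naturally_equivalent_def
    using extend_linear[of \<theta>, OF \<theta>] bij natural_hom[of \<theta>, OF \<theta> nat] extend_append[of \<theta>, OF \<theta>]
      extend_one[of \<theta>, OF \<theta>]
    by (intro exI[of _ "extend \<theta>"]) (simp del: extend.simps)
qed

end

subsection \<open>The fiber functor of a matrix\<close>

text \<open>The vector \<open>e I\<close> plays the role of the pure tensor of basis vectors with
  index list \<open>I\<close>. Lists of different lengths give independent vectors, so all tensor
  powers sit side by side in the universe, and the empty list gives the unit.\<close>

locale matrix_functor = vect_universe scale + inverse_pair N B C d
  for scale :: "complex \<Rightarrow> 'v::ab_group_add \<Rightarrow> 'v" (infixr \<open>*s\<close> 75) and N B C d +
  fixes e :: "nat list \<Rightarrow> 'v"
  assumes inj_e: "inj e" and independent_e: "independent (range e)"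
begin

definition coord :: "'v \<Rightarrow> nat list \<Rightarrow> complex" where
  "coord a I = representation (range e) a (e I)"

definition power_space :: "nat \<Rightarrow> 'v set" where
  "power_space k = span (e ` idx k)"

text \<open>The linear map on the power of order \<open>k\<close> with value \<open>g I\<close> at
  \<open>e I\<close>. All morphisms and the tensor map are built from it.\<close>

definition lin :: "nat \<Rightarrow> (nat list \<Rightarrow> 'v) \<Rightarrow> 'v \<Rightarrow> 'v" where
  "lin k g a = (\<Sum>I\<in>idx k. coord a I *s g I)"

lemma subspace_power_space: "subspace (power_space k)"
  by (simp add: power_space_def subspace_span)

lemma e_mem: "I \<in> idx k \<Longrightarrow> e I \<in> power_space k"
  unfolding power_space_def by (intro span_base imageI)

lemma power_space_range: "a \<in> power_space k \<Longrightarrow> a \<in> span (range e)"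
  unfolding power_space_def using span_mono[of "e ` idx k" "range e"] by blast

lemma coord_e: "coord (e I) J = (if I = J then 1 else 0)"
  unfolding coord_def using representation_basis[OF independent_e, of "e I"] inj_e by (auto simp: inj_eq)

lemma coord_add: "a \<in> power_space k \<Longrightarrow> b \<in> power_space k \<Longrightarrow> coord (a + b) I = coord a I + coord b I"
  unfolding coord_def by (simp add: representation_add[OF independent_e] power_space_range)

lemma coord_scale: "a \<in> power_space k \<Longrightarrow> coord (c *s a) I = c * coord a I"
  unfolding coord_def by (simp add: representation_scale[OF independent_e] power_space_range)

lemma lin_e: "I \<in> idx k \<Longrightarrow> lin k g (e I) = g I"
  by (simp add: lin_def coord_e if_distribR if_distrib[of "\<lambda>c. c *s _"] cong: if_cong)

lemma lin_linear:
  assumes "subspace Z" "\<And>I. I \<in> idx k \<Longrightarrow> g I \<in> Z"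
  shows "linear_between (power_space k) Z (lin k g)"
  unfolding linear_between_def lin_def
  using assms by (auto intro!: subspace_sum subspace_scale simp: coord_add coord_scale scale_left_distrib sum.distrib scale_sum_right)

lemma lin_e_eq: "a \<in> power_space k \<Longrightarrow> lin k e a = a"
proof -
  assume "a \<in> power_space k"
  then have "a \<in> power_space k \<and> lin k e a = a"
    unfolding power_space_def
  proof (rule span_induct)
    have l: "linear_between (power_space k) (power_space k) (lin k e)"
      by (rule lin_linear[OF subspace_power_space e_mem])
    show "subspace {a. a \<in> span (e ` idx k) \<and> lin k e a = a}"
      unfolding power_space_def[symmetric] using subspace_power_space[of k] l
      by (auto simp: subspace_def linear_between_def intro: linear_between_0[OF l subspace_power_space])
    show "x \<in> span (e ` idx k) \<and> lin k e x = x" if "x \<in> e ` idx k" for x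
      using that lin_e e_mem unfolding power_space_def by auto
  qed
  then show ?thesis ..
qed

lemma power_space_ext:
  assumes f: "linear_between (power_space k) Z f" and g: "linear_between (power_space k) Z g"
    and eq: "\<And>I. I \<in> idx k \<Longrightarrow> f (e I) = g (e I)" and a: "a \<in> power_space k"
  shows "f a = g a"
proof -
  have "f (lin k e a) = (\<Sum>I\<in>idx k. coord a I *s f (e I))"
    unfolding lin_def by (rule linear_between_lincomb[OF f subspace_power_space]) (simp_all add: e_mem)
  also have "\<dots> = (\<Sum>I\<in>idx k. coord a I *s g (e I))" by (rule sum.cong) (simp_all add: eq)
  also have "\<dots> = g (lin k e a)"
    unfolding lin_def by (rule linear_between_lincomb[OF g subspace_power_space, symmetric]) (simp_all add: e_mem)
  finally show ?thesis by (simp add: lin_e_eq[OF a])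
qed

lemma idx_append: "I \<in> idx k \<Longrightarrow> J \<in> idx l \<Longrightarrow> I @ J \<in> idx (k + l)"
  by (auto simp: idx_def)

lemma idx_split: "M \<in> idx (k + l) \<Longrightarrow> take k M \<in> idx k \<and> drop k M \<in> idx l"
  using set_take_subset[of k M] set_drop_subset[of k M] by (auto simp: idx_def)

lemma sum_idx_append:
  fixes g :: "nat list \<Rightarrow> 'v"
  shows "(\<Sum>K\<in>idx (k + l). g K) = (\<Sum>I\<in>idx k. \<Sum>J\<in>idx l. g (I @ J))"
proof -
  have "(\<Sum>I\<in>idx k. \<Sum>J\<in>idx l. g (I @ J)) = (\<Sum>(I, J)\<in>idx k \<times> idx l. g (I @ J))"
    by (simp add: sum.cartesian_product)
  also have "\<dots> = (\<Sum>K\<in>idx (k + l). g K)"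
  proof (rule sum.reindex_bij_witness[where j = "\<lambda>(I, J). I @ J" and i = "\<lambda>K. (take k K, drop k K)"])
    fix p assume "p \<in> idx k \<times> idx l"
    then obtain I J where p: "p = (I, J)" "I \<in> idx k" "J \<in> idx l" by auto
    then show "(take k (case p of (I, J) \<Rightarrow> I @ J), drop k (case p of (I, J) \<Rightarrow> I @ J)) = p"
      by (simp add: idx_length)
    show "(case p of (I, J) \<Rightarrow> I @ J) \<in> idx (k + l)" using p by (simp add: idx_append)
    show "g (case p of (I, J) \<Rightarrow> I @ J) = (case p of (I, J) \<Rightarrow> g (I @ J))" using p by simp
  next
    fix K assume "K \<in> idx (k + l)"
    then show "(take k K, drop k K) \<in> idx k \<times> idx l" using idx_split by simp
  qed simp
  finally show ?thesis by simp
qed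

section \<open>Tensor coefficients of linear combinations of diagrams\<close>

definition coefficient :: "morphism \<Rightarrow> nat list \<Rightarrow> nat list \<Rightarrow> complex" where
  "coefficient f I J = (\<Sum>D\<in>Poly_Mapping.keys f. Poly_Mapping.lookup f D * weight D I J)"

lemma coefficient_superset:
  assumes "finite S" "Poly_Mapping.keys f \<subseteq> S"
  shows "coefficient f I J = (\<Sum>D\<in>S. Poly_Mapping.lookup f D * weight D I J)"
  unfolding coefficient_def
  by (rule sum.mono_neutral_left) (use assms in \<open>auto simp: in_keys_iff\<close>)

lemma coefficient_add: "coefficient (f + g) I J = coefficient f I J + coefficient g I J"
proof -
  let ?S = "Poly_Mapping.keys f \<union> Poly_Mapping.keys g"
  have "coefficient (f + g) I J = (\<Sum>D\<in>?S. Poly_Mapping.lookup (f + g) D * weight D I J)"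
    by (rule coefficient_superset) (simp_all add: keys_add)
  also have "\<dots> = coefficient f I J + coefficient g I J"
    by (simp add: coefficient_superset[of ?S f] coefficient_superset[of ?S g] lookup_add distrib_right sum.distrib)
  finally show ?thesis .
qed

lemma coefficient_single: "coefficient (Poly_Mapping.single D c) I J = c * weight D I J"
  by (cases "c = 0") (simp_all add: coefficient_def)

lemma coefficient_sum: "finite S \<Longrightarrow> coefficient (\<Sum>x\<in>S. f x) I J = (\<Sum>x\<in>S. coefficient (f x) I J)"
proof (induction S rule: finite_induct)
  case empty
  show ?case by (simp add: coefficient_def)
qed (simp add: coefficient_add)

lemma coefficient_smult: "coefficient (Defs.smult c f) I J = c * coefficient f I J"
proof -
  have lookup: "Poly_Mapping.lookup (Defs.smult c f) D = c * Poly_Mapping.lookup f D" for D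
    by (simp add: Defs.smult_def Poly_Mapping.map.rep_eq when_def)
  have "coefficient (Defs.smult c f) I J =
      (\<Sum>D\<in>Poly_Mapping.keys f. Poly_Mapping.lookup (Defs.smult c f) D * weight D I J)"
    by (rule coefficient_superset) (auto simp: in_keys_iff lookup)
  then show ?thesis by (simp add: coefficient_def lookup sum_distrib_left mult.assoc)
qed

text \<open>The linear extension of \<open>weight_vconcat\<close>: composition of morphisms becomes
  multiplication of coefficient matrices, the scalar for the loops being absorbed.\<close>

lemma coefficient_comp:
  assumes "f \<in> Defs.hom w w'" "g \<in> Defs.hom w' w''" "I \<in> idx (length w)" "J \<in> idx (length w'')"
  shows "coefficient (comp d g f) I J = (\<Sum>M\<in>idx (length w'). coefficient f I M * coefficient g M J)"
proof -
  let ?l = Poly_Mapping.lookup and ?k = Poly_Mapping.keys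
  have "coefficient (comp d g f) I J =
      (\<Sum>D\<in>?k f. \<Sum>D'\<in>?k g. ?l f D * ?l g D' * (d ^ loops D D' * weight (vconcat D D') I J))"
    by (simp add: comp_def coefficient_sum coefficient_single mult.assoc)
  also have "\<dots> = (\<Sum>D\<in>?k f. \<Sum>D'\<in>?k g. ?l f D * ?l g D' * (\<Sum>M\<in>idx (length w'). weight D I M * weight D' M J))"
  proof (intro sum.cong refl)
    fix D D' assume "D \<in> ?k f" "D' \<in> ?k g"
    then have "D \<in> K w w'" "D' \<in> K w' w''" using assms(1,2) by (auto simp: hom_def)
    from weight_vconcat[OF this assms(3,4)]
    show "?l f D * ?l g D' * (d ^ loops D D' * weight (vconcat D D') I J) =
        ?l f D * ?l g D' * (\<Sum>M\<in>idx (length w'). weight D I M * weight D' M J)" by simp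
  qed
  also have "\<dots> = (\<Sum>D\<in>?k f. \<Sum>D'\<in>?k g. \<Sum>M\<in>idx (length w'). (?l f D * weight D I M) * (?l g D' * weight D' M J))"
    by (simp add: sum_distrib_left mult_ac)
  also have "\<dots> = (\<Sum>D\<in>?k f. \<Sum>M\<in>idx (length w'). \<Sum>D'\<in>?k g. (?l f D * weight D I M) * (?l g D' * weight D' M J))"
    by (rule sum.cong[OF refl], rule sum.swap)
  also have "\<dots> = (\<Sum>M\<in>idx (length w'). \<Sum>D\<in>?k f. \<Sum>D'\<in>?k g. (?l f D * weight D I M) * (?l g D' * weight D' M J))"
    by (rule sum.swap)
  also have "\<dots> = (\<Sum>M\<in>idx (length w'). coefficient f I M * coefficient g M J)"
    by (simp add: coefficient_def sum_product)
  finally show ?thesis .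
qed

lemma coefficient_tensor:
  assumes f: "f \<in> Defs.hom w1 w1'" and g: "g \<in> Defs.hom w2 w2'"
    and I: "I \<in> idx (length w1)" "I' \<in> idx (length w2)" and J: "J \<in> idx (length w1')" "J' \<in> idx (length w2')"
  shows "coefficient (tensor (length w1) (length w1') f g) (I @ I') (J @ J') = coefficient f I J * coefficient g I' J'"
proof -
  let ?l = Poly_Mapping.lookup and ?k = Poly_Mapping.keys
  have "coefficient (tensor (length w1) (length w1') f g) (I @ I') (J @ J') =
      (\<Sum>D\<in>?k f. \<Sum>D'\<in>?k g. ?l f D * ?l g D' * weight (hconcat (length w1) (length w1') D D') (I @ I') (J @ J'))"
    by (simp add: tensor_def coefficient_sum coefficient_single)
  also have "\<dots> = (\<Sum>D\<in>?k f. \<Sum>D'\<in>?k g. (?l f D * weight D I J) * (?l g D' * weight D' I' J'))"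
  proof (intro sum.cong refl)
    fix D D' assume "D \<in> ?k f" "D' \<in> ?k g"
    then have "D \<in> K w1 w1'" "D' \<in> K w2 w2'" using f g by (auto simp: hom_def)
    from weight_hconcat[OF K_matching[OF this(1)] K_matching[OF this(2)], of I J I' J']
    show "?l f D * ?l g D' * weight (hconcat (length w1) (length w1') D D') (I @ I') (J @ J') =
        ?l f D * weight D I J * (?l g D' * weight D' I' J')" using I J by (simp add: idx_length)
  qed
  also have "\<dots> = coefficient f I J * coefficient g I' J'"
    by (simp add: coefficient_def sum_product)
  finally show ?thesis .
qed

section \<open>The functor of a matrix and its axioms\<close>

definition matrix_data :: "'v functor_data" where
  "matrix_data = \<lparr>obj = \<lambda>w. power_space (length w),
     mor = \<lambda>w w' f. lin (length w) (\<lambda>I. \<Sum>J\<in>idx (length w'). coefficient f I J *s e J),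
     tens = \<lambda>w w' a b. lin (length w) (\<lambda>I. lin (length w') (\<lambda>J. e (I @ J)) b) a,
     one = e []\<rparr>"

lemma matrix_data_simps [simp]:
  "obj matrix_data w = power_space (length w)"
  "mor matrix_data w w' f = lin (length w) (\<lambda>I. \<Sum>J\<in>idx (length w'). coefficient f I J *s e J)"
  "one matrix_data = e []"
  by (simp_all add: matrix_data_def)

definition ten :: "nat \<Rightarrow> nat \<Rightarrow> 'v \<Rightarrow> 'v \<Rightarrow> 'v" where
  "ten k l a b = lin k (\<lambda>I. lin l (\<lambda>J. e (I @ J)) b) a"

lemma tens_matrix_data [simp]: "tens matrix_data w w' = ten (length w) (length w')"
  by (simp add: matrix_data_def ten_def fun_eq_iff)

lemma ten_e: "I \<in> idx k \<Longrightarrow> J \<in> idx l \<Longrightarrow> ten k l (e I) (e J) = e (I @ J)"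
  by (simp add: ten_def lin_e)

lemma ten_linear_left:
  "linear_between (power_space k) (power_space (k + l)) (\<lambda>a. ten k l a b)"
  unfolding ten_def
proof (rule lin_linear[OF subspace_power_space])
  fix I assume "I \<in> idx k"
  then show "lin l (\<lambda>J. e (I @ J)) b \<in> power_space (k + l)"
    unfolding lin_def by (intro subspace_sum[OF subspace_power_space] subspace_scale[OF subspace_power_space] e_mem idx_append)
qed

lemma ten_linear_right:
  "linear_between (power_space l) (power_space (k + l)) (ten k l a)"
proof -
  have l: "linear_between (power_space l) (power_space (k + l)) (lin l (\<lambda>J. e (I @ J)))" if "I \<in> idx k" for I
    using that by (intro lin_linear[OF subspace_power_space] e_mem idx_append)
  have "ten k l a b \<in> power_space (k + l)" if "b \<in> power_space l" for b
    unfolding ten_def lin_def[of k]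
    using linear_between_mem[OF l that] by (intro subspace_sum[OF subspace_power_space] subspace_scale[OF subspace_power_space])
  moreover have "ten k l a (b + c) = ten k l a b + ten k l a c" if "b \<in> power_space l" "c \<in> power_space l" for b c
    unfolding ten_def lin_def[of k] using linear_between_add[OF l that] by (simp add: scale_right_distrib sum.distrib)
  moreover have "ten k l a (r *s b) = r *s ten k l a b" if "b \<in> power_space l" for r b
    unfolding ten_def lin_def[of k] using linear_between_scale[OF l that]
    by (simp add: scale_sum_right mult.commute)
  ultimately show ?thesis by (simp add: linear_between_def)
qed

lemma ten_bilinear: "bilinear_between (power_space k) (power_space l) (power_space (k + l)) (ten k l)"
  using ten_linear_left ten_linear_right by (simp add: bilinear_between_def)

lemma bilinear_ext:
  assumes f: "bilinear_between (power_space k) (power_space l) Z f" and g: "bilinear_between (power_space k) (power_space l) Z g"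
    and eq: "\<And>I J. I \<in> idx k \<Longrightarrow> J \<in> idx l \<Longrightarrow> f (e I) (e J) = g (e I) (e J)"
    and ab: "a \<in> power_space k" "b \<in> power_space l"
  shows "f a b = g a b"
proof (rule power_space_ext[OF bilinear_betweenD(2)[OF f ab(2)] bilinear_betweenD(2)[OF g ab(2)] _ ab(1)])
  fix I assume I: "I \<in> idx k"
  show "f (e I) b = g (e I) b"
    by (rule power_space_ext[OF bilinear_betweenD(1)[OF f e_mem[OF I]] bilinear_betweenD(1)[OF g e_mem[OF I]] eq[OF I] ab(2)])
qed

lemma ten_is_tensor_product:
  "is_tensor_product (power_space k) (power_space l) (power_space (k + l)) (ten k l)"
  unfolding is_tensor_product_def
proof (intro conjI allI impI)
  show "bilinear_between (power_space k) (power_space l) (power_space (k + l)) (ten k l)" by (rule ten_bilinear)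
  fix Z and b :: "'v \<Rightarrow> 'v \<Rightarrow> 'v" assume Z: "subspace Z" and b: "bilinear_between (power_space k) (power_space l) Z b"
  \<comment> \<open>Cutting an index list after \<open>k\<close> places recovers the two factors of
    a basis vector, which dictates the factoring map.\<close>
  define L where "L = lin (k + l) (\<lambda>K. b (e (take k K)) (e (drop k K)))"
  have L: "linear_between (power_space (k + l)) Z L"
    unfolding L_def by (rule lin_linear[OF Z]) (use idx_split bilinear_mem[OF b] e_mem in blast)
  have L_e: "L (ten k l (e I) (e J)) = b (e I) (e J)" if "I \<in> idx k" "J \<in> idx l" for I J
    using that by (simp add: ten_e L_def lin_e idx_append idx_length)
  have L_b: "L (ten k l x y) = b x y" if "x \<in> power_space k" "y \<in> power_space l" for x y
    by (rule bilinear_ext[OF bilinear_comp[OF ten_bilinear L] b L_e that])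
  have "L' z = L z" if L': "linear_between (power_space (k + l)) Z L'"
    "\<forall>x\<in>power_space k. \<forall>y\<in>power_space l. L' (ten k l x y) = b x y" and z: "z \<in> power_space (k + l)" for L' z
  proof (rule power_space_ext[OF L'(1) L _ z])
    fix K assume "K \<in> idx (k + l)"
    then have K: "take k K \<in> idx k" "drop k K \<in> idx l" using idx_split by auto
    then have "e K = ten k l (e (take k K)) (e (drop k K))" by (simp add: ten_e)
    then show "L' (e K) = L (e K)" using L'(2) L_b e_mem[OF K(1)] e_mem[OF K(2)] by metis
  qed
  then show "\<exists>L. linear_between (power_space (k + l)) Z L \<and>
      (\<forall>x\<in>power_space k. \<forall>y\<in>power_space l. L (ten k l x y) = b x y) \<and>
      (\<forall>L'. linear_between (power_space (k + l)) Z L' \<longrightarrow>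
        (\<forall>x\<in>power_space k. \<forall>y\<in>power_space l. L' (ten k l x y) = b x y) \<longrightarrow>
        (\<forall>z\<in>power_space (k + l). L' z = L z))"
    using L L_b by blast
qed

text \<open>On basis vectors both sides are the vector of the concatenated list, so strictness is
  the associativity of list concatenation.\<close>

lemma ten_assoc:
  assumes "a \<in> power_space k" "b \<in> power_space l" "c \<in> power_space m"
  shows "ten (k + l) m (ten k l a b) c = ten k (l + m) a (ten l m b c)"
proof (rule bilinear_ext[OF _ _ _ assms(1,2), where Z = "power_space (k + l + m)"])
  show "bilinear_between (power_space k) (power_space l) (power_space (k + l + m)) (\<lambda>a b. ten (k + l) m (ten k l a b) c)"
    by (rule bilinear_comp[OF ten_bilinear ten_linear_left])
  show "bilinear_between (power_space k) (power_space l) (power_space (k + l + m)) (\<lambda>a b. ten k (l + m) a (ten l m b c))"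
    unfolding bilinear_between_def
    using linear_between_comp[OF ten_linear_left ten_linear_right[of "l + m" k]] ten_linear_left[of k "l + m"]
    by (simp add: add.assoc)
  fix I J assume I: "I \<in> idx k" and J: "J \<in> idx l"
  show "ten (k + l) m (ten k l (e I) (e J)) c = ten k (l + m) (e I) (ten l m (e J) c)"
  proof (rule power_space_ext[OF ten_linear_right _ _ assms(3)])
    show "linear_between (power_space m) (power_space (k + l + m)) (\<lambda>c. ten k (l + m) (e I) (ten l m (e J) c))"
      using linear_between_comp[OF ten_linear_right[of m l] ten_linear_right[of "l + m" k]] by (simp add: add.assoc)
    fix K assume "K \<in> idx m"
    then show "ten (k + l) m (ten k l (e I) (e J)) (e K) = ten k (l + m) (e I) (ten l m (e J) (e K))"
      using I J by (simp add: ten_e idx_append)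
  qed
qed

lemma idx_0: "idx 0 = {[]}"
  by (auto simp: idx_def)

lemma mor_linear_matrix:
  "linear_between (power_space k) (power_space l) (lin k (\<lambda>I. \<Sum>J\<in>idx l. coefficient f I J *s e J))"
  by (intro lin_linear[OF subspace_power_space] subspace_sum[OF subspace_power_space]
      subspace_scale[OF subspace_power_space] e_mem)

lemma mor_tensor_matrix:
  assumes f: "f \<in> Defs.hom w1 w1'" and g: "g \<in> Defs.hom w2 w2'"
    and ab: "a \<in> power_space (length w1)" "b \<in> power_space (length w2)"
  shows "lin (length w1 + length w2) (\<lambda>I. \<Sum>J\<in>idx (length w1' + length w2').
        coefficient (tensor (length w1) (length w1') f g) I J *s e J) (ten (length w1) (length w2) a b) =
    ten (length w1') (length w2') (lin (length w1) (\<lambda>I. \<Sum>J\<in>idx (length w1'). coefficient f I J *s e J) a)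
      (lin (length w2) (\<lambda>I. \<Sum>J\<in>idx (length w2'). coefficient g I J *s e J) b)"
proof (rule bilinear_ext[OF _ _ _ ab])
  define k l k' l' where kl: "k = length w1" "l = length w2" "k' = length w1'" "l' = length w2'"
  let ?F = "lin k (\<lambda>I. \<Sum>J\<in>idx k'. coefficient f I J *s e J)"
  let ?G = "lin l (\<lambda>I. \<Sum>J\<in>idx l'. coefficient g I J *s e J)"
  show "bilinear_between (power_space (length w1)) (power_space (length w2)) (power_space (length w1' + length w2'))
     (\<lambda>a b. lin (length w1 + length w2) (\<lambda>I. \<Sum>J\<in>idx (length w1' + length w2').
        coefficient (tensor (length w1) (length w1') f g) I J *s e J) (ten (length w1) (length w2) a b))"
    by (rule bilinear_comp[OF ten_bilinear mor_linear_matrix])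
  show "bilinear_between (power_space (length w1)) (power_space (length w2)) (power_space (length w1' + length w2'))
     (\<lambda>a b. ten (length w1') (length w2') (lin (length w1) (\<lambda>I. \<Sum>J\<in>idx (length w1'). coefficient f I J *s e J) a)
      (lin (length w2) (\<lambda>I. \<Sum>J\<in>idx (length w2'). coefficient g I J *s e J) b))"
    unfolding bilinear_between_def
    using linear_between_comp[OF mor_linear_matrix ten_linear_right] linear_between_comp[OF mor_linear_matrix ten_linear_left]
    by blast
  fix I J assume I: "I \<in> idx (length w1)" and J: "J \<in> idx (length w2)"
  have "(\<Sum>M\<in>idx (k' + l'). coefficient (tensor k k' f g) (I @ J) M *s e M) =
      (\<Sum>M\<in>idx k'. \<Sum>M'\<in>idx l'. (coefficient f I M * coefficient g J M') *s e (M @ M'))"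
    unfolding sum_idx_append
    by (intro sum.cong refl) (use coefficient_tensor[OF f g I J] in \<open>simp add: kl\<close>)
  also have "\<dots> = ten k' l' (\<Sum>M\<in>idx k'. coefficient f I M *s e M) (\<Sum>M'\<in>idx l'. coefficient g J M' *s e M')"
  proof -
    have G_mem: "(\<Sum>M'\<in>idx l'. coefficient g J M' *s e M') \<in> power_space l'"
      by (intro subspace_sum[OF subspace_power_space] subspace_scale[OF subspace_power_space] e_mem)
    have "ten k' l' (\<Sum>M\<in>idx k'. coefficient f I M *s e M) (\<Sum>M'\<in>idx l'. coefficient g J M' *s e M') =
        (\<Sum>M\<in>idx k'. coefficient f I M *s ten k' l' (e M) (\<Sum>M'\<in>idx l'. coefficient g J M' *s e M'))"
      by (rule linear_between_lincomb[OF ten_linear_left subspace_power_space]) (simp_all add: e_mem)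
    also have "\<dots> = (\<Sum>M\<in>idx k'. coefficient f I M *s (\<Sum>M'\<in>idx l'. coefficient g J M' *s e (M @ M')))"
    proof (rule sum.cong[OF refl])
      fix M assume M: "M \<in> idx k'"
      have "ten k' l' (e M) (\<Sum>M'\<in>idx l'. coefficient g J M' *s e M') =
          (\<Sum>M'\<in>idx l'. coefficient g J M' *s ten k' l' (e M) (e M'))"
        by (rule linear_between_lincomb[OF ten_linear_right subspace_power_space]) (simp_all add: e_mem)
      then show "coefficient f I M *s ten k' l' (e M) (\<Sum>M'\<in>idx l'. coefficient g J M' *s e M') =
          coefficient f I M *s (\<Sum>M'\<in>idx l'. coefficient g J M' *s e (M @ M'))"
        using M by (simp add: ten_e)
    qed
    finally show ?thesis by (simp add: scale_sum_right)
  qed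
  finally show "lin (length w1 + length w2) (\<lambda>I. \<Sum>J\<in>idx (length w1' + length w2').
        coefficient (tensor (length w1) (length w1') f g) I J *s e J) (ten (length w1) (length w2) (e I) (e J)) =
    ten (length w1') (length w2') (lin (length w1) (\<lambda>I. \<Sum>J\<in>idx (length w1'). coefficient f I J *s e J) (e I))
      (lin (length w2) (\<lambda>I. \<Sum>J\<in>idx (length w2'). coefficient g I J *s e J) (e J))"
    using I J by (simp add: ten_e lin_e idx_append kl)
qed

lemma mor_comp_matrix:
  assumes f: "f \<in> Defs.hom w w'" and g: "g \<in> Defs.hom w' w''" and a: "a \<in> power_space (length w)"
  shows "lin (length w) (\<lambda>I. \<Sum>J\<in>idx (length w''). coefficient (comp d g f) I J *s e J) a =
    lin (length w') (\<lambda>I. \<Sum>J\<in>idx (length w''). coefficient g I J *s e J)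
      (lin (length w) (\<lambda>I. \<Sum>J\<in>idx (length w'). coefficient f I J *s e J) a)"
proof (rule power_space_ext[OF mor_linear_matrix linear_between_comp[OF mor_linear_matrix mor_linear_matrix] _ a])
  let ?G = "\<lambda>I. \<Sum>J\<in>idx (length w''). coefficient g I J *s e J"
  fix I assume I: "I \<in> idx (length w)"
  have "lin (length w') ?G (\<Sum>M\<in>idx (length w'). coefficient f I M *s e M) =
      (\<Sum>M\<in>idx (length w'). coefficient f I M *s lin (length w') ?G (e M))"
    by (rule linear_between_lincomb[OF mor_linear_matrix subspace_power_space]) (simp_all add: e_mem)
  also have "\<dots> = (\<Sum>M\<in>idx (length w'). \<Sum>J\<in>idx (length w''). (coefficient f I M * coefficient g M J) *s e J)"
    by (intro sum.cong refl) (simp add: lin_e scale_sum_right)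
  also have "\<dots> = (\<Sum>J\<in>idx (length w''). (\<Sum>M\<in>idx (length w'). coefficient f I M * coefficient g M J) *s e J)"
    unfolding scale_sum_left by (rule sum.swap)
  also have "\<dots> = (\<Sum>J\<in>idx (length w''). coefficient (comp d g f) I J *s e J)"
    by (intro sum.cong refl) (simp add: coefficient_comp[OF f g I])
  finally show "lin (length w) (\<lambda>I. \<Sum>J\<in>idx (length w''). coefficient (comp d g f) I J *s e J) (e I) =
    lin (length w') ?G (lin (length w) (\<lambda>I. \<Sum>J\<in>idx (length w'). coefficient f I J *s e J) (e I))"
    using I by (simp add: lin_e)
qed

lemma e_nonzero: "e I \<noteq> 0"
  using independent_e dependent_zero by (metis rangeI)

lemma fiber_functor_matrix_data: "fiber_functor scale d matrix_data"
proof
  fix w :: word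
  show "fin_dim (obj matrix_data w)"
    unfolding fin_dim_def matrix_data_simps
    by (intro conjI subspace_power_space exI[of _ "e ` idx (length w)"]) (simp_all add: power_space_def)
next
  fix f and w w' :: word
  show "linear_between (obj matrix_data w) (obj matrix_data w') (mor matrix_data w w' f)"
    by (simp add: mor_linear_matrix)
next
  fix a w assume "a \<in> obj matrix_data w"
  then have a: "a \<in> power_space (length w)" by simp
  have "lin (length w) (\<lambda>I. \<Sum>J\<in>idx (length w). coefficient (ident w) I J *s e J) a = lin (length w) e a"
  proof (rule power_space_ext[OF mor_linear_matrix lin_linear[OF subspace_power_space e_mem] _ a])
    fix I assume I: "I \<in> idx (length w)"
    have "(\<Sum>J\<in>idx (length w). coefficient (ident w) I J *s e J) = (\<Sum>J\<in>idx (length w). if J = I then e J else 0)"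
      by (rule sum.cong) (use I in \<open>auto simp: ident_def coefficient_single weight_id idx_length\<close>)
    then show "lin (length w) (\<lambda>I. \<Sum>J\<in>idx (length w). coefficient (ident w) I J *s e J) (e I) = lin (length w) e (e I)"
      using I by (simp add: lin_e)
  qed
  then show "mor matrix_data w w (ident w) a = a" using a by (simp add: lin_e_eq)
next
  fix f g w w' w'' a assume "f \<in> Defs.hom w w'" "g \<in> Defs.hom w' w''" "a \<in> obj matrix_data w"
  then show "mor matrix_data w w'' (comp d g f) a = mor matrix_data w' w'' g (mor matrix_data w w' f a)"
    by (simp add: mor_comp_matrix)
next
  fix f g a and w w' :: word
  show "mor matrix_data w w' (f + g) a = mor matrix_data w w' f a + mor matrix_data w w' g a"
    by (simp add: lin_def coefficient_add scale_left_distrib scale_right_distrib sum.distrib)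
next
  fix f a c and w w' :: word
  show "mor matrix_data w w' (Defs.smult c f) a = c *s mor matrix_data w w' f a"
    by (simp add: lin_def coefficient_smult scale_sum_right mult_ac)
next
  fix w w' :: word
  show "is_tensor_product (obj matrix_data w) (obj matrix_data w') (obj matrix_data (w @ w')) (tens matrix_data w w')"
    by (simp add: ten_is_tensor_product)
next
  fix a b c and w w' w'' :: word
  assume "a \<in> obj matrix_data w" "b \<in> obj matrix_data w'" "c \<in> obj matrix_data w''"
  then show "tens matrix_data (w @ w') w'' (tens matrix_data w w' a b) c =
      tens matrix_data w (w' @ w'') a (tens matrix_data w' w'' b c)"
    by (simp add: ten_assoc)
next
  show "one matrix_data \<noteq> 0" by (simp add: e_nonzero)
  show "obj matrix_data [] = span {one matrix_data}" by (simp add: power_space_def idx_0)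
next
  fix a and w :: word assume "a \<in> obj matrix_data w"
  then have a: "a \<in> power_space (length w)" by simp
  have nil: "[] \<in> idx 0" by (simp add: idx_0)
  have "ten 0 (length w) (e []) a = lin (length w) e a"
    by (rule power_space_ext[OF _ lin_linear[OF subspace_power_space e_mem] _ a])
      (use ten_linear_right[of "length w" 0 "e []"] in \<open>simp_all add: ten_e nil lin_e\<close>)
  then show "tens matrix_data [] w (one matrix_data) a = a" using a by (simp add: lin_e_eq)
  have "ten (length w) 0 a (e []) = lin (length w) e a"
    by (rule power_space_ext[OF _ lin_linear[OF subspace_power_space e_mem] _ a])
      (use ten_linear_left[of "length w" 0 "e []"] in \<open>simp_all add: ten_e nil lin_e\<close>)
  then show "tens matrix_data w [] a (one matrix_data) = a" using a by (simp add: lin_e_eq)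
next
  fix f g a b and w1 w1' w2 w2' :: word
  assume "f \<in> Defs.hom w1 w1'" "g \<in> Defs.hom w2 w2'" "a \<in> obj matrix_data w1" "b \<in> obj matrix_data w2"
  then show "mor matrix_data (w1 @ w2) (w1' @ w2') (tensor (length w1) (length w1') f g) (tens matrix_data w1 w2 a b) =
      tens matrix_data w1' w2' (mor matrix_data w1 w1' f a) (mor matrix_data w2 w2' g b)"
    by (simp add: mor_tensor_matrix)
qed

text \<open>Both letters are sent to the same space, and the vectors \<open>e [i]\<close> serve as
  both bases: \<open>E\<close> has the identity matrix on them and \<open>F\<close> has the matrix
  \<open>B\<close>.\<close>

lemma attached_matrix_data: "mat N N (\<lambda>(j, i). B j i) \<in> attached_matrices matrix_data"
proof -
  interpret F: fiber_functor scale d matrix_data by (rule fiber_functor_matrix_data)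
  have idx1: "idx 1 = (\<lambda>i. [i]) ` {..<N}"
    by (auto simp: idx_def length_Suc_conv image_iff)
  have form: "F.form x (e [i]) (e [j]) = cap_entry x i j" if "i < N" "j < N" for x i j
  proof -
    have ij: "[i] \<in> idx 1" "[j] \<in> idx 1" "[i, j] \<in> idx 2" using that by (auto simp: idx_def)
    have "F.form x (e [i]) (e [j]) *s e [] = weight {up_arc x 0} [i, j] [] *s e []"
      using F.form_eq[of "e [i]" x "e [j]"] ij e_mem[OF ij(1)] e_mem[OF ij(2)]
      by (simp add: ten_e lin_e idx_0 coefficient_single numeral_2_eq_2 e_nonzero)
    also have "weight {up_arc x 0} [i, j] [] = cap_entry x i j"
      by (simp add: weight_def string_weight_up_arc)
    finally show ?thesis using e_nonzero[of "[]"] by simp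
  qed
  have inj: "inj_on (\<lambda>i. e [i]) {..<N}"
    by (rule inj_onI) (simp add: inj_eq[OF inj_e])
  have "independent ((\<lambda>i. e [i]) ` {..<N})" by (rule independent_mono[OF independent_e]) auto
  moreover have "span ((\<lambda>i. e [i]) ` {..<N}) = power_space 1" unfolding power_space_def idx1 image_image ..
  ultimately have bas: "basis_of (power_space 1) N (\<lambda>i. e [i])" using inj by (simp add: basis_of_def)
  have "F.dual_bases N (\<lambda>i. e [i]) (\<lambda>i. e [i])"
    unfolding F.dual_bases_def using bas form[of _ _ X] by (simp add: F.form_X[symmetric] cap_entry_def)
  moreover have "F.form_matrix N (\<lambda>i. e [i]) (\<lambda>i. e [i]) = mat N N (\<lambda>(j, i). B j i)"
    unfolding F.form_matrix_def using form[of _ _ X_star]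
    by (intro eq_matI) (simp_all add: F.form_X_star[symmetric] cap_entry_def)
  ultimately show ?thesis unfolding F.attached_iff by metis
qed

end

subsection \<open>The classification\<close>

lemma similar_orbit_eq:
  assumes "similar_mat A B"
  shows "{M. similar_mat M A} = {M. similar_mat M B}"
  using assms similar_mat_trans similar_mat_sym by blast

lemma (in vect_universe) independent_family:
  obtains e :: "nat list \<Rightarrow> 'v" where "inj e" "independent (range e)"
proof -
  obtain S where S: "infinite S" "independent S" using infinite_dimensional by blast
  then obtain f :: "nat \<Rightarrow> 'v" where f: "inj f" "range f \<subseteq> S" using infinite_countable_subset by blast
  \<comment> \<open>An infinite independent set contains a sequence of distinct vectors, and lists
    of numbers are countable.\<close>
  have "inj (\<lambda>I. f (list_encode I))"
    using f(1) inj_list_encode[of UNIV] by (auto simp: inj_def inj_on_def)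
  moreover have "independent (range (\<lambda>I. f (list_encode I)))"
    by (rule independent_mono[OF S(2)]) (use f(2) in auto)
  ultimately show ?thesis by (rule that)
qed

text \<open>The attached matrices of the constructed functor form one similarity class, and this
  class contains the given matrix.\<close>

lemma (in vect_universe) orbit_realised:
  assumes "\<O> \<in> similarity_orbits d"
  shows "\<exists>\<Phi>. fiber_functor scale d \<Phi> \<and> attached_matrices \<Phi> = \<O>"
proof -
  obtain n B where B: "B \<in> trace_matrices n d" and orbit: "\<O> = {A. similar_mat A B}"
    using assms unfolding similarity_orbits_def by blast
  then obtain C where C: "B \<in> carrier_mat n n" "C \<in> carrier_mat n n" "inverts_mat B C" "inverts_mat C B"
    "mat_trace B = d" "mat_trace C = d"
    unfolding trace_matrices_def by auto
  have BC: "B * C = 1\<^sub>m n" "C * B = 1\<^sub>m n"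
    using C unfolding inverts_mat_def by auto
  have mult: "(\<Sum>k<n. P $$ (i, k) * Q $$ (k, j)) = (if i = j then 1 else 0)"
    if "P * Q = 1\<^sub>m n" "P \<in> carrier_mat n n" "Q \<in> carrier_mat n n" "i < n" "j < n" for P Q :: "complex mat" and i j
    using arg_cong[OF that(1), of "\<lambda>M. M $$ (i, j)"] that(2-) by (simp add: scalar_prod_def atLeast0LessThan)
  obtain e :: "nat list \<Rightarrow> 'v" where e: "inj e" "independent (range e)" by (rule independent_family)
  interpret matrix_functor scale n "\<lambda>i j. B $$ (i, j)" "\<lambda>i j. C $$ (i, j)" d e
    by unfold_locales (use C BC mult e in \<open>auto simp: mat_trace_def\<close>)
  interpret F: fiber_functor scale d matrix_data by (rule fiber_functor_matrix_data)
  obtain m v w where vw: "F.dual_bases m v w" using F.dual_bases_exist by blast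
  note cl = F.attached_class[OF vw]
  have "mat n n (\<lambda>(j, i). B $$ (j, i)) = B" by (rule eq_matI) (use C(1) in auto)
  then have "similar_mat B (F.form_matrix m v w)" using attached_matrix_data cl by simp
  then have "attached_matrices matrix_data = \<O>" unfolding cl orbit by (rule similar_orbit_eq[symmetric])
  then show ?thesis using fiber_functor_matrix_data by blast
qed

text \<open>Equivalence classes of functors are not formed as objects; the bijection with the orbits
  is split into values in the orbits, equal values exactly for equivalent functors, and
  surjectivity.\<close>

theorem theorem5p1:
  fixes scale :: "complex \<Rightarrow> 'v::ab_group_add \<Rightarrow> 'v" and d :: complex
  assumes "vect_universe scale" and "d \<noteq> 0"
  shows "(\<forall>\<Phi>. fiber_functor scale d \<Phi> \<longrightarrow>
            vect_universe.attached_matrices scale \<Phi> \<in> similarity_orbits d) \<and>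
         (\<forall>\<Phi> \<Psi>. fiber_functor scale d \<Phi> \<longrightarrow> fiber_functor scale d \<Psi> \<longrightarrow>
            (vect_universe.naturally_equivalent scale \<Phi> \<Psi> \<longleftrightarrow>
             vect_universe.attached_matrices scale \<Phi> = vect_universe.attached_matrices scale \<Psi>)) \<and>
         (\<forall>\<O>\<in>similarity_orbits d. \<exists>\<Phi>. fiber_functor scale d \<Phi> \<and>
            vect_universe.attached_matrices scale \<Phi> = \<O>)"
proof (intro conjI allI impI ballI)
  fix \<Phi> assume "fiber_functor scale d \<Phi>"
  then show "vect_universe.attached_matrices scale \<Phi> \<in> similarity_orbits d"
    by (rule fiber_functor.attached_in_orbits[OF _ assms(2)])
next
  fix \<Phi> \<Psi> assume "fiber_functor scale d \<Phi>" "fiber_functor scale d \<Psi>"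
  then interpret two_fiber_functors scale d \<Phi> \<Psi> using assms(1) by (simp add: two_fiber_functors_def)
  show "naturally_equivalent \<Phi> \<Psi> \<longleftrightarrow> attached_matrices \<Phi> = attached_matrices \<Psi>"
    using naturally_equivalent_imp attached_eq_imp by blast
next
  fix \<O> assume "\<O> \<in> similarity_orbits d"
  then show "\<exists>\<Phi>. fiber_functor scale d \<Phi> \<and> vect_universe.attached_matrices scale \<Phi> = \<O>"
    by (rule vect_universe.orbit_realised[OF assms(1)])
qed

end
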